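(* Let $(\Sigma,\sigma)$ be a topologically mixing countable Markov shift of finite entropy with vertex set $V=\mathbb{N}$, let $\rho$ be a totally bounded metric on $V$, and let $d=d_{\rho,\theta}$, $\theta\in(0,1)$, be the corresponding metric on $\Sigma$. Let $\bar\Sigma$ be the completion of $(\Sigma,d)$ with the extended shift $\bar\sigma$. If $V$ is sectorially arranged with respect to $\rho$ and $\phi\in UC_d(\Sigma)$, then $$P_\Sigma(\phi)=P_{\bar\Sigma}(\phi),$$ where on the right-hand side $\phi$ also denotes its unique continuous extension to $\bar\Sigma$.
   Context: Countable Markov shift: let $A=(a_{i,j})$ be an $\mathbb{N}\times\mathbb{N}$ matrix with entries in $\{0,1\}$ ($\mathbb{N}=\{1,2,\dots\}$, $\mathbb{N}_0=\{0,1,2,\dots\}$), $\Sigma=\{\underline{x}=(x_0,x_1,\ldots)\in\mathbb{N}^{\mathbb{N}_0}: a_{x_n,x_{n+1}}=1 \text{ for all } n\}$, with the topology generated by cylinder sets (sets of all $\underline y\in\Sigma$ with finitely many prescribed initial symbols), and $\sigma:\Sigma\to\Sigma$ the left shift. The vertex set is $V=\mathbb{N}$. Topologically mixing means, as in the paper: for all $i,j\in V$ there is a finite path $i=x_0,x_1,\ldots,x_\ell=j$ ($\ell\ge 1$) with $a_{x_k,x_{k+1}}=1$ for $k=0,\ldots,\ell-1$. Pressure on $\Sigma$: for continuous $\phi:\Sigma\to\mathbb{R}$, $P_\Sigma(\phi)=\sup\{h(\mu)+\int\phi\,d\mu : \mu \text{ a } \sigma\text{-invariant Borel probability measure on }\Sigma,\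 \int\phi\,d\mu>-\infty\}$, where $h(\mu)$ is the measure-theoretic entropy. Finite entropy means $h_{top}(\sigma)=P_\Sigma(0)<\infty$. Metric: $\rho:V\times V\to[0,1]$ is a metric on $V$ inducing the discrete topology, and for $\theta\in(0,1)$, $d(\underline{x},\underline{y})=d_{\rho,\theta}(\underline{x},\underline{y})=\sum_{n\ge0}\theta^n\rho(x_n,y_n)$; it generates the cylinder topology and $\sigma$ is uniformly continuous for $d$. $\bar\Sigma$ is the completion of $(\Sigma,d)$ (compact if $\rho$ is totally bounded), with extended metric $\bar d$, and $\bar\sigma:\bar\Sigma\to\bar\Sigma$ is the continuous extension of $\sigma$. $UC_d(\Sigma)$ is the space of bounded functions $\Sigma\to\mathbb{R}$ that are uniformly continuous with respect to $d$; each extends uniquely to a continuous function on $\bar\Sigma$. Pressure on the compact space $\bar\Sigma$: for a continuous map $T$ of a compact metric space $(X,d)$ and continuous $\phi:X\to\mathbb{R}$, a set $E\subset X$ is $(n,\epsilon)$-separated if for all distinct $x,y\in E$ there is $j\in\{0,\ldots,n-1\}$ with $d(T^jx,T^jy)>\epsilon$; $Q_n(T,\phi,\epsilon)=\sup\{\sum_{x\in E}e^{\sum_{i=0}^{n-1}\phi(T^ix)}: E \text{ is }(n,\epsilon)\text{-separated}\}$ and $P(\phi)=\lim_{\epsilon\to0}\limsup_{n\to\infty}\frac1n\log Q_n(T,\phi,\epsilon)$. $P_{\bar\Sigma}$ denotes this pressure for $(\bar\Sigma,\bar\sigma)$. Connectedness: a set of vertices is connected if for each two vertices in the set there is a directed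 path between them (this may only be in one direction). For sets of vertices $B,C\subset V$, write $B\to C$ if there are $i\in B$, $j\in C$ with $a_{i,j}=1$. Sectorially arranged: $V=\mathbb{N}$ is sectorially arranged with respect to $\rho$ if there are sequences $N_k\to\infty$ of positive integers and $\hat\delta_k\to0$ such that for every $k$ $$V=\{1,\ldots,N_k\}\cup\bigsqcup_{i=1}^{p_k}V_k^i$$ for some $p_k\in\mathbb{N}\cup\{\infty\}$, where the sets $V_k^i$ (sectors) are pairwise disjoint (but may intersect $\{1,\ldots,N_k\}$), each $V_k^i$ is infinite and connected with $\rho$-diameter less than $\hat\delta_k$; for a given $k$ the $V_k^i$ are not connected to each other (for $i\ne i'$ neither $V_k^i\to V_k^{i'}$ nor $V_k^{i'}\to V_k^i$); and for $k\ge2$ each $V_k^i$ is contained in some $V_{k-1}^{i'}$. *)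

theory Defs
  imports "HOL-Probability.Probability" "HOL-Library.Extended_Nat"
begin

section \<open>Countable Markov shifts\<close>

text \<open>A 0-1 matrix indexed by the positive integers is a relation \<open>A\<close>: \<open>A i j\<close> means that the
  entry in position \<open>(i, j)\<close> is 1. Values of \<open>A\<close> outside \<open>verts\<close> are never used.\<close>

definition verts :: "nat set" where
  "verts = {1..}"

definition shift_space :: "(nat \<Rightarrow> nat \<Rightarrow> bool) \<Rightarrow> (nat \<Rightarrow> nat) set" where
  "shift_space A = {x. (\<forall>n. x n \<in> verts) \<and> (\<forall>n. A (x n) (x (Suc n)))}"

definition shift :: "(nat \<Rightarrow> nat) \<Rightarrow> (nat \<Rightarrow> nat)" where
  "shift x = (\<lambda>n. x (Suc n))"

definition cylinder :: "(nat \<Rightarrow> nat \<Rightarrow> bool) \<Rightarrow> nat \<Rightarrow> (nat \<Rightarrow> nat) \<Rightarrow> (nat \<Rightarrow> nat) set" where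
  "cylinder A n w = {y \<in> shift_space A. \<forall>i<n. y i = w i}"

definition cylinder_topology :: "(nat \<Rightarrow> nat \<Rightarrow> bool) \<Rightarrow> (nat \<Rightarrow> nat) topology" where
  "cylinder_topology A = topology_generated_by {cylinder A n w | n w. True}"

definition shift_borel :: "(nat \<Rightarrow> nat \<Rightarrow> bool) \<Rightarrow> (nat \<Rightarrow> nat) measure" where
  "shift_borel A = sigma (shift_space A) {U. openin (cylinder_topology A) U}"

text \<open>\<open>path_in A B i j\<close>: there is a directed path of length at least 1 from \<open>i\<close> to \<open>j\<close>
  all of whose vertices lie in \<open>B\<close>.\<close>

definition path_in :: "(nat \<Rightarrow> nat \<Rightarrow> bool) \<Rightarrow> nat set \<Rightarrow> nat \<Rightarrow> nat \<Rightarrow> bool" where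
  "path_in A B i j \<longleftrightarrow>
     (\<exists>l\<ge>1. \<exists>x. x 0 = i \<and> x l = j \<and> (\<forall>k\<le>l. x k \<in> B) \<and> (\<forall>k<l. A (x k) (x (Suc k))))"

definition topologically_mixing :: "(nat \<Rightarrow> nat \<Rightarrow> bool) \<Rightarrow> bool" where
  "topologically_mixing A \<longleftrightarrow> (\<forall>i\<in>verts. \<forall>j\<in>verts. path_in A verts i j)"

section \<open>Entropy and variational pressure\<close>

definition partition_entropy :: "'a measure \<Rightarrow> 'a set set \<Rightarrow> real" where
  "partition_entropy M P = (\<Sum>C\<in>P. - measure M C * ln (measure M C))"

text \<open>The join of \<open>P\<close>, \<open>T\<^sup>-\<^sup>1 P\<close>, ..., \<open>T\<^sup>-\<^sup>(\<^sup>n\<^sup>-\<^sup>1\<^sup>) P\<close>. It may contain the empty set, which does not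
  contribute to the entropy.\<close>

definition iterated_join ::
    "'a measure \<Rightarrow> ('a \<Rightarrow> 'a) \<Rightarrow> 'a set set \<Rightarrow> nat \<Rightarrow> 'a set set" where
  "iterated_join M T P n =
     {{x \<in> space M. \<forall>i<n. (T ^^ i) x \<in> c i} | c. \<forall>i<n. c i \<in> P}"

definition entropy_wrt :: "'a measure \<Rightarrow> ('a \<Rightarrow> 'a) \<Rightarrow> 'a set set \<Rightarrow> ereal" where
  "entropy_wrt M T P = lim (\<lambda>n. ereal (partition_entropy M (iterated_join M T P n) / real n))"

definition measure_entropy :: "'a measure \<Rightarrow> ('a \<Rightarrow> 'a) \<Rightarrow> ereal" where
  "measure_entropy M T =
     (SUP P \<in> {P. finite P \<and> P \<subseteq> sets M \<and> partition_on (space M) P}. entropy_wrt M T P)"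

definition invariant_measures :: "(nat \<Rightarrow> nat \<Rightarrow> bool) \<Rightarrow> (nat \<Rightarrow> nat) measure set" where
  "invariant_measures A =
     {M. prob_space M \<and> sets M = sets (shift_borel A) \<and>
         shift \<in> measurable M M \<and> distr M M shift = M}"

text \<open>The integral with values in the extended reals, as the integral of the positive part minus
  that of the negative part (\<open>ennreal\<close> maps negative numbers to 0). In \<open>shift_pressure\<close> the
  negative part is required to have a finite integral: this says that the integral of \<open>\<phi>\<close>
  exists and is not \<open>-\<infinity>\<close>.\<close>

definition ext_integral :: "'a measure \<Rightarrow> ('a \<Rightarrow> real) \<Rightarrow> ereal" where
  "ext_integral M f =
     enn2ereal (\<integral>\<^sup>+x. ennreal (f x) \<partial>M) - enn2ereal (\<integral>\<^sup>+x. ennreal (- f x) \<partial>M)"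

definition shift_pressure ::
    "(nat \<Rightarrow> nat \<Rightarrow> bool) \<Rightarrow> ((nat \<Rightarrow> nat) \<Rightarrow> real) \<Rightarrow> ereal" where
  "shift_pressure A \<phi> =
     (SUP M \<in> {M \<in> invariant_measures A. (\<integral>\<^sup>+x. ennreal (- \<phi> x) \<partial>M) < \<infinity>}.
        measure_entropy M shift + ext_integral M \<phi>)"

definition finite_entropy :: "(nat \<Rightarrow> nat \<Rightarrow> bool) \<Rightarrow> bool" where
  "finite_entropy A \<longleftrightarrow> shift_pressure A (\<lambda>x. 0) < \<infinity>"

section \<open>The metric on the shift space and its completion\<close>

definition vertex_metric :: "nat metric \<Rightarrow> bool" where
  "vertex_metric \<rho> \<longleftrightarrow>
     mspace \<rho> = verts \<and> (\<forall>i\<in>verts. \<forall>j\<in>verts. mdist \<rho> i j \<le> 1) \<and>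
     mtopology_of \<rho> = discrete_topology verts"

text \<open>The library type \<open>metric\<close> asks for a nonnegative symmetric distance function on the whole
  type, hence the value 0 off the shift space.\<close>

definition shift_metric :: "(nat \<Rightarrow> nat \<Rightarrow> bool) \<Rightarrow> nat metric \<Rightarrow> real \<Rightarrow> (nat \<Rightarrow> nat) metric" where
  "shift_metric A \<rho> \<theta> = metric (shift_space A,
     \<lambda>x y. if x \<in> shift_space A \<and> y \<in> shift_space A
           then \<Sum>n. \<theta> ^ n * mdist \<rho> (x n) (y n) else 0)"

lemma shift_metric:
  assumes "vertex_metric \<rho>" "0 < \<theta>" "\<theta> < 1"
  shows mspace_shift_metric: "mspace (shift_metric A \<rho> \<theta>) = shift_space A"
    and mdist_shift_metric: "x \<in> shift_space A \<Longrightarrow> y \<in> shift_space A \<Longrightarrow>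
      mdist (shift_metric A \<rho> \<theta>) x y = (\<Sum>n. \<theta> ^ n * mdist \<rho> (x n) (y n))"
proof -
  let ?S = "shift_space A"
  let ?f = "\<lambda>x y n. \<theta> ^ n * mdist \<rho> (x n) (y n)"
  let ?d = "\<lambda>x y. if x \<in> ?S \<and> y \<in> ?S then \<Sum>n. ?f x y n else 0"
  have V: "x n \<in> mspace \<rho>" if "x \<in> ?S" for x n
    using that assms(1) by (auto simp: shift_space_def vertex_metric_def)
  have le1: "mdist \<rho> (x n) (y n) \<le> 1" if "x \<in> ?S" "y \<in> ?S" for x y n
    using that assms(1) V[of x n] V[of y n] by (auto simp: vertex_metric_def)
  have nn: "0 \<le> ?f x y n" for x y n
    using assms(2) by simp
  have sm: "summable (?f x y)" if "x \<in> ?S" "y \<in> ?S" for x y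
  proof (rule summable_comparison_test')
    show "summable (\<lambda>n. \<theta> ^ n)"
      using assms by (simp add: summable_geometric)
    show "norm (?f x y n) \<le> \<theta> ^ n" if "n \<ge> 0" for n
      using le1[OF \<open>x \<in> ?S\<close> \<open>y \<in> ?S\<close>, of n] assms
      by (simp add: mult_left_le)
  qed
  have "Metric_space ?S ?d"
  proof
    fix x y
    show "0 \<le> ?d x y"
      using sm nn by (auto intro!: suminf_nonneg simp del: zero_le_mult_iff)
    show "?d x y = ?d y x"
      by (simp add: mdist_commute)
  next
    fix x y assume xy: "x \<in> ?S" "y \<in> ?S"
    have "?d x y = 0 \<longleftrightarrow> (\<forall>n. ?f x y n = 0)"
      using suminf_eq_zero_iff[OF sm[OF xy]] nn xy by simp
    also have "\<dots> \<longleftrightarrow> (\<forall>n. x n = y n)"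
      using V xy assms(2) by simp
    finally show "?d x y = 0 \<longleftrightarrow> x = y"
      by auto
  next
    fix x y z assume x: "x \<in> ?S" and y: "y \<in> ?S" and z: "z \<in> ?S"
    have "(\<Sum>n. ?f x z n) \<le> (\<Sum>n. ?f x y n + ?f y z n)"
    proof (rule suminf_le)
      show "?f x z n \<le> ?f x y n + ?f y z n" for n
        using mult_left_mono[OF mdist_triangle[of "x n" \<rho> "y n" "z n"], of "\<theta> ^ n"] V x y z assms(2)
        by (simp add: distrib_left)
    qed (use sm x y z in \<open>auto intro: summable_add\<close>)
    also have "\<dots> = (\<Sum>n. ?f x y n) + (\<Sum>n. ?f y z n)"
      using sm x y z by (simp add: suminf_add)
    finally show "?d x z \<le> ?d x y + ?d y z"
      using x y z by simp
  qed
  then interpret Metric_space ?S ?d .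
  show "mspace (shift_metric A \<rho> \<theta>) = ?S"
    unfolding shift_metric_def by (rule mspace_metric)
  show "x \<in> ?S \<Longrightarrow> y \<in> ?S \<Longrightarrow> mdist (shift_metric A \<rho> \<theta>) x y = (\<Sum>n. ?f x y n)"
    unfolding shift_metric_def by (simp add: mdist_metric)
qed

text \<open>Completions are unique up to isometry; \<open>\<iota>\<close> is the embedding of \<open>m\<close> into its completion.\<close>

definition is_completion :: "'a metric \<Rightarrow> 'b metric \<Rightarrow> ('a \<Rightarrow> 'b) \<Rightarrow> bool" where
  "is_completion m X \<iota> \<longleftrightarrow>
     mcomplete_of X \<and> \<iota> \<in> mspace m \<rightarrow> mspace X \<and>
     (\<forall>x\<in>mspace m. \<forall>y\<in>mspace m. mdist X (\<iota> x) (\<iota> y) = mdist m x y) \<and>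
     mtopology_of X closure_of (\<iota> ` mspace m) = mspace X"

definition UC :: "'a metric \<Rightarrow> ('a \<Rightarrow> real) set" where
  "UC m = {\<phi>. bounded (\<phi> ` mspace m) \<and> uniformly_continuous_map m euclidean_metric \<phi>}"

section \<open>Topological pressure\<close>

definition separated_set ::
    "'a metric \<Rightarrow> ('a \<Rightarrow> 'a) \<Rightarrow> nat \<Rightarrow> real \<Rightarrow> 'a set \<Rightarrow> bool" where
  "separated_set X T n \<epsilon> E \<longleftrightarrow>
     E \<subseteq> mspace X \<and>
     (\<forall>x\<in>E. \<forall>y\<in>E. x \<noteq> y \<longrightarrow> (\<exists>j<n. mdist X ((T ^^ j) x) ((T ^^ j) y) > \<epsilon>))"

text \<open>On a compact space every \<open>(n, \<epsilon>)\<close>-separated set is finite; in general, restricting to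
  finite sets does not change the supremum, since the terms are positive and subsets of separated
  sets are separated.\<close>

definition separated_sum ::
    "'a metric \<Rightarrow> ('a \<Rightarrow> 'a) \<Rightarrow> ('a \<Rightarrow> real) \<Rightarrow> nat \<Rightarrow> real \<Rightarrow> ereal" where
  "separated_sum X T \<phi> n \<epsilon> =
     (SUP E \<in> {E. finite E \<and> separated_set X T n \<epsilon> E}.
        ereal (\<Sum>x\<in>E. exp (\<Sum>i<n. \<phi> ((T ^^ i) x))))"

definition ereal_ln :: "ereal \<Rightarrow> ereal" where
  "ereal_ln x = (if x \<le> 0 then - \<infinity> else if x = \<infinity> then \<infinity> else ereal (ln (real_of_ereal x)))"

definition topological_pressure :: "'a metric \<Rightarrow> ('a \<Rightarrow> 'a) \<Rightarrow> ('a \<Rightarrow> real) \<Rightarrow> ereal" where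
  "topological_pressure X T \<phi> =
     Lim (at_right 0) (\<lambda>\<epsilon>. limsup (\<lambda>n. ereal_ln (separated_sum X T \<phi> n \<epsilon>) / ereal (real n)))"

section \<open>Sectorial arrangement\<close>

definition connected_vertices :: "(nat \<Rightarrow> nat \<Rightarrow> bool) \<Rightarrow> nat set \<Rightarrow> bool" where
  "connected_vertices A B \<longleftrightarrow>
     (\<forall>i\<in>B. \<forall>j\<in>B. i \<noteq> j \<longrightarrow> path_in A B i j \<or> path_in A B j i)"

definition leads_to :: "(nat \<Rightarrow> nat \<Rightarrow> bool) \<Rightarrow> nat set \<Rightarrow> nat set \<Rightarrow> bool" where
  "leads_to A B C \<longleftrightarrow> (\<exists>i\<in>B. \<exists>j\<in>C. A i j)"

definition vertex_diameter :: "nat metric \<Rightarrow> nat set \<Rightarrow> real" where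
  "vertex_diameter \<rho> B = (SUP (i, j) \<in> B \<times> B. mdist \<rho> i j)"

text \<open>The sectors of level \<open>k \<ge> 1\<close> are \<open>S k i\<close> for \<open>i = 1, ..., p k\<close> (all \<open>i \<ge> 1\<close> if
  \<open>p k = \<infinity>\<close>).\<close>

definition sectorially_arranged :: "(nat \<Rightarrow> nat \<Rightarrow> bool) \<Rightarrow> nat metric \<Rightarrow> bool" where
  "sectorially_arranged A \<rho> \<longleftrightarrow>
     (\<exists>(N :: nat \<Rightarrow> nat) (\<delta> :: nat \<Rightarrow> real) (p :: nat \<Rightarrow> enat) (S :: nat \<Rightarrow> nat \<Rightarrow> nat set).
        let I = (\<lambda>k. {i. 1 \<le> i \<and> enat i \<le> p k}) in
        (\<forall>k\<ge>1. 1 \<le> N k) \<and> filterlim N at_top sequentially \<and> \<delta> \<longlonglongrightarrow> 0 \<and>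
        (\<forall>k\<ge>1.
           1 \<le> p k \<and>
           verts = {1..N k} \<union> (\<Union>i\<in>I k. S k i) \<and>
           disjoint_family_on (S k) (I k) \<and>
           (\<forall>i\<in>I k. infinite (S k i) \<and> connected_vertices A (S k i) \<and>
                     vertex_diameter \<rho> (S k i) < \<delta> k) \<and>
           (\<forall>i\<in>I k. \<forall>i'\<in>I k. i \<noteq> i' \<longrightarrow> \<not> leads_to A (S k i) (S k i')) \<and>
           (k \<ge> 2 \<longrightarrow> (\<forall>i\<in>I k. \<exists>i'\<in>I (k - 1). S k i \<subseteq> S (k - 1) i'))))"

end

theory Submission
  imports Defs
begin

text \<open>
  Both inequalities are proved on the shift space itself: a finite separated set in the completion
  is an open condition on finitely many points, so its points may be moved into the dense shift
  space (\<open>separated_sum_completion\<close>). What remains is to compare the variational pressure with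
  the growth of weighted separated sets in \<open>(\<Sigma>, d)\<close>, which need not be compact.

  The variational pressure is the smaller one, as in the easy half of the variational principle.
  Cylinders generate the Borel sets, so the entropy of a finite partition is, up to an arbitrarily
  small conditional entropy, the entropy of the words obtained by replacing all symbols above some
  \<open>m\<close> by one placeholder (\<open>approximation_by_observables\<close>). Since \<open>\<rho>\<close> is discrete, a symbol
  up to \<open>m\<close> has a positive distance to all others. Hence points with different truncated words are
  separated at a fixed scale, and the Gibbs inequality bounds entropy plus integral by the logarithm
  of a separated sum (\<open>truncated_entropy_le_separated_sum\<close>).

  For the converse, a finite family of loops of common length \<open>L\<close> at one vertex yields an invariant
  measure: concatenate independent random loops, a loop \<open>y\<close> having weight proportional to the
  exponential of its Birkhoff sum, and average over the \<open>L\<close> starting positions. By construction its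
  cylinders have at most the mass predicted by a Gibbs measure, so the exponential growth rate of the
  loop weights is a lower bound for the variational pressure (\<open>loop_pressure_bound\<close>). It follows
  that weights of words with prescribed end points grow at most like \<open>exp (n P)\<close>
  (\<open>word_sum_le\<close>).

  A separated set, however, also contains orbit pieces that stay far out for a long time, and here
  the sectors enter. An orbit can change sectors only by visiting the finite set
  \<open>F = {1..N\<^sub>k}\<close>. Inside one sector all symbols are close together, so that \<open>\<phi>\<close> is almost constant
  there. Connectedness and infinity of a sector give arbitrarily long walks inside it. They can be
  extended within the sector until they meet \<open>F\<close> on both sides, and since \<open>F\<close> is finite the way
  back from \<open>F\<close> to \<open>F\<close> has bounded length. The resulting loops spend almost all of their time in the
  sector, so the almost constant value of \<open>\<phi>\<close> there cannot exceed \<open>P\<close> by more than a small error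
  (\<open>sector_bound\<close>).

  Finally, up to scale \<open>\<epsilon>\<close> an orbit piece is determined by its first and last visits to \<open>F\<close>, the word
  between them, and the approximate position of its two ends, for which total boundedness leaves only
  finitely many choices. The word in between may be arbitrary, but distinct points of a separated set
  give distinct words, so their weights are controlled by \<open>word_sum_le\<close>, and the two ends are
  controlled by \<open>sector_bound\<close> (\<open>separated_set_sum_le\<close>). The number of codes grows
  quadratically in the length and does not affect the exponential rate.
\<close>

section \<open>Entropy of observations with finitely many values\<close>

text \<open>Writing the entropy as the mean information of the value observed makes its invariance and
  monotonicity immediate from properties of the integral; \<open>obs_entropy_eq_sum\<close> gives the usual sum.\<close>

definition obs_entropy :: "'a measure \<Rightarrow> ('a \<Rightarrow> 'c) \<Rightarrow> real" where
  "obs_entropy M f = (\<integral>x. - ln (measure M {y \<in> space M. f y = f x}) \<partial>M)"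

lemma simple_function_level_sets:
  assumes "simple_function M f"
  shows "{y \<in> space M. f y = c} \<in> sets M"
proof -
  have "{y \<in> space M. f y = c} = f -` {c} \<inter> space M"
    by auto
  then show ?thesis
    using simple_functionD(2)[OF assms, of "{c}"] by simp
qed

context prob_space
begin

lemma integral_simple_observable:
  fixes g :: "'c \<Rightarrow> real"
  assumes f: "simple_function M f" and R: "finite R" "f ` space M \<subseteq> R"
  shows "(\<integral>x. g (f x) \<partial>M) = (\<Sum>c\<in>R. g c * prob {y \<in> space M. f y = c})"
    and "integrable M (\<lambda>x. g (f x))"
proof -
  have eq: "g (f x) = (\<Sum>c\<in>R. g c * indicator {y \<in> space M. f y = c} x)" if "x \<in> space M" for x
  proof -
    have "(\<Sum>c\<in>R. g c * indicator {y \<in> space M. f y = c} x) = (\<Sum>c\<in>R. if c = f x then g c else 0)"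
      using that by (intro sum.cong) (auto simp: indicator_def)
    also have "\<dots> = g (f x)"
      using R that by auto
    finally show ?thesis ..
  qed
  have int: "integrable M (\<lambda>x. g c * indicator {y \<in> space M. f y = c} x)" for c
    by (intro integrable_mult_right integrable_real_indicator simple_function_level_sets[OF f])
       (simp add: emeasure_eq_measure)
  have "(\<integral>x. g (f x) \<partial>M) = (\<integral>x. (\<Sum>c\<in>R. g c * indicator {y \<in> space M. f y = c} x) \<partial>M)"
    by (intro Bochner_Integration.integral_cong refl eq)
  also have "\<dots> = (\<Sum>c\<in>R. g c * prob {y \<in> space M. f y = c})"
    using int simple_function_level_sets[OF f] by (subst Bochner_Integration.integral_sum) auto
  finally show "(\<integral>x. g (f x) \<partial>M) = (\<Sum>c\<in>R. g c * prob {y \<in> space M. f y = c})" .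
  have "integrable M (\<lambda>x. (\<Sum>c\<in>R. g c * indicator {y \<in> space M. f y = c} x))"
    using int by (intro Bochner_Integration.integrable_sum)
  then show "integrable M (\<lambda>x. g (f x))"
    by (subst Bochner_Integration.integrable_cong[OF refl eq]) auto
qed

lemma AE_level_set_positive:
  assumes f: "simple_function M f"
  shows "AE x in M. 0 < prob {y \<in> space M. f y = f x}"
proof -
  let ?N = "\<Union>c\<in>{c \<in> f ` space M. prob {y \<in> space M. f y = c} = 0}. {y \<in> space M. f y = c}"
  have "?N \<in> null_sets M"
  proof (rule null_sets_UN')
    show "countable {c \<in> f ` space M. prob {y \<in> space M. f y = c} = 0}"
      using simple_functionD(1)[OF f] by (intro countable_finite) auto
  qed (use simple_function_level_sets[OF f] in \<open>auto simp: null_sets_def emeasure_eq_measure\<close>)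
  then show ?thesis
    by (rule AE_I') (auto simp: zero_less_measure_iff)
qed

lemma sum_level_sets:
  assumes f: "simple_function M f" and R: "finite R" "f ` space M \<subseteq> R" and B: "B \<in> sets M"
  shows "(\<Sum>c\<in>R. prob ({y \<in> space M. f y = c} \<inter> B)) = prob B"
proof -
  have "prob (\<Union>c\<in>R. {y \<in> space M. f y = c} \<inter> B) = (\<Sum>c\<in>R. prob ({y \<in> space M. f y = c} \<inter> B))"
    using simple_function_level_sets[OF f] B R
    by (intro finite_measure_finite_Union) (auto simp: disjoint_family_on_def)
  moreover have "(\<Union>c\<in>R. {y \<in> space M. f y = c} \<inter> B) = B"
    using R sets.sets_into_space[OF B] by auto
  ultimately show ?thesis by simp
qed

lemma obs_entropy_eq_sum:
  assumes f: "simple_function M f" and R: "finite R" "f ` space M \<subseteq> R"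
  shows "obs_entropy M f = (\<Sum>c\<in>R. - prob {y \<in> space M. f y = c} * ln (prob {y \<in> space M. f y = c}))"
  unfolding obs_entropy_def
  using integral_simple_observable(1)[OF assms, of "\<lambda>c. - ln (prob {y \<in> space M. f y = c})"]
  by (simp add: mult.commute)

lemma integrable_obs_entropy:
  assumes f: "simple_function M f"
  shows "integrable M (\<lambda>x. ln (prob {y \<in> space M. f y = f x}))"
  using integral_simple_observable(2)[OF f simple_functionD(1)[OF f] subset_refl,
      of "\<lambda>c. ln (prob {y \<in> space M. f y = c})"] .

lemma obs_entropy_cong:
  assumes "\<And>x y. x \<in> space M \<Longrightarrow> y \<in> space M \<Longrightarrow> f x = f y \<longleftrightarrow> g x = g y"
  shows "obs_entropy M f = obs_entropy M g"
  unfolding obs_entropy_def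
proof (rule Bochner_Integration.integral_cong[OF refl])
  fix x assume "x \<in> space M"
  then have "{y \<in> space M. f y = f x} = {y \<in> space M. g y = g x}"
    by (intro Collect_cong conj_cong refl assms)
  then show "- ln (prob {y \<in> space M. f y = f x}) = - ln (prob {y \<in> space M. g y = g x})"
    by (simp only:)
qed

lemma obs_entropy_mono:
  assumes f: "simple_function M f" and g: "simple_function M g"
    and fine: "\<And>x y. x \<in> space M \<Longrightarrow> y \<in> space M \<Longrightarrow> f x = f y \<Longrightarrow> g x = g y"
  shows "obs_entropy M g \<le> obs_entropy M f"
  unfolding obs_entropy_def
proof (rule integral_mono_AE)
  show "AE x in M. - ln (prob {y \<in> space M. g y = g x}) \<le> - ln (prob {y \<in> space M. f y = f x})"
    using AE_level_set_positive[OF f] AE_space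
  proof eventually_elim
    case (elim x)
    have "prob {y \<in> space M. f y = f x} \<le> prob {y \<in> space M. g y = g x}"
      using fine elim(2) by (intro finite_measure_mono simple_function_level_sets[OF g] subsetI) blast
    with elim show ?case by simp
  qed
qed (use integrable_obs_entropy f g in auto)

lemma obs_entropy_nonneg: "0 \<le> obs_entropy M f"
proof -
  have "0 \<le> - ln (prob {y \<in> space M. f y = f x})" for x
    by (cases "prob {y \<in> space M. f y = f x} = 0")
       (auto simp: ln_le_zero_iff zero_less_measure_iff)
  then show ?thesis
    unfolding obs_entropy_def by (intro integral_nonneg_AE AE_I2)
qed

text \<open>Strong subadditivity: the conditional mutual information of \<open>X\<close> and \<open>Y\<close> given \<open>Z\<close> is
  nonnegative. With \<open>t\<close> the ratio of the conditionally independent to the actual joint probability,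
  it is the mean of \<open>- ln t\<close>. The mean of \<open>ln t\<close> is at most the mean of \<open>t - 1\<close>, which is nonpositive
  because in the mean of \<open>t\<close> the joint probabilities cancel and the numerators add up to at most one.\<close>

lemma obs_entropy_submodular:
  fixes X :: "'a \<Rightarrow> 'x" and Y :: "'a \<Rightarrow> 'y" and Z :: "'a \<Rightarrow> 'z"
  assumes X: "simple_function M X" and Y: "simple_function M Y" and Z: "simple_function M Z"
  shows "obs_entropy M (\<lambda>x. (X x, Y x, Z x)) + obs_entropy M Z
     \<le> obs_entropy M (\<lambda>x. (X x, Z x)) + obs_entropy M (\<lambda>x. (Y x, Z x))"
proof -
  define pz where "pz c = prob {y \<in> space M. Z y = c}" for c
  define pxz where "pxz u = prob {y \<in> space M. (X y, Z y) = u}" for u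
  define pyz where "pyz u = prob {y \<in> space M. (Y y, Z y) = u}" for u
  define p where "p u = prob {y \<in> space M. (X y, Y y, Z y) = u}" for u
  note XZ = simple_function_Pair[OF X Z] and YZ = simple_function_Pair[OF Y Z]
  note XYZ = simple_function_Pair[OF X YZ]
  let ?t = "\<lambda>(a, b, c). pxz (a, c) * pyz (b, c) / (p (a, b, c) * pz c)"
  let ?R = "X ` space M \<times> Y ` space M \<times> Z ` space M"
  have fin: "finite (X ` space M)" "finite (Y ` space M)" "finite (Z ` space M)"
    using X Y Z simple_functionD(1) by blast+
  have R: "finite ?R" "(\<lambda>x. (X x, Y x, Z x)) ` space M \<subseteq> ?R"
    using fin by auto
  have nn: "0 \<le> pz c" "0 \<le> pxz u" "0 \<le> pyz v" "0 \<le> p w" for c u v w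
    by (auto simp: pz_def pxz_def pyz_def p_def)
  have sx: "(\<Sum>a\<in>X ` space M. pxz (a, c)) = pz c" for c
  proof -
    have "{y \<in> space M. (X y, Z y) = (a, c)} = {y \<in> space M. X y = a} \<inter> {y \<in> space M. Z y = c}" for a
      by auto
    then show ?thesis
      using sum_level_sets[OF X fin(1) subset_refl simple_function_level_sets[OF Z, of c]]
      by (simp only: pz_def pxz_def)
  qed
  have sy: "(\<Sum>b\<in>Y ` space M. pyz (b, c)) = pz c" for c
  proof -
    have "{y \<in> space M. (Y y, Z y) = (b, c)} = {y \<in> space M. Y y = b} \<inter> {y \<in> space M. Z y = c}" for b
      by auto
    then show ?thesis
      using sum_level_sets[OF Y fin(2) subset_refl simple_function_level_sets[OF Z, of c]]
      by (simp only: pz_def pyz_def)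
  qed
  have sz: "(\<Sum>c\<in>Z ` space M. pz c) = 1"
  proof -
    have "{y \<in> space M. Z y = c} \<inter> space M = {y \<in> space M. Z y = c}" for c
      by auto
    then show ?thesis
      using sum_level_sets[OF Z fin(3) subset_refl sets.top] by (simp only: pz_def prob_space)
  qed
  have "(\<integral>x. ?t (X x, Y x, Z x) \<partial>M) = (\<Sum>u\<in>?R. ?t u * p u)"
    using integral_simple_observable(1)[OF XYZ R, of ?t] by (simp add: p_def)
  also have "\<dots> \<le> (\<Sum>(a, b, c)\<in>?R. pxz (a, c) * pyz (b, c) / pz c)"
  proof (rule sum_mono)
    fix u :: "'x \<times> 'y \<times> 'z"
    obtain a :: 'x and b :: 'y and c :: 'z where u: "u = (a, b, c)"
      by (cases u)
    have "pxz (a, c) * pyz (b, c) / (p (a, b, c) * pz c) * p (a, b, c) \<le> pxz (a, c) * pyz (b, c) / pz c"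
      using nn by (cases "p (a, b, c) = 0") auto
    then show "?t u * p u \<le> (case u of (a, b, c) \<Rightarrow> pxz (a, c) * pyz (b, c) / pz c)"
      by (simp add: u)
  qed
  also have "\<dots> = (\<Sum>a\<in>X ` space M. \<Sum>b\<in>Y ` space M. \<Sum>c\<in>Z ` space M. pxz (a, c) * pyz (b, c) / pz c)"
    by (simp add: sum.cartesian_product)
  also have "\<dots> = (\<Sum>c\<in>Z ` space M. \<Sum>a\<in>X ` space M. \<Sum>b\<in>Y ` space M. pxz (a, c) * pyz (b, c) / pz c)"
    by (rule trans[OF sum.cong[OF refl sum.swap] sum.swap])
  also have "\<dots> = (\<Sum>c\<in>Z ` space M. (\<Sum>a\<in>X ` space M. pxz (a, c)) * (\<Sum>b\<in>Y ` space M. pyz (b, c)) / pz c)"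
    by (simp only: sum_product sum_divide_distrib)
  also have "\<dots> = (\<Sum>c\<in>Z ` space M. pz c)"
    by (simp add: sx sy)
  finally have t1: "(\<integral>x. ?t (X x, Y x, Z x) \<partial>M) \<le> 1"
    by (simp add: sz)
  note ints = integrable_obs_entropy[OF XZ, folded pxz_def] integrable_obs_entropy[OF YZ, folded pyz_def]
    integrable_obs_entropy[OF XYZ, folded p_def] integrable_obs_entropy[OF Z, folded pz_def]
  have it: "integrable M (\<lambda>x. ?t (X x, Y x, Z x))"
    by (rule integral_simple_observable(2)[OF XYZ R])
  have "(\<integral>x. ln (pxz (X x, Z x)) + ln (pyz (Y x, Z x)) - ln (p (X x, Y x, Z x)) - ln (pz (Z x)) \<partial>M)
      \<le> (\<integral>x. ?t (X x, Y x, Z x) - 1 \<partial>M)"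
  proof (rule integral_mono_AE)
    show "AE x in M. ln (pxz (X x, Z x)) + ln (pyz (Y x, Z x)) - ln (p (X x, Y x, Z x)) - ln (pz (Z x))
        \<le> ?t (X x, Y x, Z x) - 1"
      using AE_level_set_positive[OF XZ, folded pxz_def] AE_level_set_positive[OF YZ, folded pyz_def]
        AE_level_set_positive[OF XYZ, folded p_def] AE_level_set_positive[OF Z, folded pz_def]
    proof eventually_elim
      case (elim x)
      have "ln (?t (X x, Y x, Z x)) \<le> ?t (X x, Y x, Z x) - 1"
        using elim by (intro ln_le_minus_one) auto
      with elim show ?case
        by (simp add: ln_mult ln_div)
    qed
  qed (use ints it in auto)
  also have "\<dots> \<le> 0"
    using t1 it by (simp add: prob_space)
  finally have "(\<integral>x. ln (pxz (X x, Z x)) \<partial>M) + (\<integral>x. ln (pyz (Y x, Z x)) \<partial>M)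
      - (\<integral>x. ln (p (X x, Y x, Z x)) \<partial>M) - (\<integral>x. ln (pz (Z x)) \<partial>M) \<le> 0"
    using ints by simp
  moreover have "obs_entropy M Z = - (\<integral>x. ln (pz (Z x)) \<partial>M)"
    by (simp only: obs_entropy_def pz_def Bochner_Integration.integral_minus)
  moreover have "obs_entropy M (\<lambda>x. (X x, Z x)) = - (\<integral>x. ln (pxz (X x, Z x)) \<partial>M)"
    by (simp only: obs_entropy_def pxz_def Bochner_Integration.integral_minus)
  moreover have "obs_entropy M (\<lambda>x. (Y x, Z x)) = - (\<integral>x. ln (pyz (Y x, Z x)) \<partial>M)"
    by (simp only: obs_entropy_def pyz_def Bochner_Integration.integral_minus)
  moreover have "obs_entropy M (\<lambda>x. (X x, Y x, Z x)) = - (\<integral>x. ln (p (X x, Y x, Z x)) \<partial>M)"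
    by (simp only: obs_entropy_def p_def Bochner_Integration.integral_minus)
  ultimately show ?thesis
    by linarith
qed

end

section \<open>Itineraries and entropy rates\<close>

definition itinerary :: "('a \<Rightarrow> 'a) \<Rightarrow> ('a \<Rightarrow> 'c) \<Rightarrow> nat \<Rightarrow> 'a \<Rightarrow> 'c list" where
  "itinerary T f n x = map (\<lambda>i. f ((T ^^ i) x)) [0..<n]"

lemma itinerary_eq_iff:
  "itinerary T f n x = itinerary T f n y \<longleftrightarrow> (\<forall>i<n. f ((T ^^ i) x) = f ((T ^^ i) y))"
  by (auto simp: itinerary_def)

lemma itinerary_Suc: "itinerary T f (Suc n) x = itinerary T f n x @ [f ((T ^^ n) x)]"
  by (simp add: itinerary_def)

lemma itinerary_Cons: "itinerary T f (Suc n) x = f x # itinerary T f n (T x)"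
  by (simp add: itinerary_def upt_conv_Cons map_Suc_upt[symmetric] funpow_swap1 del: upt_Suc)

definition level_partition :: "'a measure \<Rightarrow> ('a \<Rightarrow> 'c) \<Rightarrow> 'a set set" where
  "level_partition M f = (\<lambda>c. {x \<in> space M. f x = c}) ` f ` space M"

text \<open>Partitions and observations are interchangeable: a point is observed through its own cell.\<close>

lemma finite_measurable_partition_eq_level_partition:
  assumes P: "finite P" "P \<subseteq> sets M" "partition_on (space M) P"
  obtains f :: "'a \<Rightarrow> 'a set" where "simple_function M f" "P = level_partition M f" "f ` space M \<subseteq> P"
    "\<And>x. x \<in> space M \<Longrightarrow> x \<in> f x"
proof -
  define f where "f x = (THE C. C \<in> P \<and> x \<in> C)" for x
  have uniq: "\<exists>!C. C \<in> P \<and> x \<in> C" if "x \<in> space M" for x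
  proof (rule ex_ex1I)
    show "\<exists>C. C \<in> P \<and> x \<in> C"
      using partition_onD1[OF P(3)] that by blast
    show "C = D" if "C \<in> P \<and> x \<in> C" "D \<in> P \<and> x \<in> D" for C D
      using disjointD[OF partition_onD2[OF P(3)], of C D] that by blast
  qed
  have f: "f x \<in> P \<and> x \<in> f x" if "x \<in> space M" for x
    unfolding f_def by (rule theI'[OF uniq[OF that]])
  have f_eq: "f x = C" if "C \<in> P" "x \<in> C" "x \<in> space M" for x C
    unfolding f_def by (rule the1_equality[OF uniq[OF that(3)]]) (use that in blast)
  have sub: "C \<subseteq> space M" if "C \<in> P" for C
    using P(2) that sets.sets_into_space by blast
  have level: "{x \<in> space M. f x = C} = C" if "C \<in> P" for C
    using f f_eq sub that by blast
  have ne: "C \<noteq> {}" if "C \<in> P" for C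
    using P(3) that by (auto simp: partition_on_def)
  have range: "f ` space M = P"
  proof
    show "P \<subseteq> f ` space M"
    proof
      fix C assume "C \<in> P"
      with ne obtain x where "x \<in> C" by blast
      with \<open>C \<in> P\<close> show "C \<in> f ` space M"
        using f_eq[OF \<open>C \<in> P\<close>] sub by blast
    qed
  qed (use f in auto)
  show ?thesis
  proof
    show "simple_function M f"
      unfolding simple_function_def
    proof (intro conjI ballI)
      show "finite (f ` space M)" using range P(1) by simp
    next
      fix C assume "C \<in> f ` space M"
      then have "C \<in> P" using range by simp
      moreover have "f -` {C} \<inter> space M = {x \<in> space M. f x = C}" by auto
      ultimately show "f -` {C} \<inter> space M \<in> sets M"
        using level P(2) by auto
    qed
    show "P = level_partition M f"
      unfolding level_partition_def range using level by (simp cong: image_cong)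
  qed (use f in auto)
qed

lemma level_partition_is_partition:
  assumes f: "simple_function M f"
  shows "finite (level_partition M f) \<and> level_partition M f \<subseteq> sets M \<and>
    partition_on (space M) (level_partition M f)"
proof (intro conjI)
  show "finite (level_partition M f)"
    using simple_functionD(1)[OF f] by (simp add: level_partition_def)
  show "level_partition M f \<subseteq> sets M"
    using simple_function_level_sets[OF f] by (auto simp: level_partition_def)
  show "partition_on (space M) (level_partition M f)"
    by (auto simp: level_partition_def partition_on_def disjoint_def)
qed

lemma simple_function_measurable_comp:
  assumes f: "simple_function M f" and T: "T \<in> measurable M M"
  shows "simple_function M (\<lambda>x. f (T x))"
  unfolding simple_function_def
proof (intro conjI ballI)
  have "(\<lambda>x. f (T x)) ` space M \<subseteq> f ` space M"
    using measurable_space[OF T] by auto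
  then show "finite ((\<lambda>x. f (T x)) ` space M)"
    using simple_functionD(1)[OF f] finite_subset by blast
next
  fix c
  have "(\<lambda>x. f (T x)) -` {c} \<inter> space M = T -` {y \<in> space M. f y = c} \<inter> space M"
    using measurable_space[OF T] by auto
  then show "(\<lambda>x. f (T x)) -` {c} \<inter> space M \<in> sets M"
    using measurable_sets[OF T simple_function_level_sets[OF f]] by simp
qed

lemma measurable_iterate:
  assumes T: "T \<in> measurable M M"
  shows "(T ^^ n) \<in> measurable M M"
proof (induction n)
  case (Suc n)
  then show ?case using T by (auto intro: measurable_comp)
qed simp

lemma simple_function_itinerary:
  assumes f: "simple_function M f" and T: "T \<in> measurable M M"
  shows "simple_function M (itinerary T f n)"
proof (induction n)
  case 0
  then show ?case by (simp add: itinerary_def)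
next
  case (Suc n)
  have "simple_function M (\<lambda>x. itinerary T f n x @ [f ((T ^^ n) x)])"
    using simple_function_compose2[OF Suc
        simple_function_measurable_comp[OF f measurable_iterate[OF T]], of "\<lambda>u c. u @ [c]"] .
  then show ?case
    by (simp add: itinerary_Suc[abs_def])
qed

text \<open>A nonempty cell of the join is exactly the set of points with a given itinerary.\<close>

lemma (in prob_space) partition_entropy_iterated_join:
  assumes f: "simple_function M f" and T: "T \<in> measurable M M"
  shows "partition_entropy M (iterated_join M T (level_partition M f) n) = obs_entropy M (itinerary T f n)"
proof -
  define L where "L u = {x \<in> space M. itinerary T f n x = u}" for u
  let ?J = "iterated_join M T (level_partition M f) n"
  let ?U = "itinerary T f n ` space M"
  have Tn: "(T ^^ i) x \<in> space M" if "x \<in> space M" for i x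
    using measurable_space[OF measurable_iterate[OF T] that] .
  have 1: "L ` ?U \<subseteq> ?J"
  proof clarify
    fix x assume x: "x \<in> space M"
    show "L (itinerary T f n x) \<in> ?J"
      unfolding iterated_join_def
    proof (intro CollectI exI[of _ "\<lambda>i. {y \<in> space M. f y = f ((T ^^ i) x)}"] conjI allI impI)
      show "{y \<in> space M. f y = f ((T ^^ i) x)} \<in> level_partition M f" for i
        using Tn[OF x] by (auto simp: level_partition_def)
      show "L (itinerary T f n x) =
        {xa \<in> space M. \<forall>i<n. (T ^^ i) xa \<in> {y \<in> space M. f y = f ((T ^^ i) x)}}"
        using Tn by (auto simp: L_def itinerary_eq_iff)
    qed
  qed
  have 2: "?J \<subseteq> insert {} (L ` ?U)"
  proof
    fix B assume "B \<in> ?J"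
    then obtain c where c: "\<And>i. i < n \<Longrightarrow> c i \<in> level_partition M f"
      and B: "B = {x \<in> space M. \<forall>i<n. (T ^^ i) x \<in> c i}"
      by (auto simp: iterated_join_def)
    show "B \<in> insert {} (L ` ?U)"
    proof (cases "B = {}")
      case False
      then obtain x where "x \<in> B"
        by blast
      then have x: "x \<in> space M" "\<And>i. i < n \<Longrightarrow> (T ^^ i) x \<in> c i"
        by (simp_all add: B)
      have ci: "c i = {y \<in> space M. f y = f ((T ^^ i) x)}" if i: "i < n" for i
      proof -
        obtain d where d: "c i = {y \<in> space M. f y = d}"
          using c[OF i] unfolding level_partition_def by blast
        then have "f ((T ^^ i) x) = d"
          using x(2)[OF i] d by simp
        then show ?thesis using d by (simp only:)
      qed
      have "B = L (itinerary T f n x)"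
        unfolding B L_def itinerary_eq_iff using Tn by (auto simp: ci)
      then show ?thesis using x(1) by auto
    qed simp
  qed
  have finU: "finite ?U"
    using simple_functionD(1)[OF simple_function_itinerary[OF f T]] .
  have inj: "inj_on L ?U"
  proof (rule inj_onI, clarify)
    fix x y assume "x \<in> space M" "L (itinerary T f n x) = L (itinerary T f n y)"
    then have "x \<in> L (itinerary T f n y)" by (auto simp: L_def)
    then show "itinerary T f n x = itinerary T f n y" by (simp add: L_def)
  qed
  have "partition_entropy M ?J = (\<Sum>C\<in>L ` ?U. - measure M C * ln (measure M C))"
    unfolding partition_entropy_def
  proof (rule sum.mono_neutral_right[OF _ 1], safe)
    show "finite ?J"
      using finite_subset[OF 2] finU by simp
    show "- measure M C * ln (measure M C) = 0" if "C \<in> ?J" "C \<notin> L ` ?U" for C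
      using subsetD[OF 2 that(1)] that(2) by (elim insertE) simp_all
  qed
  also have "\<dots> = (\<Sum>u\<in>?U. - measure M (L u) * ln (measure M (L u)))"
    by (rule sum.reindex_cong[OF inj]) auto
  also have "\<dots> = obs_entropy M (itinerary T f n)"
    by (subst obs_entropy_eq_sum[OF simple_function_itinerary[OF f T] finU subset_refl]) (simp add: L_def)
  finally show ?thesis .
qed

text \<open>A concave sequence starting at 0 has a decreasing ratio \<open>a n / n\<close>. This replaces Fekete's lemma
  and also shows that the limit is a lower bound.\<close>

lemma concave_sequence_ratio:
  fixes a :: "nat \<Rightarrow> real"
  assumes a0: "a 0 = 0" and concave: "\<And>n. a (Suc (Suc n)) + a n \<le> 2 * a (Suc n)"
    and nonneg: "\<And>n. 0 \<le> a n"
  obtains h where "(\<lambda>n. a n / real n) \<longlonglongrightarrow> h" "\<And>n. h * real n \<le> a n"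
proof -
  have inc: "real n * (a (Suc n) - a n) \<le> a n" for n
  proof (induction n)
    case 0
    then show ?case using a0 by simp
  next
    case (Suc n)
    have "real (Suc n) * (a (Suc (Suc n)) - a (Suc n)) \<le> real (Suc n) * (a (Suc n) - a n)"
      using concave[of n] by (intro mult_left_mono) auto
    also have "\<dots> \<le> a (Suc n)"
      using Suc by (simp add: algebra_simps)
    finally show ?case .
  qed
  have dec: "decseq (\<lambda>n. a (Suc n) / real (Suc n))"
    unfolding decseq_Suc_iff
  proof
    fix n
    show "a (Suc (Suc n)) / real (Suc (Suc n)) \<le> a (Suc n) / real (Suc n)"
      using inc[of "Suc n"] by (simp add: field_simps)
  qed
  then obtain h where h: "(\<lambda>n. a (Suc n) / real (Suc n)) \<longlonglongrightarrow> h"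
    and le: "\<And>n. h \<le> a (Suc n) / real (Suc n)"
    using decseq_convergent[OF dec, of 0] nonneg by (metis divide_nonneg_nonneg of_nat_0_le_iff)
  have "(\<lambda>n. a n / real n) \<longlonglongrightarrow> h"
    using h by (subst (asm) filterlim_sequentially_Suc)
  moreover have "h * real n \<le> a n" for n
    using le[of "n - 1"] a0 by (cases n) (auto simp: field_simps)
  ultimately show ?thesis
    using that by blast
qed

locale measure_preserving = prob_space M for M :: "'a measure" +
  fixes T :: "'a \<Rightarrow> 'a"
  assumes measurable_T: "T \<in> measurable M M" and invariant: "distr M M T = M"
begin

lemma measure_invariant:
  assumes "B \<in> sets M"
  shows "measure M (T -` B \<inter> space M) = measure M B"
  using measure_distr[OF measurable_T assms] by (simp add: invariant)

lemma obs_entropy_invariant: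
  assumes f: "simple_function M f"
  shows "obs_entropy M (\<lambda>x. f (T x)) = obs_entropy M f"
proof -
  have R: "finite (f ` space M)" "(\<lambda>x. f (T x)) ` space M \<subseteq> f ` space M"
    using simple_functionD(1)[OF f] measurable_space[OF measurable_T] by auto
  have "measure M {x \<in> space M. f (T x) = c} = measure M {x \<in> space M. f x = c}" for c
  proof -
    have "{x \<in> space M. f (T x) = c} = T -` {x \<in> space M. f x = c} \<inter> space M"
      using measurable_space[OF measurable_T] by auto
    then show ?thesis
      using measure_invariant[OF simple_function_level_sets[OF f]] by simp
  qed
  then show ?thesis
    by (subst obs_entropy_eq_sum[OF simple_function_measurable_comp[OF f measurable_T] R],
        subst obs_entropy_eq_sum[OF f R(1) subset_refl]) (simp only:)
qed

lemma obs_entropy_iterate_invariant: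
  assumes f: "simple_function M f"
  shows "obs_entropy M (\<lambda>x. f ((T ^^ n) x)) = obs_entropy M f"
proof (induction n)
  case (Suc n)
  have "obs_entropy M (\<lambda>x. f ((T ^^ Suc n) x)) = obs_entropy M (\<lambda>x. f ((T ^^ n) (T x)))"
    by (simp add: funpow_swap1)
  also have "\<dots> = obs_entropy M (\<lambda>x. f ((T ^^ n) x))"
    using obs_entropy_invariant[OF simple_function_measurable_comp[OF f measurable_iterate[OF measurable_T]]] .
  finally show ?case using Suc by simp
qed simp

text \<open>Submodularity for the first and the last letter given the word between them; by invariance
  the words of equal length have equal entropy.\<close>

lemma itinerary_concave:
  assumes f: "simple_function M f"
  shows "obs_entropy M (itinerary T f (Suc (Suc n))) + obs_entropy M (itinerary T f n)
    \<le> 2 * obs_entropy M (itinerary T f (Suc n))"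
proof -
  let ?Y = "\<lambda>x. f ((T ^^ Suc n) x)" and ?Z = "\<lambda>x. itinerary T f n (T x)"
  note T = measurable_T
  note it = simple_function_itinerary[OF f T]
  note Y = simple_function_measurable_comp[OF f measurable_iterate[OF T], of "Suc n"]
  note Z = simple_function_measurable_comp[OF it T, of n]
  have "obs_entropy M (\<lambda>x. (f x, ?Y x, ?Z x)) = obs_entropy M (itinerary T f (Suc (Suc n)))"
    by (rule obs_entropy_cong)
       (simp only: itinerary_Cons[of _ _ "Suc n"] itinerary_Suc[of _ _ n] funpow_Suc_right o_apply, auto)
  moreover have "obs_entropy M (\<lambda>x. (f x, ?Z x)) = obs_entropy M (itinerary T f (Suc n))"
    by (rule obs_entropy_cong) (simp add: itinerary_Cons)
  moreover have "obs_entropy M (\<lambda>x. (?Y x, ?Z x)) = obs_entropy M (\<lambda>x. itinerary T f (Suc n) (T x))"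
    by (rule obs_entropy_cong)
       (auto simp: itinerary_Suc funpow_swap1)
  moreover have "obs_entropy M ?Z = obs_entropy M (itinerary T f n)"
    by (rule obs_entropy_invariant[OF it])
  ultimately show ?thesis
    using obs_entropy_submodular[OF f Y Z] obs_entropy_invariant[OF it, of "Suc n"] by simp
qed

text \<open>In particular the limit in the definition of the entropy of a partition exists.\<close>

lemma entropy_rate:
  assumes f: "simple_function M f"
  obtains h where "entropy_wrt M T (level_partition M f) = ereal h"
    "(\<lambda>n. obs_entropy M (itinerary T f n) / real n) \<longlonglongrightarrow> h"
    "\<And>n. h * real n \<le> obs_entropy M (itinerary T f n)"
proof -
  have "obs_entropy M (itinerary T f 0) = 0"
    by (simp add: obs_entropy_def itinerary_def prob_space)
  then obtain h where h: "(\<lambda>n. obs_entropy M (itinerary T f n) / real n) \<longlonglongrightarrow> h"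
      "\<And>n. h * real n \<le> obs_entropy M (itinerary T f n)"
    using concave_sequence_ratio[of "\<lambda>n. obs_entropy M (itinerary T f n)"]
      itinerary_concave[OF f] obs_entropy_nonneg by blast
  have "(\<lambda>n. ereal (obs_entropy M (itinerary T f n) / real n)) \<longlonglongrightarrow> ereal h"
    using h(1) by simp
  then have "entropy_wrt M T (level_partition M f) = ereal h"
    unfolding entropy_wrt_def partition_entropy_iterated_join[OF f measurable_T] by (rule limI)
  then show ?thesis using that h by blast
qed

text \<open>Entropy of a word of \<open>f\<close> given the word of \<open>g\<close> costs at most the conditional entropy of \<open>f\<close> given
  \<open>g\<close> per letter. Each new pair of letters is handled by submodularity twice: conditioning on more
  never increases entropy.\<close>

lemma itinerary_conditional_bound:
  assumes f: "simple_function M f" and g: "simple_function M g"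
  shows "obs_entropy M (itinerary T f n) \<le> obs_entropy M (itinerary T g n)
    + real n * (obs_entropy M (\<lambda>x. (f x, g x)) - obs_entropy M g)"
proof -
  note T = measurable_T
  define p q r s where "p = itinerary T f" and "q = itinerary T g"
    and "r n x = f ((T ^^ n) x)" and "s n x = g ((T ^^ n) x)" for n x
  have P: "simple_function M (p n)" and Q: "simple_function M (q n)" for n
    unfolding p_def q_def by (rule simple_function_itinerary[OF f T], rule simple_function_itinerary[OF g T])
  have R: "simple_function M (r n)" and S: "simple_function M (s n)" for n
    unfolding r_def[abs_def] s_def[abs_def]
    by (rule simple_function_measurable_comp[OF f measurable_iterate[OF T]],
        rule simple_function_measurable_comp[OF g measurable_iterate[OF T]])
  have joint: "obs_entropy M (\<lambda>x. (p n x, q n x)) \<le> obs_entropy M (q n)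
    + real n * (obs_entropy M (\<lambda>x. (f x, g x)) - obs_entropy M g)" for n
  proof (induction n)
    case 0
    have "obs_entropy M (\<lambda>x. (p 0 x, q 0 x)) = obs_entropy M (q 0)"
      by (rule obs_entropy_cong) (auto simp: p_def itinerary_def)
    then show ?case by simp
  next
    case (Suc n)
    have 1: "obs_entropy M (\<lambda>x. (p n x, s n x, q n x)) + obs_entropy M (q n)
      \<le> obs_entropy M (\<lambda>x. (p n x, q n x)) + obs_entropy M (\<lambda>x. (s n x, q n x))"
      by (rule obs_entropy_submodular[OF P S Q])
    have 2: "obs_entropy M (\<lambda>x. ((p n x, q n x), r n x, s n x)) + obs_entropy M (s n)
      \<le> obs_entropy M (\<lambda>x. ((p n x, q n x), s n x)) + obs_entropy M (\<lambda>x. (r n x, s n x))"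
      by (rule obs_entropy_submodular[OF simple_function_Pair[OF P Q] R S])
    have "obs_entropy M (\<lambda>x. ((p n x, q n x), r n x, s n x)) = obs_entropy M (\<lambda>x. (p (Suc n) x, q (Suc n) x))"
      by (rule obs_entropy_cong) (auto simp: p_def q_def r_def s_def itinerary_Suc)
    moreover have "obs_entropy M (\<lambda>x. ((p n x, q n x), s n x)) = obs_entropy M (\<lambda>x. (p n x, s n x, q n x))"
      by (rule obs_entropy_cong) auto
    moreover have "obs_entropy M (\<lambda>x. (s n x, q n x)) = obs_entropy M (q (Suc n))"
      by (rule obs_entropy_cong) (auto simp: q_def s_def itinerary_Suc)
    moreover have "obs_entropy M (s n) = obs_entropy M g"
      unfolding s_def[abs_def] by (rule obs_entropy_iterate_invariant[OF g])
    moreover have "obs_entropy M (\<lambda>x. (r n x, s n x)) = obs_entropy M (\<lambda>x. (f x, g x))"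
      unfolding r_def s_def by (rule obs_entropy_iterate_invariant[OF simple_function_Pair[OF f g]])
    ultimately show ?case
      using 1 2 Suc by (simp add: algebra_simps)
  qed
  have "obs_entropy M (p n) \<le> obs_entropy M (\<lambda>x. (p n x, q n x))"
    by (rule obs_entropy_mono[OF simple_function_Pair[OF P Q] P]) auto
  with joint[of n] show ?thesis
    by (simp add: p_def q_def)
qed

end

section \<open>Approximation of partitions and the Gibbs inequality\<close>

text \<open>The sets that can be approximated form a sigma-algebra; for a countable union, a finite
  partial union already carries almost all of the mass.\<close>

lemma (in prob_space) approximation_by_algebra:
  assumes G: "algebra (space M) G" and gen: "sets M = sigma_sets (space M) G"
    and B: "B \<in> sets M" and e: "0 < e"
  shows "\<exists>C\<in>G. prob ((B - C) \<union> (C - B)) < e"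
proof -
  interpret G: algebra "space M" G by fact
  have GM: "C \<in> sets M" if "C \<in> G" for C
    using that gen by auto
  have "B \<in> sigma_sets (space M) G"
    using B gen by simp
  then have "\<forall>e>0. \<exists>C\<in>G. prob ((B - C) \<union> (C - B)) < e"
  proof induction
    case (Basic a)
    then show ?case by (intro allI impI bexI[of _ a]) auto
  next
    case Empty
    then show ?case by (intro allI impI bexI[of _ "{}"]) auto
  next
    case (Compl a)
    show ?case
    proof (intro allI impI)
      fix e :: real assume "0 < e"
      then obtain C where C: "C \<in> G" "prob ((a - C) \<union> (C - a)) < e"
        using Compl.IH by blast
      have "a \<subseteq> space M"
        using Compl.hyps gen sets.sets_into_space by blast
      then have "((space M - a) - (space M - C)) \<union> ((space M - C) - (space M - a)) = (a - C) \<union> (C - a)"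
        using G.sets_into_space[OF C(1)] by blast
      then show "\<exists>C\<in>G. prob ((space M - a - C) \<union> (C - (space M - a))) < e"
        using C by (intro bexI[of _ "space M - C"]) auto
    qed
  next
    case (Union a)
    have aM: "a i \<in> sets M" for i
      using Union.hyps gen by simp
    show ?case
    proof (intro allI impI)
      fix e :: real assume e: "0 < e"
      have "(\<lambda>n. prob (\<Union>i<n. a i)) \<longlonglongrightarrow> prob (\<Union>n. \<Union>i<n. a i)"
        using aM by (intro finite_Lim_measure_incseq) (auto simp: incseq_def intro: less_le_trans)
      moreover have "(\<Union>n. \<Union>i<n. a i) = (\<Union>i. a i)"
        by (auto intro: lessI)
      ultimately have "eventually (\<lambda>n. prob (\<Union>i. a i) - e / 2 < prob (\<Union>i<n. a i)) sequentially"
        using e by (intro order_tendstoD(1)[where y = "prob (\<Union>i. a i)"]) auto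
      then obtain n where n: "prob (\<Union>i. a i) - e / 2 < prob (\<Union>i<n. a i)"
        by (auto simp: eventually_sequentially)
      have "\<exists>C\<in>G. prob ((a i - C) \<union> (C - a i)) < e / (2 * (real n + 1))" for i
        using Union.IH e by simp
      then obtain C where C: "\<And>i. C i \<in> G" "\<And>i. prob ((a i - C i) \<union> (C i - a i)) < e / (2 * (real n + 1))"
        by metis
      let ?C = "\<Union>i<n. C i"
      have CG: "?C \<in> G"
        using C(1) by (intro G.finite_UN) auto
      have "prob (((\<Union>i. a i) - ?C) \<union> (?C - (\<Union>i. a i)))
          \<le> prob (((\<Union>i. a i) - (\<Union>i<n. a i)) \<union> (\<Union>i<n. (a i - C i) \<union> (C i - a i)))"
        using aM GM[OF C(1)] GM[OF CG] by (intro finite_measure_mono) auto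
      also have "\<dots> \<le> prob ((\<Union>i. a i) - (\<Union>i<n. a i)) + prob (\<Union>i<n. (a i - C i) \<union> (C i - a i))"
        using aM GM[OF C(1)] by (intro measure_Un_le) auto
      also have "prob ((\<Union>i. a i) - (\<Union>i<n. a i)) < e / 2"
        using n aM by (subst finite_measure_Diff) auto
      also have "prob (\<Union>i<n. (a i - C i) \<union> (C i - a i)) \<le> (\<Sum>i<n. prob ((a i - C i) \<union> (C i - a i)))"
        using aM GM[OF C(1)] by (intro finite_measure_subadditive_finite) auto
      also have "\<dots> \<le> (\<Sum>i<n. e / (2 * (real n + 1)))"
        using C(2) by (intro sum_mono less_imp_le)
      also have "\<dots> \<le> e / 2"
        using e by (simp add: field_simps)
      finally show "\<exists>C\<in>G. prob (((\<Union>i. a i) - C) \<union> (C - (\<Union>i. a i))) < e"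
        using CG by (intro bexI[of _ ?C]) auto
    qed
  qed
  with e show ?thesis by blast
qed

text \<open>At 0 the bound \<open>\<bar>x ln x\<bar> \<le> 2 sqrt x\<close> comes from \<open>ln u \<le> u - 1\<close> with \<open>u = 1 / sqrt x\<close>.\<close>

lemma x_ln_x_continuous:
  fixes a :: real
  assumes a: "u \<longlonglongrightarrow> a" and nn: "\<And>n. 0 \<le> u n"
  shows "(\<lambda>n. u n * ln (u n)) \<longlonglongrightarrow> a * ln a"
proof (cases "a = 0")
  case False
  with assms show ?thesis by (intro tendsto_intros)
next
  case True
  have bound: "\<bar>x * ln x\<bar> \<le> 2 * sqrt x" if "0 \<le> x" "x \<le> 1" for x :: real
  proof (cases "x = 0")
    case False
    with that have x: "0 < x" by simp
    have "ln (1 / sqrt x) \<le> 1 / sqrt x - 1"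
      using x by (intro ln_le_minus_one) auto
    then have "- ln x \<le> 2 / sqrt x"
      using x by (simp add: ln_div ln_sqrt)
    then have "x * (- ln x) \<le> x * (2 / sqrt x)"
      using x by (intro mult_left_mono) auto
    also have "\<dots> = 2 * sqrt x"
      using x by (simp add: field_simps flip: real_sqrt_mult)
    finally have "- (x * ln x) \<le> 2 * sqrt x" by simp
    moreover have "x * ln x \<le> 0"
      using x that by (intro mult_nonneg_nonpos) auto
    ultimately show ?thesis by simp
  qed simp
  have "eventually (\<lambda>n. u n < 1) sequentially"
    using order_tendstoD(2)[OF a, of 1] True by simp
  then have "eventually (\<lambda>n. norm (u n * ln (u n)) \<le> 2 * sqrt (u n)) sequentially"
    by eventually_elim (use bound nn in auto)
  moreover have "(\<lambda>n. 2 * sqrt (u n)) \<longlonglongrightarrow> 0"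
    using tendsto_mult_left[OF tendsto_real_sqrt[OF a], of 2] True by simp
  ultimately have "(\<lambda>n. u n * ln (u n)) \<longlonglongrightarrow> 0"
    by (rule Lim_null_comparison)
  then show ?thesis using True by simp
qed

context prob_space
begin

text \<open>Entropy depends only on finitely many probabilities, each of which changes by at most the
  probability that the two observations differ.\<close>

lemma obs_entropy_tendsto:
  assumes f: "simple_function M f" and g: "\<And>n. simple_function M (g n)"
    and R: "finite R" "f ` space M \<subseteq> R" "\<And>n. g n ` space M \<subseteq> R"
    and close: "(\<lambda>n. prob {x \<in> space M. g n x \<noteq> f x}) \<longlonglongrightarrow> 0"
  shows "(\<lambda>n. obs_entropy M (g n)) \<longlonglongrightarrow> obs_entropy M f"
proof -
  note level = simple_function_level_sets
  have neq: "{x \<in> space M. g n x \<noteq> f x} \<in> sets M" for n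
  proof -
    have "{x \<in> space M. g n x \<noteq> f x} = (\<Union>c\<in>R. {x \<in> space M. g n x = c} - {x \<in> space M. f x = c})"
      using R(3)[of n] by auto
    also have "\<dots> \<in> sets M"
      using R(1) by (intro sets.finite_UN sets.Diff level[OF f] level[OF g])
    finally show ?thesis .
  qed
  have le: "prob {x \<in> space M. u x = c} \<le> prob {x \<in> space M. v x = c} + prob {x \<in> space M. u x \<noteq> v x}"
    if u: "simple_function M u" and v: "simple_function M v" and uv: "{x \<in> space M. u x \<noteq> v x} \<in> sets M" for u v c
  proof -
    have "prob {x \<in> space M. u x = c} \<le> prob ({x \<in> space M. v x = c} \<union> {x \<in> space M. u x \<noteq> v x})"
      using uv level[OF u] level[OF v] by (intro finite_measure_mono) auto
    also have "\<dots> \<le> prob {x \<in> space M. v x = c} + prob {x \<in> space M. u x \<noteq> v x}"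
      using uv level[OF v] by (intro measure_Un_le) auto
    finally show ?thesis .
  qed
  have "(\<lambda>n. prob {x \<in> space M. g n x = c} - prob {x \<in> space M. f x = c}) \<longlonglongrightarrow> 0" for c
  proof (rule Lim_null_comparison[OF always_eventually close], rule allI)
    fix n
    have sym: "{x \<in> space M. f x \<noteq> g n x} = {x \<in> space M. g n x \<noteq> f x}"
      by auto
    show "norm (prob {x \<in> space M. g n x = c} - prob {x \<in> space M. f x = c}) \<le> prob {x \<in> space M. g n x \<noteq> f x}"
      using le[OF g f neq, of n c] le[OF f g, of n c] neq[of n] unfolding sym by simp
  qed
  then have lim: "(\<lambda>n. prob {x \<in> space M. g n x = c}) \<longlonglongrightarrow> prob {x \<in> space M. f x = c}" for c
    by (simp add: LIM_zero_iff)
  have "(\<lambda>n. \<Sum>c\<in>R. - (prob {x \<in> space M. g n x = c} * ln (prob {x \<in> space M. g n x = c})))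
      \<longlonglongrightarrow> (\<Sum>c\<in>R. - (prob {x \<in> space M. f x = c} * ln (prob {x \<in> space M. f x = c})))"
    by (intro tendsto_sum tendsto_minus x_ln_x_continuous[OF lim]) simp
  then show ?thesis
    using obs_entropy_eq_sum[OF g R(1,3)] obs_entropy_eq_sum[OF f R(1,2)] by simp
qed

lemma conditional_entropy_tendsto_0:
  assumes f: "simple_function M f" and g: "\<And>n. simple_function M (g n)"
    and R: "finite R" "f ` space M \<subseteq> R" "\<And>n. g n ` space M \<subseteq> R"
    and close: "(\<lambda>n. prob {x \<in> space M. g n x \<noteq> f x}) \<longlonglongrightarrow> 0"
  shows "(\<lambda>n. obs_entropy M (\<lambda>x. (f x, g n x)) - obs_entropy M (g n)) \<longlonglongrightarrow> 0"
proof -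
  have "(\<lambda>n. obs_entropy M (\<lambda>x. (f x, g n x))) \<longlonglongrightarrow> obs_entropy M (\<lambda>x. (f x, f x))"
  proof (rule obs_entropy_tendsto[OF simple_function_Pair[OF f f] simple_function_Pair[OF f g], of "R \<times> R"])
    show "(\<lambda>n. prob {x \<in> space M. (f x, g n x) \<noteq> (f x, f x)}) \<longlonglongrightarrow> 0"
      using close by simp
  qed (use R in \<open>auto simp: image_subset_iff\<close>)
  moreover have "obs_entropy M (\<lambda>x. (f x, f x)) = obs_entropy M f"
    by (rule obs_entropy_cong) simp
  ultimately show ?thesis
    using tendsto_diff[OF _ obs_entropy_tendsto[OF assms]] by fastforce
qed

text \<open>If the observations \<open>h m\<close> become finer with \<open>m\<close> and together generate the sigma-algebra, then some
  function of one of them predicts \<open>f\<close> up to small conditional entropy: approximate every level set of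
  \<open>f\<close> by a set visible through \<open>h m\<close>, and read off the value of \<open>f\<close> where exactly one of these sets
  is entered.\<close>

lemma approximation_by_observables:
  fixes f :: "'a \<Rightarrow> 'c" and h :: "nat \<Rightarrow> 'a \<Rightarrow> 'd"
  assumes f: "simple_function M f" and h: "\<And>m. simple_function M (h m)"
    and refine: "\<And>m x y. x \<in> space M \<Longrightarrow> y \<in> space M \<Longrightarrow> h (Suc m) x = h (Suc m) y \<Longrightarrow> h m x = h m y"
    and gen: "sets M = sigma_sets (space M) {{x \<in> space M. h m x \<in> U} |m U. True}"
    and d: "0 < d"
  obtains m and \<psi> :: "'d \<Rightarrow> 'c" where "simple_function M (\<lambda>x. \<psi> (h m x))"
    "obs_entropy M (\<lambda>x. (f x, \<psi> (h m x))) - obs_entropy M (\<lambda>x. \<psi> (h m x)) < d"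
proof -
  define G where "G = {{x \<in> space M. h m x \<in> U} |m U. True}"
  have refine_le: "h m x = h m y" if "m \<le> m'" "x \<in> space M" "y \<in> space M" "h m' x = h m' y" for m m' x y
    using that by (induction m' rule: dec_induct) (auto dest: refine)
  have lift: "\<exists>U'. {x \<in> space M. h m x \<in> U} = {x \<in> space M. h m' x \<in> U'}" if "m \<le> m'" for m m' U
  proof (rule exI[of _ "h m' ` {x \<in> space M. h m x \<in> U}"], rule set_eqI, rule iffI)
    fix x assume "x \<in> {x \<in> space M. h m' x \<in> h m' ` {x \<in> space M. h m x \<in> U}}"
    then obtain y where x: "x \<in> space M" and y: "y \<in> space M" "h m y \<in> U" and eq: "h m' x = h m' y"
      by blast
    from refine_le[OF that x y(1) eq] x y(2) show "x \<in> {x \<in> space M. h m x \<in> U}"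
      by simp
  qed blast
  have alg: "algebra (space M) G"
    unfolding algebra_iff_Un
  proof (intro conjI ballI)
    show "G \<subseteq> Pow (space M)" by (auto simp: G_def)
    show "{} \<in> G" unfolding G_def by (intro CollectI exI[of _ "{}"]) auto
  next
    fix a assume "a \<in> G"
    then obtain m U where "a = {x \<in> space M. h m x \<in> U}" by (auto simp: G_def)
    then have "space M - a = {x \<in> space M. h m x \<in> - U}" by auto
    then show "space M - a \<in> G" unfolding G_def by blast
  next
    fix a b assume "a \<in> G" "b \<in> G"
    then obtain m U m' U' where a: "a = {x \<in> space M. h m x \<in> U}" and b: "b = {x \<in> space M. h m' x \<in> U'}"
      by (auto simp: G_def)
    obtain V V' where "a = {x \<in> space M. h (max m m') x \<in> V}" "b = {x \<in> space M. h (max m m') x \<in> V'}"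
      using lift[of m "max m m'" U] lift[of m' "max m m'" U'] a b by auto
    then have "a \<union> b = {x \<in> space M. h (max m m') x \<in> V \<union> V'}" by auto
    then show "a \<union> b \<in> G" unfolding G_def by blast
  qed
  let ?R = "f ` space M"
  have finR: "finite ?R" using simple_functionD(1)[OF f] .
  have neR: "?R \<noteq> {}" using not_empty by simp
  define r where "r = real (card ?R)"
  have r: "0 < r" using finR neR by (simp add: r_def card_gt_0_iff)
  define level where "level c = {x \<in> space M. f x = c}" for c
  have level_sets: "level c \<in> sets M" for c
    unfolding level_def by (rule simple_function_level_sets[OF f])
  define C where "C n c = (SOME C. C \<in> G \<and> prob ((level c - C) \<union> (C - level c)) < 1 / (real n + 1))"
    for n :: nat and c
  have "\<exists>C. C \<in> G \<and> prob ((level c - C) \<union> (C - level c)) < 1 / (real n + 1)" for n :: nat and c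
    using approximation_by_algebra[OF alg gen[folded G_def] level_sets, of "1 / (real n + 1)" c]
    unfolding Bex_def by simp
  from someI_ex[OF this]
  have CG: "C n c \<in> G" and C: "prob ((level c - C n c) \<union> (C n c - level c)) < 1 / (real n + 1)" for n c
    unfolding C_def by blast+
  have "\<exists>m. \<exists>U. C n c = {x \<in> space M. h m x \<in> U}" for n c
    using CG[of n c] unfolding G_def by blast
  then obtain m0 where m0: "\<And>n c. \<exists>U. C n c = {x \<in> space M. h (m0 n c) x \<in> U}"
    by metis
  define m where "m n = Max (m0 n ` ?R)" for n
  define U where "U n c = (SOME U. C n c = {x \<in> space M. h (m n) x \<in> U})" for n c
  have U_ex: "\<exists>U. C n c = {x \<in> space M. h (m n) x \<in> U}" if c: "c \<in> ?R" for n c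
  proof -
    obtain U where U: "C n c = {x \<in> space M. h (m0 n c) x \<in> U}"
      using m0[of n c] by blast
    have "m0 n c \<le> m n"
      unfolding m_def using finR c by (intro Max_ge) auto
    from lift[OF this, of U] show ?thesis
      unfolding U .
  qed
  have U: "C n c = {x \<in> space M. h (m n) x \<in> U n c}" if "c \<in> ?R" for n c
    unfolding U_def by (rule someI_ex[OF U_ex[OF that]])
  define D where "D n c = (level c - C n c) \<union> (C n c - level c)" for n c
  have D: "prob (D n c) < 1 / (real n + 1)" for n c
    unfolding D_def by (rule C)
  have hU: "{x \<in> space M. h k x \<in> V} \<in> sets M" for k V
    using gen by auto
  have D_sets: "D n c \<in> sets M" for n c
  proof -
    have "C n c \<in> sets M"
      using m0[of n c] hU by auto
    then show ?thesis
      unfolding D_def using level_sets by auto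
  qed
  (* Where the approximating sets overlap or miss, any value will do. *)
  define \<psi> where "\<psi> n u = (if \<exists>!c. c \<in> ?R \<and> u \<in> U n c then THE c. c \<in> ?R \<and> u \<in> U n c else (SOME c. c \<in> ?R))" for n u
  have \<psi>_R: "\<psi> n u \<in> ?R" for n u
  proof (cases "\<exists>!c. c \<in> ?R \<and> u \<in> U n c")
    case True
    from theI'[OF this] True show ?thesis by (simp add: \<psi>_def)
  next
    case False
    with some_in_eq[of ?R] neR show ?thesis by (simp add: \<psi>_def)
  qed
  have \<psi>: "\<psi> n (h (m n) x) = f x" if x: "x \<in> space M" "\<And>c. c \<in> ?R \<Longrightarrow> x \<notin> D n c" for n x
  proof -
    have iff: "h (m n) x \<in> U n c \<longleftrightarrow> c = f x" if "c \<in> ?R" for c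
    proof -
      have "h (m n) x \<in> U n c \<longleftrightarrow> x \<in> C n c"
        using x(1) by (simp add: U[OF that])
      also have "\<dots> \<longleftrightarrow> x \<in> level c"
        using x(2)[OF that] by (auto simp: D_def)
      also have "\<dots> \<longleftrightarrow> c = f x"
        using x(1) by (auto simp: level_def)
      finally show ?thesis .
    qed
    have "(THE c. c \<in> ?R \<and> h (m n) x \<in> U n c) = f x"
      by (rule the_equality) (use iff x(1) in auto)
    moreover have "\<exists>!c. c \<in> ?R \<and> h (m n) x \<in> U n c"
      by (rule ex1I[of _ "f x"]) (use iff x(1) in auto)
    ultimately show ?thesis by (simp add: \<psi>_def)
  qed
  have simple: "simple_function M (\<lambda>x. \<psi> n (h (m n) x))" for n
    by (rule simple_function_compose1[OF h])
  have "(\<lambda>n. prob {x \<in> space M. \<psi> n (h (m n) x) \<noteq> f x}) \<longlonglongrightarrow> 0"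
  proof (rule Lim_null_comparison[OF always_eventually], rule allI)
    fix n
    have "prob {x \<in> space M. \<psi> n (h (m n) x) \<noteq> f x} \<le> prob (\<Union>c\<in>?R. D n c)"
    proof (rule finite_measure_mono)
      show "{x \<in> space M. \<psi> n (h (m n) x) \<noteq> f x} \<subseteq> (\<Union>c\<in>?R. D n c)"
        using \<psi>[of _ n] by blast
      show "(\<Union>c\<in>?R. D n c) \<in> sets M"
        by (rule sets.finite_UN[OF finR D_sets])
    qed
    also have "\<dots> \<le> (\<Sum>c\<in>?R. prob (D n c))"
      using finR D_sets by (intro finite_measure_subadditive_finite image_subsetI) simp_all
    also have "\<dots> \<le> (\<Sum>c\<in>?R. 1 / (real n + 1))"
      using D by (intro sum_mono less_imp_le)
    finally show "norm (prob {x \<in> space M. \<psi> n (h (m n) x) \<noteq> f x}) \<le> r * (1 / (real n + 1))"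
      by (simp add: r_def)
  next
    have "(\<lambda>n. 1 / (real n + 1)) \<longlonglongrightarrow> 0"
      using LIMSEQ_inverse_real_of_nat by (simp add: inverse_eq_divide add.commute)
    from tendsto_mult_left[OF this, of r] show "(\<lambda>n. r * (1 / (real n + 1))) \<longlonglongrightarrow> 0" by simp
  qed
  then have "(\<lambda>n. obs_entropy M (\<lambda>x. (f x, \<psi> n (h (m n) x))) - obs_entropy M (\<lambda>x. \<psi> n (h (m n) x))) \<longlonglongrightarrow> 0"
    by (intro conditional_entropy_tendsto_0[OF f simple finR subset_refl]) (use \<psi>_R in auto)
  then obtain n where "obs_entropy M (\<lambda>x. (f x, \<psi> n (h (m n) x))) - obs_entropy M (\<lambda>x. \<psi> n (h (m n) x)) < d"
    using order_tendstoD(2)[OF _ d] eventually_happens'[OF sequentially_bot] by blast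
  then show ?thesis
    using that[of "\<psi> n" "m n"] simple[of n] by (simp only:)
qed

text \<open>The maximum of entropy plus energy over all distributions is the logarithm of the partition
  function; the proof is \<open>ln t \<le> t - 1\<close> for the ratio \<open>t\<close> of the Gibbs weight to the actual
  probability.\<close>

lemma gibbs_inequality:
  assumes f: "simple_function M f" and u: "integrable M u"
    and le: "\<And>x. x \<in> space M \<Longrightarrow> u x \<le> b (f x)"
  shows "obs_entropy M f + (\<integral>x. u x \<partial>M) \<le> ln (\<Sum>c\<in>f ` space M. exp (b c))"
proof -
  let ?R = "f ` space M"
  define Z where "Z = (\<Sum>c\<in>?R. exp (b c))"
  define p where "p c = prob {y \<in> space M. f y = c}" for c
  have fin: "finite ?R" using simple_functionD(1)[OF f] .
  have Z: "0 < Z" unfolding Z_def using fin not_empty by (intro sum_pos) auto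
  have p: "0 \<le> p c" for c by (simp add: p_def)
  note int = integral_simple_observable[OF f fin subset_refl, folded p_def]
  have "obs_entropy M f + (\<integral>x. u x \<partial>M) = (\<integral>x. u x - ln (p (f x)) \<partial>M)"
    unfolding obs_entropy_def using u integrable_obs_entropy[OF f] by (simp add: p_def)
  also have "\<dots> \<le> (\<integral>x. exp (b (f x)) / (Z * p (f x)) - 1 + ln Z \<partial>M)"
  proof (rule integral_mono_AE)
    show "AE x in M. u x - ln (p (f x)) \<le> exp (b (f x)) / (Z * p (f x)) - 1 + ln Z"
      using AE_level_set_positive[OF f, folded p_def] AE_space
    proof eventually_elim
      case (elim x)
      have "ln (exp (b (f x)) / (Z * p (f x))) \<le> exp (b (f x)) / (Z * p (f x)) - 1"
        using elim Z by (intro ln_le_minus_one) auto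
      then show ?case
        using le[OF elim(2)] elim Z by (simp add: ln_div ln_mult)
    qed
    show "integrable M (\<lambda>x. u x - ln (p (f x)))"
      using u int(2)[of "\<lambda>c. ln (p c)"] by simp
    show "integrable M (\<lambda>x. exp (b (f x)) / (Z * p (f x)) - 1 + ln Z)"
      using int(2)[of "\<lambda>c. exp (b c) / (Z * p c)"] by simp
  qed
  also have "\<dots> = (\<integral>x. exp (b (f x)) / (Z * p (f x)) \<partial>M) - 1 + ln Z"
    using int(2)[of "\<lambda>c. exp (b c) / (Z * p c)"] by (simp add: prob_space)
  also have "(\<integral>x. exp (b (f x)) / (Z * p (f x)) \<partial>M) = (\<Sum>c\<in>?R. exp (b c) / (Z * p c) * p c)"
    by (rule int(1)[of "\<lambda>c. exp (b c) / (Z * p c)"])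
  also have "\<dots> \<le> (\<Sum>c\<in>?R. exp (b c) / Z)"
  proof (rule sum_mono)
    fix c show "exp (b c) / (Z * p c) * p c \<le> exp (b c) / Z"
      using Z by (cases "p c = 0") auto
  qed
  also have "\<dots> = 1"
    using Z by (simp add: Z_def flip: sum_divide_distrib)
  finally show ?thesis by (simp add: Z_def)
qed

lemma obs_entropy_integral_lower_bound:
  assumes f: "simple_function M f" and u: "integrable M u"
    and le: "AE x in M. R \<le> u x - ln (prob {y \<in> space M. f y = f x})"
  shows "R \<le> obs_entropy M f + (\<integral>x. u x \<partial>M)"
proof -
  have "R = (\<integral>x. R \<partial>M)" by (simp add: prob_space)
  also have "\<dots> \<le> (\<integral>x. u x - ln (prob {y \<in> space M. f y = f x}) \<partial>M)"
    using u integrable_obs_entropy[OF f] le by (intro integral_mono_AE) auto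
  also have "\<dots> = obs_entropy M f + (\<integral>x. u x \<partial>M)"
    unfolding obs_entropy_def using u integrable_obs_entropy[OF f] by simp
  finally show ?thesis .
qed

end

section \<open>Borel sets and truncated words of a countable Markov shift\<close>

lemma funpow_shift: "(shift ^^ n) x = (\<lambda>i. x (n + i))"
  by (induction n) (auto simp: shift_def)

lemma shift_in_shift_space: "x \<in> shift_space A \<Longrightarrow> shift x \<in> shift_space A"
  by (auto simp: shift_space_def shift_def)

lemma funpow_shift_in_shift_space: "x \<in> shift_space A \<Longrightarrow> (shift ^^ n) x \<in> shift_space A"
  by (induction n) (auto simp: shift_in_shift_space)

text \<open>Two cylinders around the same point are nested, so cylinders around points form a base.\<close>

lemma openin_cylinder_topology:
  "openin (cylinder_topology A) U \<longleftrightarrow> U \<subseteq> shift_space A \<and> (\<forall>x\<in>U. \<exists>n. cylinder A n x \<subseteq> U)"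
proof (intro iffI conjI)
  assume U: "openin (cylinder_topology A) U"
  then have "generate_topology_on {cylinder A n w | n w. True} U"
    by (simp add: cylinder_topology_def openin_topology_generated_by_iff)
  then have "U \<subseteq> shift_space A \<and> (\<forall>x\<in>U. \<exists>n. cylinder A n x \<subseteq> U)"
  proof induction
    case (Int a b)
    have "\<exists>n. cylinder A n x \<subseteq> a \<inter> b" if "x \<in> a \<inter> b" for x
    proof -
      from that Int obtain n m where "cylinder A n x \<subseteq> a" "cylinder A m x \<subseteq> b" by blast
      moreover have "cylinder A (max n m) x \<subseteq> cylinder A n x \<inter> cylinder A m x"
        by (auto simp: cylinder_def)
      ultimately show ?thesis by blast
    qed
    with Int show ?case by blast
  next
    case (UN K)
    then show ?case by (meson Sup_least UnionE Union_upper order_trans)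
  next
    case (Basis s)
    then obtain n w where s: "s = cylinder A n w" by blast
    have "cylinder A n x \<subseteq> s" if "x \<in> s" for x
      using that by (auto simp: s cylinder_def)
    moreover have "s \<subseteq> shift_space A"
      by (auto simp: s cylinder_def)
    ultimately show ?case by blast
  qed simp
  then show "U \<subseteq> shift_space A" "\<forall>x\<in>U. \<exists>n. cylinder A n x \<subseteq> U" by blast+
next
  assume U: "U \<subseteq> shift_space A \<and> (\<forall>x\<in>U. \<exists>n. cylinder A n x \<subseteq> U)"
  let ?K = "{cylinder A n x | n x. cylinder A n x \<subseteq> U}"
  have "U = \<Union>?K"
  proof
    show "U \<subseteq> \<Union>?K"
    proof
      fix x assume "x \<in> U"
      with U obtain n where "cylinder A n x \<subseteq> U" by blast
      moreover have "x \<in> cylinder A n x"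
        using U \<open>x \<in> U\<close> by (auto simp: cylinder_def)
      ultimately show "x \<in> \<Union>?K" by blast
    qed
  qed blast
  moreover have "openin (cylinder_topology A) (\<Union>?K)"
  proof (rule openin_Union)
    fix S assume "S \<in> ?K"
    then show "openin (cylinder_topology A) S"
      unfolding cylinder_topology_def by (intro topology_generated_by_Basis) blast
  qed
  ultimately show "openin (cylinder_topology A) U" by simp
qed

lemma countable_cylinders: "countable {cylinder A n w | n w. True}"
proof -
  have "{cylinder A n w | n w. True} \<subseteq> (\<lambda>u. cylinder A (length u) (\<lambda>i. u ! i)) ` UNIV"
  proof clarify
    fix n w
    have "cylinder A n w = cylinder A (length (map w [0..<n])) (\<lambda>i. map w [0..<n] ! i)"
      by (auto simp: cylinder_def)
    then show "cylinder A n w \<in> range (\<lambda>u. cylinder A (length u) (\<lambda>i. u ! i))"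
      by blast
  qed
  then show ?thesis
    by (rule countable_subset) simp
qed

lemma space_shift_borel [simp]: "space (shift_borel A) = shift_space A"
  unfolding shift_borel_def by (rule space_measure_of) (auto simp: openin_cylinder_topology)

lemma openin_in_sets_shift_borel:
  assumes "U \<subseteq> shift_space A" "\<And>x. x \<in> U \<Longrightarrow> \<exists>n. cylinder A n x \<subseteq> U"
  shows "U \<in> sets (shift_borel A)"
  unfolding shift_borel_def
  by (subst sets_measure_of) (use assms in \<open>auto simp: openin_cylinder_topology intro!: sigma_sets.Basic\<close>)

lemma sets_shift_borel:
  "sets (shift_borel A) = sigma_sets (shift_space A) {cylinder A n w | n w. True}"
proof -
  let ?C = "{cylinder A n w | n w. True}"
  have C: "?C \<subseteq> Pow (shift_space A)"
    by (auto simp: cylinder_def)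
  have "sets (shift_borel A) = sigma_sets (shift_space A) {U. openin (cylinder_topology A) U}"
    unfolding shift_borel_def by (rule sets_measure_of) (auto simp: openin_cylinder_topology)
  also have "\<dots> = sigma_sets (shift_space A) ?C"
  proof (rule sigma_sets_eqI)
    fix U assume "U \<in> {U. openin (cylinder_topology A) U}"
    then have U: "U \<subseteq> shift_space A" "\<And>x. x \<in> U \<Longrightarrow> \<exists>n. cylinder A n x \<subseteq> U"
      by (auto simp: openin_cylinder_topology)
    have "U = \<Union>{c \<in> ?C. c \<subseteq> U}"
    proof
      show "U \<subseteq> \<Union>{c \<in> ?C. c \<subseteq> U}"
      proof
        fix x assume "x \<in> U"
        with U obtain n where "cylinder A n x \<subseteq> U" "x \<in> cylinder A n x"
          by (fastforce simp: cylinder_def)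
        then show "x \<in> \<Union>{c \<in> ?C. c \<subseteq> U}" by blast
      qed
    qed blast
    moreover have "\<Union>{c \<in> ?C. c \<subseteq> U} \<in> sigma_sets (shift_space A) ?C"
      by (intro sigma_sets_UNION countable_subset[OF _ countable_cylinders])
         (auto intro: sigma_sets.Basic)
    ultimately show "U \<in> sigma_sets (shift_space A) ?C" by simp
  next
    fix c assume "c \<in> ?C"
    then show "c \<in> sigma_sets (shift_space A) {U. openin (cylinder_topology A) U}"
      unfolding cylinder_topology_def
      by (intro sigma_sets.Basic CollectI topology_generated_by_Basis) blast
  qed
  finally show ?thesis .
qed

lemma finite_coordinates_in_sets_shift_borel:
  assumes "\<And>x y. x \<in> shift_space A \<Longrightarrow> y \<in> shift_space A \<Longrightarrow> \<forall>i<n. x i = y i \<Longrightarrow> Q x \<Longrightarrow> Q y"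
  shows "{x \<in> shift_space A. Q x} \<in> sets (shift_borel A)"
proof (rule openin_in_sets_shift_borel)
  fix x assume x: "x \<in> {x \<in> shift_space A. Q x}"
  show "\<exists>n. cylinder A n x \<subseteq> {x \<in> shift_space A. Q x}"
  proof (intro exI subsetI)
    fix y assume "y \<in> cylinder A n x"
    then have "y \<in> shift_space A" "\<forall>i<n. x i = y i"
      by (auto simp: cylinder_def)
    with x assms[of x y] show "y \<in> {x \<in> shift_space A. Q x}" by blast
  qed
qed blast

lemma measurable_to_shift_borel:
  assumes "f \<in> space N \<rightarrow> shift_space A"
    and "\<And>n w. {z \<in> space N. \<forall>i<n. f z i = w i} \<in> sets N"
  shows "f \<in> measurable N (shift_borel A)"
proof (rule measurable_sigma_sets[OF sets_shift_borel _ assms(1)])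
  show "{cylinder A n w |n w. True} \<subseteq> Pow (shift_space A)"
    by (auto simp: cylinder_def)
  fix y assume "y \<in> {cylinder A n w |n w. True}"
  then obtain n w where y: "y = cylinder A n w" by blast
  have "f -` y \<inter> space N = {z \<in> space N. \<forall>i<n. f z i = w i}"
    using funcset_mem[OF assms(1)] unfolding y cylinder_def by blast
  then show "f -` y \<inter> space N \<in> sets N"
    using assms(2)[of n w] by (simp only:)
qed

lemma measurable_shift: "shift \<in> measurable (shift_borel A) (shift_borel A)"
proof (rule measurable_to_shift_borel)
  fix n w
  show "{z \<in> space (shift_borel A). \<forall>i<n. shift z i = w i} \<in> sets (shift_borel A)"
    unfolding space_shift_borel
  proof (rule finite_coordinates_in_sets_shift_borel[where n = "Suc n"])
    fix x y :: "nat \<Rightarrow> nat"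
    assume "\<forall>i<Suc n. x i = y i" "\<forall>i<n. shift x i = w i"
    then show "\<forall>i<n. shift y i = w i"
      unfolding shift_def by (metis Suc_less_eq)
  qed
qed (auto simp: shift_in_shift_space)

lemma invariant_measures_iff:
  "M \<in> invariant_measures A \<longleftrightarrow> sets M = sets (shift_borel A) \<and> measure_preserving M shift"
  by (auto simp: invariant_measures_def measure_preserving_def measure_preserving_axioms_def)

lemma space_invariant_measure: "M \<in> invariant_measures A \<Longrightarrow> space M = shift_space A"
  using sets_eq_imp_space_eq[of M "shift_borel A"] by (simp add: invariant_measures_iff)

text \<open>Since vertices are positive, 0 is free to stand for every symbol above \<open>m\<close>.\<close>

definition truncate_symbol :: "nat \<Rightarrow> nat \<Rightarrow> nat" where
  "truncate_symbol m v = (if v \<le> m then v else 0)"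

lemma itinerary_shift: "itinerary shift (\<lambda>x. g (x 0)) n x = map (\<lambda>i. g (x i)) [0..<n]"
  by (simp add: itinerary_def funpow_shift)

lemma simple_function_first_symbol:
  assumes M: "sets M = sets (shift_borel A)" and g: "finite (range g)"
  shows "simple_function M (\<lambda>x. g (x (0 :: nat)))"
  unfolding simple_function_def
proof (intro conjI ballI)
  show "finite ((\<lambda>x. g (x 0)) ` space M)"
    by (rule finite_subset[OF _ g]) auto
  fix c
  have "space M = shift_space A"
    using sets_eq_imp_space_eq[OF M] by simp
  then have "(\<lambda>x. g (x 0)) -` {c} \<inter> space M = {x \<in> shift_space A. g (x 0) = c}"
    by auto
  also have "\<dots> \<in> sets M"
    unfolding M by (rule finite_coordinates_in_sets_shift_borel[where n = 1]) auto
  finally show "(\<lambda>x. g (x 0)) -` {c} \<inter> space M \<in> sets M" .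
qed

lemma finite_range_truncate_symbol: "finite (range (truncate_symbol m))"
  by (rule finite_subset[of _ "{..m}"]) (auto simp: truncate_symbol_def)

text \<open>A cylinder of length \<open>n\<close> with symbols up to \<open>m\<close> is visible through the truncated word of any length
  that exceeds \<open>n\<close> and truncation level at least \<open>m\<close>, so one parameter can serve for both.\<close>

lemma truncated_words_generate:
  "sets (shift_borel A) = sigma_sets (shift_space A)
     {{x \<in> shift_space A. itinerary shift (\<lambda>x. truncate_symbol m (x 0)) m x \<in> U} | m U. True}"
    (is "_ = sigma_sets _ ?G")
proof
  have "?G \<subseteq> sets (shift_borel A)"
  proof clarify
    fix m U
    show "{x \<in> shift_space A. itinerary shift (\<lambda>x. truncate_symbol m (x 0)) m x \<in> U} \<in> sets (shift_borel A)"
    proof (rule finite_coordinates_in_sets_shift_borel[where n = m])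
      fix x y :: "nat \<Rightarrow> nat"
      assume "\<forall>i<m. x i = y i" "itinerary shift (\<lambda>x. truncate_symbol m (x 0)) m x \<in> U"
      moreover from this(1) have "map (\<lambda>i. truncate_symbol m (x i)) [0..<m] = map (\<lambda>i. truncate_symbol m (y i)) [0..<m]"
        by simp
      ultimately show "itinerary shift (\<lambda>x. truncate_symbol m (x 0)) m y \<in> U"
        unfolding itinerary_shift by simp
    qed
  qed
  then show "sigma_sets (shift_space A) ?G \<subseteq> sets (shift_borel A)"
    using sets.sigma_sets_subset[of ?G "shift_borel A"] by simp
  show "sets (shift_borel A) \<subseteq> sigma_sets (shift_space A) ?G"
    unfolding sets_shift_borel
  proof (rule sigma_sets_mono, clarify)
    fix n and w :: "nat \<Rightarrow> nat"
    (* At least n and at least every w i. *)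
    define m where "m = n + (\<Sum>i<n. w i)"
    have m: "i < m" "w i \<le> m" if "i < n" for i
      using that member_le_sum[of i "{..<n}" w] by (auto simp: m_def)
    define U where "U = {u :: nat list. (\<forall>i<n. u ! i = w i \<and> w i \<noteq> 0)}"
    have "cylinder A n w = {x \<in> shift_space A. itinerary shift (\<lambda>x. truncate_symbol m (x 0)) m x \<in> U}"
    proof (rule set_eqI)
      fix x
      have "(x i = w i) = (truncate_symbol m (x i) = w i \<and> w i \<noteq> 0)" if "x \<in> shift_space A" "i < n" for i
      proof -
        have "x i \<noteq> 0"
          using that(1) by (auto simp: shift_space_def verts_def Suc_le_eq)
        then show ?thesis
          using m(2)[OF that(2)] by (auto simp: truncate_symbol_def)
      qed
      then show "x \<in> cylinder A n w \<longleftrightarrow> x \<in> {x \<in> shift_space A. itinerary shift (\<lambda>x. truncate_symbol m (x 0)) m x \<in> U}"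
        using m(1) by (auto simp: cylinder_def U_def itinerary_shift)
    qed
    then show "cylinder A n w \<in> sigma_sets (shift_space A) ?G"
      by (intro sigma_sets.Basic) blast
  qed
qed

section \<open>Potentials on the shift space and their Birkhoff sums\<close>

text \<open>The vertex metric and the potential; assumptions on the graph are made where they are used.\<close>

locale shift_potential =
  fixes A :: "nat \<Rightarrow> nat \<Rightarrow> bool" and \<rho> :: "nat metric" and \<theta> :: real
    and \<phi> :: "(nat \<Rightarrow> nat) \<Rightarrow> real"
  assumes rho: "vertex_metric \<rho>" and theta: "0 < \<theta>" "\<theta> < 1"
    and phi: "\<phi> \<in> UC (shift_metric A \<rho> \<theta>)"
begin

abbreviation "X \<equiv> shift_space A"

abbreviation "D \<equiv> mdist (shift_metric A \<rho> \<theta>)"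

lemmas D_eq = mdist_shift_metric[OF rho theta]
lemmas mspace_X = mspace_shift_metric[OF rho theta]

lemma symbol_in_verts: "x \<in> X \<Longrightarrow> x i \<in> verts"
  by (simp add: shift_space_def)

lemma mspace_rho: "mspace \<rho> = verts"
  using rho by (simp add: vertex_metric_def)

lemma rho_le_1: "i \<in> verts \<Longrightarrow> j \<in> verts \<Longrightarrow> mdist \<rho> i j \<le> 1"
  using rho by (simp add: vertex_metric_def)

lemma summable_D:
  assumes "x \<in> X" "y \<in> X"
  shows "summable (\<lambda>n. \<theta> ^ n * mdist \<rho> (x n) (y n))"
proof (rule summable_comparison_test')
  show "summable (\<lambda>n. \<theta> ^ n)"
    using theta by (simp add: summable_geometric)
  show "norm (\<theta> ^ n * mdist \<rho> (x n) (y n)) \<le> \<theta> ^ n" if "n \<ge> 0" for n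
    using rho_le_1[of "x n" "y n"] symbol_in_verts assms theta by (simp add: mult_left_le)
qed

lemma D_ge_first_symbol:
  assumes "x \<in> X" "y \<in> X"
  shows "mdist \<rho> (x 0) (y 0) \<le> D x y"
proof -
  have "(\<Sum>n\<in>{0}. \<theta> ^ n * mdist \<rho> (x n) (y n)) \<le> (\<Sum>n. \<theta> ^ n * mdist \<rho> (x n) (y n))"
    using theta by (intro sum_le_suminf summable_D assms) auto
  then show ?thesis
    using D_eq[OF assms] by simp
qed

lemma D_le:
  assumes xy: "x \<in> X" "y \<in> X" and close: "\<And>i. i < m \<Longrightarrow> mdist \<rho> (x i) (y i) \<le> \<kappa>" and \<kappa>: "0 \<le> \<kappa>"
  shows "D x y \<le> (\<kappa> + \<theta> ^ m) / (1 - \<theta>)"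
proof -
  let ?t = "\<lambda>n. \<theta> ^ n * mdist \<rho> (x n) (y n)"
  have geom: "(\<lambda>n. \<theta> ^ n) sums (1 / (1 - \<theta>))"
    using geometric_sums[of \<theta>] theta by simp
  have "D x y = (\<Sum>n. ?t (n + m)) + (\<Sum>n<m. ?t n)"
    using D_eq[OF xy] suminf_split_initial_segment[OF summable_D[OF xy], of m] by simp
  also have "(\<Sum>n. ?t (n + m)) \<le> (\<Sum>n. \<theta> ^ m * \<theta> ^ n)"
  proof (rule suminf_le)
    show "?t (n + m) \<le> \<theta> ^ m * \<theta> ^ n" for n
      using rho_le_1[of "x (n + m)" "y (n + m)"] symbol_in_verts xy theta
      by (simp add: power_add mult.commute mult_left_le)
    show "summable (\<lambda>n. ?t (n + m))"
      using summable_D[OF xy] summable_iff_shift[of ?t m] by simp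
    show "summable (\<lambda>n. \<theta> ^ m * \<theta> ^ n)"
      using geom by (intro summable_mult sums_summable)
  qed
  also have "(\<Sum>n. \<theta> ^ m * \<theta> ^ n) = \<theta> ^ m * (1 / (1 - \<theta>))"
    using geom by (metis sums_mult sums_unique)
  also have "(\<Sum>n<m. ?t n) \<le> (\<Sum>n<m. \<theta> ^ n * \<kappa>)"
    using close theta by (intro sum_mono mult_left_mono) auto
  also have "\<dots> = (\<Sum>n<m. \<theta> ^ n) * \<kappa>"
    by (simp add: sum_distrib_right)
  also have "(\<Sum>n<m. \<theta> ^ n) \<le> 1 / (1 - \<theta>)"
    using sum_le_suminf[of "\<lambda>n. \<theta> ^ n" "{..<m}"] geom theta sums_summable[OF geom] sums_unique[OF geom]
    by simp
  finally show ?thesis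
    using \<kappa> by (simp add: add_divide_distrib mult_right_mono)
qed

lemma phi_bound_ex: "\<exists>B>0. \<forall>x\<in>X. \<bar>\<phi> x\<bar> \<le> B"
proof -
  have "bounded (\<phi> ` X)"
    using phi mspace_X by (simp add: UC_def)
  then show ?thesis
    by (auto simp: bounded_pos)
qed

definition B :: real where "B = (SOME B. 0 < B \<and> (\<forall>x\<in>X. \<bar>\<phi> x\<bar> \<le> B))"

lemma B_pos: "0 < B" and phi_bound: "x \<in> X \<Longrightarrow> \<bar>\<phi> x\<bar> \<le> B"
  using someI_ex[OF phi_bound_ex] unfolding B_def by blast+

text \<open>Closeness for \<open>d\<close> is closeness for \<open>\<rho>\<close> in finitely many coordinates, since the tail of the series
  is bounded by a geometric one.\<close>

lemma modulus:
  assumes "0 < \<eta>" "0 < \<epsilon>"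
  obtains \<kappa> m where "0 < \<kappa>"
    "\<And>x y. x \<in> X \<Longrightarrow> y \<in> X \<Longrightarrow> (\<And>i. i < m \<Longrightarrow> mdist \<rho> (x i) (y i) \<le> \<kappa>) \<Longrightarrow> \<bar>\<phi> x - \<phi> y\<bar> \<le> \<eta> \<and> D x y \<le> \<epsilon>"
proof -
  have "uniformly_continuous_map (shift_metric A \<rho> \<theta>) euclidean_metric \<phi>"
    using phi by (simp add: UC_def)
  then obtain \<delta> where \<delta>: "0 < \<delta>" "\<And>x y. x \<in> X \<Longrightarrow> y \<in> X \<Longrightarrow> D y x < \<delta> \<Longrightarrow> dist (\<phi> y) (\<phi> x) < \<eta>"
    using assms(1) unfolding uniformly_continuous_map_def mspace_X mdist_euclidean_metric by meson
  define \<beta> where "\<beta> = min \<epsilon> (\<delta> / 2)"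
  have \<beta>: "0 < \<beta>" "\<beta> \<le> \<epsilon>" "\<beta> < \<delta>"
    using \<delta>(1) assms(2) by (auto simp: \<beta>_def)
  (* The first m coordinates and the tail contribute at most half of \<beta> each. *)
  define \<kappa> where "\<kappa> = \<beta> * (1 - \<theta>) / 2"
  have \<kappa>: "0 < \<kappa>" using \<beta> theta by (simp add: \<kappa>_def)
  obtain m where m: "\<theta> ^ m < \<kappa>"
    using real_arch_pow_inv[OF \<kappa> theta(2)] by blast
  show ?thesis
  proof (rule that[OF \<kappa>, of m])
    fix x y assume xy: "x \<in> X" "y \<in> X" and close: "\<And>i. i < m \<Longrightarrow> mdist \<rho> (x i) (y i) \<le> \<kappa>"
    have "D x y \<le> (\<kappa> + \<theta> ^ m) / (1 - \<theta>)"
      using D_le[OF xy close] \<kappa> by simp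
    also have "\<dots> \<le> (\<kappa> + \<kappa>) / (1 - \<theta>)"
      using m theta by (intro divide_right_mono) auto
    also have "\<dots> = \<beta>"
      using theta by (simp add: \<kappa>_def)
    finally have "D x y \<le> \<beta>" .
    then show "\<bar>\<phi> x - \<phi> y\<bar> \<le> \<eta> \<and> D x y \<le> \<epsilon>"
      using \<delta>(2)[OF xy(2) xy(1)] \<beta> by (auto simp: dist_real_def)
  qed
qed

lemma modulus_agree:
  assumes "0 < \<eta>"
  obtains m where "\<And>x y. x \<in> X \<Longrightarrow> y \<in> X \<Longrightarrow> (\<And>i. i < m \<Longrightarrow> x i = y i) \<Longrightarrow> \<bar>\<phi> x - \<phi> y\<bar> \<le> \<eta>"
proof -
  obtain \<kappa> m where \<kappa>: "0 < \<kappa>" and m: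
    "\<And>x y. x \<in> X \<Longrightarrow> y \<in> X \<Longrightarrow> (\<And>i. i < m \<Longrightarrow> mdist \<rho> (x i) (y i) \<le> \<kappa>) \<Longrightarrow> \<bar>\<phi> x - \<phi> y\<bar> \<le> \<eta> \<and> D x y \<le> 1"
    using modulus[OF assms zero_less_one] by blast
  show ?thesis
  proof (rule that[of m])
    fix x y assume xy: "x \<in> X" "y \<in> X" and agree: "\<And>i. i < m \<Longrightarrow> x i = y i"
    have "mdist \<rho> (x i) (y i) \<le> \<kappa>" if "i < m" for i
    proof -
      have "mdist \<rho> (x i) (y i) = 0"
        using xy agree[OF that] by (simp add: mspace_rho symbol_in_verts)
      with \<kappa> show ?thesis by simp
    qed
    with m[OF xy] show "\<bar>\<phi> x - \<phi> y\<bar> \<le> \<eta>" by blast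
  qed
qed

definition birkhoff_sum :: "nat \<Rightarrow> (nat \<Rightarrow> nat) \<Rightarrow> real" where
  "birkhoff_sum n x = (\<Sum>i<n. \<phi> ((shift ^^ i) x))"

lemma birkhoff_sum_add: "birkhoff_sum (n + k) x = birkhoff_sum n x + birkhoff_sum k ((shift ^^ n) x)"
proof (induction k)
  case (Suc k)
  have "(shift ^^ (n + k)) x = (shift ^^ k) ((shift ^^ n) x)"
    by (simp add: funpow_shift add.assoc add.commute add.left_commute)
  with Suc show ?case by (simp add: birkhoff_sum_def)
qed (simp add: birkhoff_sum_def)

lemma birkhoff_sum_bound:
  assumes "x \<in> X"
  shows "\<bar>birkhoff_sum n x\<bar> \<le> real n * B"
proof -
  have "\<bar>birkhoff_sum n x\<bar> \<le> (\<Sum>i<n. \<bar>\<phi> ((shift ^^ i) x)\<bar>)"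
    unfolding birkhoff_sum_def by (rule sum_abs)
  also have "\<dots> \<le> (\<Sum>i<n. B)"
    by (intro sum_mono phi_bound funpow_shift_in_shift_space assms)
  finally show ?thesis by simp
qed

text \<open>Orbit pieces with a common word of length \<open>L\<close> have almost equal Birkhoff sums: only in the last
  \<open>m\<close> steps do they share fewer than \<open>m\<close> symbols.\<close>

lemma birkhoff_sum_distortion:
  assumes m: "\<And>x y. x \<in> X \<Longrightarrow> y \<in> X \<Longrightarrow> (\<And>i. i < m \<Longrightarrow> x i = y i) \<Longrightarrow> \<bar>\<phi> x - \<phi> y\<bar> \<le> \<eta>"
    and \<eta>: "0 \<le> \<eta>" and xy: "x \<in> X" "y \<in> X" and agree: "\<And>i. i < L \<Longrightarrow> x i = y i"
  shows "\<bar>birkhoff_sum L x - birkhoff_sum L y\<bar> \<le> real L * \<eta> + 2 * real m * B"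
proof -
  have "\<bar>birkhoff_sum L x - birkhoff_sum L y\<bar> \<le> (\<Sum>i<L. \<bar>\<phi> ((shift ^^ i) x) - \<phi> ((shift ^^ i) y)\<bar>)"
    unfolding birkhoff_sum_def sum_subtractf[symmetric] by (rule sum_abs)
  also have "\<dots> \<le> (\<Sum>i<L. \<eta> + (if L < i + m then 2 * B else 0))"
  proof (rule sum_mono)
    fix i
    have in_X: "(shift ^^ i) x \<in> X" "(shift ^^ i) y \<in> X"
      using xy by (auto intro: funpow_shift_in_shift_space)
    show "\<bar>\<phi> ((shift ^^ i) x) - \<phi> ((shift ^^ i) y)\<bar> \<le> \<eta> + (if L < i + m then 2 * B else 0)"
    proof (cases "L < i + m")
      case True
      then show ?thesis
        using phi_bound[OF in_X(1)] phi_bound[OF in_X(2)] \<eta> by auto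
    next
      case False
      have "(shift ^^ i) x j = (shift ^^ i) y j" if "j < m" for j
        using False that agree[of "i + j"] by (simp add: funpow_shift)
      with m[OF in_X] False show ?thesis by simp
    qed
  qed
  also have "\<dots> = real L * \<eta> + 2 * B * real (card {i \<in> {..<L}. L < i + m})"
    by (simp add: sum.distrib sum.If_cases Int_def)
  also have "real (card {i \<in> {..<L}. L < i + m}) \<le> real m"
  proof -
    have "{i \<in> {..<L}. L < i + m} \<subseteq> {L - m..<L}" by auto
    from card_mono[OF _ this] show ?thesis by simp
  qed
  finally show ?thesis
    using B_pos by (simp add: algebra_simps)
qed

lemma phi_measurable: "\<phi> \<in> borel_measurable (shift_borel A)"
proof (rule borel_measurableI)
  fix S :: "real set" assume S: "open S"
  show "\<phi> -` S \<inter> space (shift_borel A) \<in> sets (shift_borel A)"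
  proof (rule openin_in_sets_shift_borel)
    fix x assume x: "x \<in> \<phi> -` S \<inter> space (shift_borel A)"
    then obtain e where e: "0 < e" "\<And>z. \<bar>z - \<phi> x\<bar> < e \<Longrightarrow> z \<in> S"
      using S by (auto simp: open_real)
    obtain m where m: "\<And>x y. x \<in> X \<Longrightarrow> y \<in> X \<Longrightarrow> (\<And>i. i < m \<Longrightarrow> x i = y i) \<Longrightarrow> \<bar>\<phi> x - \<phi> y\<bar> \<le> e / 2"
      using modulus_agree[of "e / 2"] e(1) by auto
    show "\<exists>n. cylinder A n x \<subseteq> \<phi> -` S \<inter> space (shift_borel A)"
    proof (intro exI subsetI)
      fix y assume "y \<in> cylinder A m x"
      then have "y \<in> X" "\<And>i. i < m \<Longrightarrow> y i = x i" by (simp_all add: cylinder_def)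
      then have "\<bar>\<phi> y - \<phi> x\<bar> \<le> e / 2"
        using x by (intro m) auto
      with e have "\<phi> y \<in> S" by simp
      with \<open>y \<in> X\<close> show "y \<in> \<phi> -` S \<inter> space (shift_borel A)" by simp
    qed
  qed simp
qed

context
  fixes M
  assumes M: "M \<in> invariant_measures A"
begin

interpretation measure_preserving M shift
  using M by (simp add: invariant_measures_iff)

lemma space_M: "space M = X"
  by (rule space_invariant_measure[OF M])

lemma phi_measurable_M: "\<phi> \<in> borel_measurable M"
  using phi_measurable M by (simp add: invariant_measures_iff cong: measurable_cong_sets)

lemma phi_integrable: "integrable M \<phi>"
  by (rule integrable_const_bound[of _ B]) (use phi_bound space_M phi_measurable_M in auto)

lemma ext_integral_phi: "ext_integral M \<phi> = ereal (\<integral>x. \<phi> x \<partial>M)"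
proof -
  have fin: "(\<integral>\<^sup>+x. ennreal (\<phi> x) \<partial>M) \<noteq> \<infinity>" "(\<integral>\<^sup>+x. ennreal (- \<phi> x) \<partial>M) \<noteq> \<infinity>"
    using real_integrable_def[THEN iffD1, OF phi_integrable] by auto
  have "ereal (\<integral>x. \<phi> x \<partial>M) = ereal (enn2real (\<integral>\<^sup>+x. ennreal (\<phi> x) \<partial>M)) - ereal (enn2real (\<integral>\<^sup>+x. ennreal (- \<phi> x) \<partial>M))"
    by (simp add: real_lebesgue_integral_def[OF phi_integrable])
  also have "\<dots> = ext_integral M \<phi>"
    unfolding ext_integral_def using fin
    by (metis enn2ereal_ennreal ennreal_enn2real_if enn2real_nonneg infinity_ennreal_def)
  finally show ?thesis ..
qed

lemma birkhoff_sum_integral: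
  "integrable M (birkhoff_sum n)" "(\<integral>x. birkhoff_sum n x \<partial>M) = real n * (\<integral>x. \<phi> x \<partial>M)"
proof -
  have it: "(shift ^^ i) \<in> measurable M M" for i
    by (rule measurable_iterate[OF measurable_T])
  have inv: "distr M M (shift ^^ i) = M" for i
  proof (induction i)
    case (Suc i)
    have "distr M M (shift ^^ Suc i) = distr (distr M M (shift ^^ i)) M shift"
      by (subst distr_distr[OF measurable_T it]) (simp add: comp_def)
    with Suc show ?case by (simp add: invariant comp_def)
  qed (simp add: distr_id2 id_def)
  have int: "integrable M (\<lambda>x. \<phi> ((shift ^^ i) x))" for i
    using phi_integrable inv[of i] by (intro integrable_distr[OF it]) simp
  have eq: "(\<integral>x. \<phi> ((shift ^^ i) x) \<partial>M) = (\<integral>x. \<phi> x \<partial>M)" for i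
    using integral_distr[OF it[of i] phi_measurable_M] inv[of i] by simp
  show "integrable M (birkhoff_sum n)"
    unfolding birkhoff_sum_def[abs_def] using int by (intro Bochner_Integration.integrable_sum)
  show "(\<integral>x. birkhoff_sum n x \<partial>M) = real n * (\<integral>x. \<phi> x \<partial>M)"
    unfolding birkhoff_sum_def using int eq by (subst Bochner_Integration.integral_sum) auto
qed

lemma pressure_ge:
  assumes f: "simple_function M f"
  shows "entropy_wrt M shift (level_partition M f) + ereal (\<integral>x. \<phi> x \<partial>M) \<le> shift_pressure A \<phi>"
proof -
  have "entropy_wrt M shift (level_partition M f) \<le> measure_entropy M shift"
    unfolding measure_entropy_def using level_partition_is_partition[OF f] by (intro SUP_upper) simp
  moreover have "measure_entropy M shift + ereal (\<integral>x. \<phi> x \<partial>M) \<le> shift_pressure A \<phi>"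
    unfolding shift_pressure_def ext_integral_phi[symmetric]
    using M real_integrable_def[THEN iffD1, OF phi_integrable]
    by (intro SUP_upper) (simp add: less_top)
  ultimately show ?thesis
    by (meson add_right_mono order_trans)
qed

end

lemma pressure_le:
  assumes "\<And>M (f :: (nat \<Rightarrow> nat) \<Rightarrow> (nat \<Rightarrow> nat) set). M \<in> invariant_measures A \<Longrightarrow> simple_function M f \<Longrightarrow>
    entropy_wrt M shift (level_partition M f) + ereal (\<integral>x. \<phi> x \<partial>M) \<le> c"
  shows "shift_pressure A \<phi> \<le> c"
  unfolding shift_pressure_def
proof (rule SUP_least)
  fix M assume "M \<in> {M \<in> invariant_measures A. (\<integral>\<^sup>+x. ennreal (- \<phi> x) \<partial>M) < \<infinity>}"
  then have M: "M \<in> invariant_measures A" by simp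
  have "measure_entropy M shift \<le> c - ereal (\<integral>x. \<phi> x \<partial>M)"
    unfolding measure_entropy_def
  proof (rule SUP_least)
    fix P assume "P \<in> {P. finite P \<and> P \<subseteq> sets M \<and> partition_on (space M) P}"
    then obtain f :: "(nat \<Rightarrow> nat) \<Rightarrow> (nat \<Rightarrow> nat) set" where "simple_function M f" "P = level_partition M f"
      using finite_measurable_partition_eq_level_partition[of P M] by auto
    with assms[OF M] show "entropy_wrt M shift P \<le> c - ereal (\<integral>x. \<phi> x \<partial>M)"
      by (simp add: ereal_le_minus)
  qed
  then show "measure_entropy M shift + ext_integral M \<phi> \<le> c"
    by (simp add: ext_integral_phi[OF M] ereal_le_minus)
qed

end

section \<open>The pressure of the shift is at most the pressure of its completion\<close>

lemma ereal_ln_mono: "x \<le> y \<Longrightarrow> ereal_ln x \<le> ereal_ln y"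
  by (cases x; cases y) (auto simp: ereal_ln_def)

lemma ereal_ln_ereal: "0 < r \<Longrightarrow> ereal_ln (ereal r) = ereal (ln r)"
  by (simp add: ereal_ln_def)

lemma separated_sum_antimono:
  assumes "\<epsilon> \<le> \<epsilon>'"
  shows "separated_sum m T f n \<epsilon>' \<le> separated_sum m T f n \<epsilon>"
  unfolding separated_sum_def
proof (rule SUP_subset_mono[OF Collect_mono[OF impI] order_refl])
  fix E assume "finite E \<and> separated_set m T n \<epsilon>' E"
  then show "finite E \<and> separated_set m T n \<epsilon> E"
    unfolding separated_set_def using assms by (meson le_less_trans)
qed

text \<open>The outer limit in the definition of the topological pressure exists because smaller scales
  allow more separated sets.\<close>

lemma Lim_at_right_antimono:
  fixes g :: "real \<Rightarrow> ereal"
  assumes "\<And>a b. 0 < a \<Longrightarrow> a \<le> b \<Longrightarrow> g b \<le> g a"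
  shows "Lim (at_right 0) g = (SUP \<epsilon>\<in>{0<..}. g \<epsilon>)"
proof (rule tendsto_Lim)
  show "(g \<longlongrightarrow> (SUP \<epsilon>\<in>{0<..}. g \<epsilon>)) (at_right 0)"
  proof (rule order_tendstoI)
    fix a assume "a < (SUP \<epsilon>\<in>{0<..}. g \<epsilon>)"
    then obtain e where e: "0 < e" "a < g e"
      by (auto simp: less_SUP_iff)
    have "\<forall>\<^sub>F x in at_right 0. 0 < x \<and> x < e"
      using e(1) by (auto simp: eventually_at_right_field)
    then show "\<forall>\<^sub>F x in at_right 0. a < g x"
    proof eventually_elim
      case (elim x)
      then show ?case
        using e(2) assms[of x e] by (auto intro: less_le_trans)
    qed
  next
    fix a assume a: "(SUP \<epsilon>\<in>{0<..}. g \<epsilon>) < a"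
    have "\<forall>\<^sub>F x in at_right (0::real). 0 < x"
      by (simp add: eventually_at_right_less)
    then show "\<forall>\<^sub>F x in at_right 0. g x < a"
    proof eventually_elim
      case (elim x)
      then have "g x \<le> (SUP \<epsilon>\<in>{0<..}. g \<epsilon>)"
        by (intro SUP_upper) simp
      with a show ?case by (rule le_less_trans[rotated])
    qed
  qed
qed simp

lemma topological_pressure_eq_SUP:
  "topological_pressure m T f =
     (SUP \<epsilon>\<in>{0<..}. limsup (\<lambda>n. ereal_ln (separated_sum m T f n \<epsilon>) / ereal (real n)))"
  unfolding topological_pressure_def
proof (rule Lim_at_right_antimono)
  fix a b :: real assume "0 < a" "a \<le> b"
  then show "limsup (\<lambda>n. ereal_ln (separated_sum m T f n b) / ereal (real n))
      \<le> limsup (\<lambda>n. ereal_ln (separated_sum m T f n a) / ereal (real n))"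
    by (intro Limsup_mono eventually_sequentiallyI[of 1] ereal_divide_right_mono ereal_ln_mono
        separated_sum_antimono) auto
qed

lemma truncate_symbol_eq_mono:
  "truncate_symbol m' u = truncate_symbol m' v \<Longrightarrow> m \<le> m' \<Longrightarrow> truncate_symbol m u = truncate_symbol m v"
  by (auto simp: truncate_symbol_def split: if_splits)

context shift_potential
begin

text \<open>The topology of \<open>\<rho>\<close> is discrete, and only finitely many vertices are up to \<open>m\<close>. If just one of
  two symbols is up to \<open>m\<close> this suffices to keep them apart.\<close>

lemma rho_isolated:
  obtains r where "0 < r" "\<And>v w. v \<in> verts \<Longrightarrow> w \<in> verts \<Longrightarrow> v \<le> m \<Longrightarrow> v \<noteq> w \<Longrightarrow> r \<le> mdist \<rho> v w"
proof -
  have "\<exists>r>0. \<forall>w\<in>verts. v \<noteq> w \<longrightarrow> r \<le> mdist \<rho> v w" if v: "v \<in> verts" for v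
  proof -
    have "openin (mtopology_of \<rho>) {v}"
      using rho v by (simp add: vertex_metric_def)
    then obtain r where "0 < r" "mball_of \<rho> v r \<subseteq> {v}"
      unfolding mtopology_of_def mball_of_def
      using Metric_space.openin_mtopology[OF Metric_space_mspace_mdist[of \<rho>], of "{v}"] by auto
    then show ?thesis
      using v mspace_rho by (intro exI[of _ r]) (auto simp: subset_iff not_less[symmetric])
  qed
  then obtain r where r: "\<And>v. v \<in> verts \<Longrightarrow> 0 < r v"
      "\<And>v w. v \<in> verts \<Longrightarrow> w \<in> verts \<Longrightarrow> v \<noteq> w \<Longrightarrow> r v \<le> mdist \<rho> v w"
    by metis
  define R where "R = Min (insert 1 (r ` (verts \<inter> {..m})))"
  have fin: "finite (insert 1 (r ` (verts \<inter> {..m})))" by simp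
  show ?thesis
  proof (rule that[of R])
    show "0 < R"
      unfolding R_def using r(1) by (subst Min_gr_iff[OF fin]) auto
    fix v w assume vw: "v \<in> verts" "w \<in> verts" "v \<le> m" "v \<noteq> w"
    have "R \<le> r v"
      unfolding R_def using vw by (intro Min_le[OF fin]) auto
    also have "\<dots> \<le> mdist \<rho> v w" using r(2) vw by blast
    finally show "R \<le> mdist \<rho> v w" .
  qed
qed

lemma word_sum_le_separated_sum:
  fixes m :: nat
  assumes E: "finite E" "E \<subseteq> X"
    and inj: "inj_on (itinerary shift (\<lambda>x. truncate_symbol m (x 0)) n) E"
    and r: "\<And>v w. v \<in> verts \<Longrightarrow> w \<in> verts \<Longrightarrow> v \<le> m \<Longrightarrow> v \<noteq> w \<Longrightarrow> r \<le> mdist \<rho> v w"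
    and e: "\<epsilon> < r"
  shows "ereal (\<Sum>x\<in>E. exp (birkhoff_sum n x)) \<le> separated_sum (shift_metric A \<rho> \<theta>) shift \<phi> n \<epsilon>"
  unfolding separated_sum_def birkhoff_sum_def
proof (rule SUP_upper, intro CollectI conjI E(1))
  show "separated_set (shift_metric A \<rho> \<theta>) shift n \<epsilon> E"
    unfolding separated_set_def mspace_X
  proof (intro conjI E(2) ballI impI)
    fix x y assume xy: "x \<in> E" "y \<in> E" "x \<noteq> y"
    then have "itinerary shift (\<lambda>x. truncate_symbol m (x 0)) n x \<noteq> itinerary shift (\<lambda>x. truncate_symbol m (x 0)) n y"
      using inj by (auto dest: inj_onD)
    then obtain j where j: "j < n" "truncate_symbol m (x j) \<noteq> truncate_symbol m (y j)"
      by (auto simp: itinerary_shift)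
    then have "x j \<le> m \<or> y j \<le> m" "x j \<noteq> y j"
      by (auto simp: truncate_symbol_def split: if_splits)
    moreover have V: "x j \<in> verts" "y j \<in> verts"
      using xy E(2) symbol_in_verts by auto
    ultimately have "r \<le> mdist \<rho> (x j) (y j)"
      using r[of "x j" "y j"] r[of "y j" "x j"] mdist_commute[of \<rho> "x j" "y j"] by auto
    also have "\<dots> \<le> D ((shift ^^ j) x) ((shift ^^ j) y)"
    proof -
      have "(shift ^^ j) x \<in> X" "(shift ^^ j) y \<in> X"
        using xy E(2) by (auto intro: funpow_shift_in_shift_space)
      from D_ge_first_symbol[OF this] show ?thesis
        by (simp add: funpow_shift)
    qed
    finally show "\<exists>j<n. \<epsilon> < D ((shift ^^ j) x) ((shift ^^ j) y)"
      using e j(1) by (intro exI[of _ j]) auto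
  qed
qed

text \<open>In each word choose a point whose Birkhoff sum is maximal up to \<open>\<eta>\<close>. These points are separated,
  and the Gibbs inequality applies to their weights.\<close>

lemma truncated_entropy_le_separated_sum:
  assumes M: "M \<in> invariant_measures A"
    and r: "\<And>v w. v \<in> verts \<Longrightarrow> w \<in> verts \<Longrightarrow> v \<le> m \<Longrightarrow> v \<noteq> w \<Longrightarrow> r \<le> mdist \<rho> v w"
    and e: "\<epsilon> < r"
  shows "ereal (obs_entropy M (itinerary shift (\<lambda>x. truncate_symbol m (x 0)) n) + real n * (\<integral>x. \<phi> x \<partial>M))
    \<le> ereal_ln (separated_sum (shift_metric A \<rho> \<theta>) shift \<phi> n \<epsilon>)"
proof (rule ereal_le_epsilon2)
  fix \<eta> :: real assume \<eta>: "0 < \<eta>"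
  interpret measure_preserving M shift
    using M by (simp add: invariant_measures_iff)
  define F where "F = itinerary shift (\<lambda>x. truncate_symbol m (x 0)) n"
  have F: "simple_function M F"
    unfolding F_def using M finite_range_truncate_symbol
    by (intro simple_function_itinerary simple_function_first_symbol measurable_T)
       (auto simp: invariant_measures_iff)
  have spM: "space M = X" by (rule space_M[OF M])
  have "\<exists>x. x \<in> X \<and> F x = c \<and> (\<forall>y\<in>X. F y = c \<longrightarrow> birkhoff_sum n y \<le> birkhoff_sum n x + \<eta>)" if c: "c \<in> F ` X" for c
  proof -
    let ?S = "birkhoff_sum n ` {y \<in> X. F y = c}"
    have ne: "?S \<noteq> {}" using c by auto
    have bdd: "bdd_above ?S"
      using birkhoff_sum_bound[of _ n] by (intro bdd_aboveI[of _ "real n * B"]) (auto simp: abs_le_iff)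
    have "Sup ?S - \<eta> < Sup ?S" using \<eta> by simp
    then obtain s where "s \<in> ?S" "Sup ?S - \<eta> < s"
      using less_cSup_iff[OF ne bdd] by blast
    then obtain x where x: "x \<in> X" "F x = c" "Sup ?S - \<eta> < birkhoff_sum n x" by blast
    have "birkhoff_sum n y \<le> birkhoff_sum n x + \<eta>" if "y \<in> X" "F y = c" for y
    proof -
      have "birkhoff_sum n y \<le> Sup ?S"
        using that by (intro cSup_upper bdd) auto
      with x(3) show ?thesis by simp
    qed
    with x show ?thesis by blast
  qed
  then obtain z where z: "\<And>c. c \<in> F ` X \<Longrightarrow> z c \<in> X" "\<And>c. c \<in> F ` X \<Longrightarrow> F (z c) = c"
      "\<And>c y. c \<in> F ` X \<Longrightarrow> y \<in> X \<Longrightarrow> F y = c \<Longrightarrow> birkhoff_sum n y \<le> birkhoff_sum n (z c) + \<eta>"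
    by metis
  define E where "E = z ` F ` X"
  have fin: "finite (F ` X)"
    using simple_functionD(1)[OF F] spM by simp
  have injz: "inj_on z (F ` X)"
    by (rule inj_onI) (metis z(2))
  have "obs_entropy M F + (\<integral>x. birkhoff_sum n x \<partial>M) \<le> ln (\<Sum>c\<in>F ` space M. exp (birkhoff_sum n (z c) + \<eta>))"
    using z(3) spM by (intro gibbs_inequality[OF F birkhoff_sum_integral(1)[OF M]]) auto
  also have "(\<Sum>c\<in>F ` space M. exp (birkhoff_sum n (z c) + \<eta>)) = exp \<eta> * (\<Sum>x\<in>E. exp (birkhoff_sum n x))"
    unfolding spM E_def by (subst sum.reindex[OF injz]) (simp add: exp_add sum_distrib_left mult.commute)
  also have "ln \<dots> = \<eta> + ln (\<Sum>x\<in>E. exp (birkhoff_sum n x))"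
  proof -
    have "0 < (\<Sum>x\<in>E. exp (birkhoff_sum n x))"
      using fin not_empty spM by (intro sum_pos) (auto simp: E_def)
    then show ?thesis by (simp add: ln_mult)
  qed
  finally have 1: "ereal (obs_entropy M F + real n * (\<integral>x. \<phi> x \<partial>M)) \<le> ereal (ln (\<Sum>x\<in>E. exp (birkhoff_sum n x))) + ereal \<eta>"
    by (simp add: birkhoff_sum_integral(2)[OF M])
  have "ereal (ln (\<Sum>x\<in>E. exp (birkhoff_sum n x))) = ereal_ln (ereal (\<Sum>x\<in>E. exp (birkhoff_sum n x)))"
    using fin not_empty spM by (intro ereal_ln_ereal[symmetric] sum_pos) (auto simp: E_def)
  also have "\<dots> \<le> ereal_ln (separated_sum (shift_metric A \<rho> \<theta>) shift \<phi> n \<epsilon>)"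
  proof (rule ereal_ln_mono, rule word_sum_le_separated_sum[OF _ _ _ r e])
    show "finite E" using fin by (simp add: E_def)
    show "E \<subseteq> X" using z(1) by (auto simp: E_def)
    show "inj_on (itinerary shift (\<lambda>x. truncate_symbol m (x 0)) n) E"
      unfolding F_def[symmetric] E_def using z(2) by (intro inj_onI) force
  qed
  finally show "ereal (obs_entropy M (itinerary shift (\<lambda>x. truncate_symbol m (x 0)) n) + real n * (\<integral>x. \<phi> x \<partial>M))
    \<le> ereal_ln (separated_sum (shift_metric A \<rho> \<theta>) shift \<phi> n \<epsilon>) + ereal \<eta>"
    using order_trans[OF 1 add_right_mono] unfolding F_def by blast
qed

text \<open>The truncation level \<open>m\<close> depends on the prescribed error \<open>d\<close>, and the scale \<open>r / 2\<close> on \<open>m\<close>. Words of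
  \<open>n\<close> approximating letters are functions of truncated words of length \<open>n + m\<close>, which has no influence
  on the rate.\<close>

theorem shift_pressure_le_topological_pressure:
  "shift_pressure A \<phi> \<le> topological_pressure (shift_metric A \<rho> \<theta>) shift \<phi>"
proof (rule pressure_le)
  fix M and f :: "(nat \<Rightarrow> nat) \<Rightarrow> (nat \<Rightarrow> nat) set"
  assume M: "M \<in> invariant_measures A" and f: "simple_function M f"
  interpret measure_preserving M shift
    using M by (simp add: invariant_measures_iff)
  define I where "I = (\<integral>x. \<phi> x \<partial>M)"
  obtain h where h: "entropy_wrt M shift (level_partition M f) = ereal h"
      "(\<lambda>n. obs_entropy M (itinerary shift f n) / real n) \<longlonglongrightarrow> h"
      "\<And>n. h * real n \<le> obs_entropy M (itinerary shift f n)"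
    by (rule entropy_rate[OF f]) (rule that)
  have spM: "space M = X" by (rule space_M[OF M])
  have setsM: "sets M = sets (shift_borel A)"
    using M by (simp add: invariant_measures_iff)
  show "entropy_wrt M shift (level_partition M f) + ereal (\<integral>x. \<phi> x \<partial>M)
      \<le> topological_pressure (shift_metric A \<rho> \<theta>) shift \<phi>"
  proof (rule ereal_le_epsilon2)
    fix d :: real assume d: "0 < d"
    let ?t = "\<lambda>m x. truncate_symbol m (x (0::nat))"
    have t: "simple_function M (?t m)" for m
      by (rule simple_function_first_symbol[OF setsM finite_range_truncate_symbol])
    have refine: "itinerary shift (?t m) m x = itinerary shift (?t m) m y"
      if words: "itinerary shift (?t (Suc m)) (Suc m) x = itinerary shift (?t (Suc m)) (Suc m) y" for m x y
    proof -
      have "truncate_symbol m (x i) = truncate_symbol m (y i)" if i: "i < m" for i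
      proof -
        have "truncate_symbol (Suc m) (x i) = truncate_symbol (Suc m) (y i)"
          using itinerary_eq_iff[THEN iffD1, OF words, rule_format, of i] i by (simp add: funpow_shift)
        then show ?thesis
          by (rule truncate_symbol_eq_mono) simp
      qed
      then show ?thesis
        by (simp add: itinerary_eq_iff funpow_shift)
    qed
    have gen: "sets M = sigma_sets (space M) {{x \<in> space M. itinerary shift (?t m) m x \<in> U} | m U. True}"
      using truncated_words_generate[of A] by (simp only: spM setsM)
    obtain m and \<psi> :: "nat list \<Rightarrow> (nat \<Rightarrow> nat) set"
      where \<psi>: "simple_function M (\<lambda>x. \<psi> (itinerary shift (?t m) m x))"
        and cond: "obs_entropy M (\<lambda>x. (f x, \<psi> (itinerary shift (?t m) m x)))
          - obs_entropy M (\<lambda>x. \<psi> (itinerary shift (?t m) m x)) < d"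
      using approximation_by_observables[OF f simple_function_itinerary[OF t measurable_T] refine gen d] by blast
    define g where "g x = \<psi> (itinerary shift (?t m) m x)" for x
    have g: "simple_function M g" unfolding g_def[abs_def] by (rule \<psi>)
    obtain hm where "entropy_wrt M shift (level_partition M (?t m)) = ereal hm"
      and hm: "(\<lambda>n. obs_entropy M (itinerary shift (?t m) n) / real n) \<longlonglongrightarrow> hm"
        "\<And>n. hm * real n \<le> obs_entropy M (itinerary shift (?t m) n)"
      by (rule entropy_rate[OF t[of m]]) (rule that)
    have le: "h * real n \<le> obs_entropy M (itinerary shift (?t m) (n + m)) + real n * d" for n
    proof -
      have "h * real n \<le> obs_entropy M (itinerary shift g n) + real n * (obs_entropy M (\<lambda>x. (f x, g x)) - obs_entropy M g)"
        using h(3)[of n] itinerary_conditional_bound[OF f g, of n] by linarith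
      also have "\<dots> \<le> obs_entropy M (itinerary shift g n) + real n * d"
        using cond unfolding g_def[abs_def] by (intro add_left_mono mult_left_mono) auto
      also have "obs_entropy M (itinerary shift g n) \<le> obs_entropy M (itinerary shift (?t m) (n + m))"
      proof (rule obs_entropy_mono)
        fix x y assume "itinerary shift (?t m) (n + m) x = itinerary shift (?t m) (n + m) y"
        then have eq: "truncate_symbol m (x i) = truncate_symbol m (y i)" if "i < n + m" for i
          using that by (simp add: itinerary_eq_iff funpow_shift)
        have "itinerary shift (?t m) m ((shift ^^ i) x) = itinerary shift (?t m) m ((shift ^^ i) y)" if "i < n" for i
          unfolding itinerary_shift using that eq by (simp add: funpow_shift)
        then have "g ((shift ^^ i) x) = g ((shift ^^ i) y)" if "i < n" for i
          unfolding g_def using that by (simp only:)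
        then show "itinerary shift g n x = itinerary shift g n y"
          unfolding itinerary_eq_iff by blast
      qed (use simple_function_itinerary[OF _ measurable_T] t g in auto)
      finally show ?thesis by simp
    qed
    have h_le: "h \<le> hm + d"
    proof (rule LIMSEQ_le_const)
      have "(\<lambda>n. obs_entropy M (itinerary shift (?t m) (n + m)) / real (n + m) * (real (n + m) / real n) + d)
          \<longlonglongrightarrow> hm * 1 + d"
      proof (intro tendsto_intros)
        show "(\<lambda>n. obs_entropy M (itinerary shift (?t m) (n + m)) / real (n + m)) \<longlonglongrightarrow> hm"
          using LIMSEQ_ignore_initial_segment[OF hm(1), of m] .
        have "(\<lambda>n. 1 + real m / real n) \<longlonglongrightarrow> 1 + 0"
          by (intro tendsto_intros lim_const_over_n)
        moreover have "\<forall>\<^sub>F n in sequentially. 1 + real m / real n = real (n + m) / real n"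
          by (rule eventually_sequentiallyI[of 1]) (simp add: field_simps)
        ultimately show "(\<lambda>n. real (n + m) / real n) \<longlonglongrightarrow> 1"
          using Lim_transform_eventually by fastforce
      qed
      then show "(\<lambda>n. obs_entropy M (itinerary shift (?t m) (n + m)) / real (n + m) * (real (n + m) / real n) + d)
          \<longlonglongrightarrow> hm + d" by simp
      show "\<exists>N. \<forall>n\<ge>N. h \<le> obs_entropy M (itinerary shift (?t m) (n + m)) / real (n + m) * (real (n + m) / real n) + d"
      proof (intro exI[of _ 1] allI impI)
        fix n :: nat assume "1 \<le> n"
        then have "obs_entropy M (itinerary shift (?t m) (n + m)) / real (n + m) * (real (n + m) / real n)
            = obs_entropy M (itinerary shift (?t m) (n + m)) / real n"
          by simp
        moreover have "h \<le> obs_entropy M (itinerary shift (?t m) (n + m)) / real n + d"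
          using le[of n] \<open>1 \<le> n\<close> by (simp add: field_simps)
        ultimately show "h \<le> obs_entropy M (itinerary shift (?t m) (n + m)) / real (n + m) * (real (n + m) / real n) + d"
          by (simp only:)
      qed
    qed
    obtain r where r: "0 < r" "\<And>v w. v \<in> verts \<Longrightarrow> w \<in> verts \<Longrightarrow> v \<le> m \<Longrightarrow> v \<noteq> w \<Longrightarrow> r \<le> mdist \<rho> v w"
      using rho_isolated[of m] by blast
    let ?L = "\<lambda>\<epsilon> n. ereal_ln (separated_sum (shift_metric A \<rho> \<theta>) shift \<phi> n \<epsilon>) / ereal (real n)"
    have "ereal (hm + I) \<le> limsup (?L (r / 2))"
    proof (rule le_Limsup[OF _ eventually_sequentiallyI[of 1]])
      fix n :: nat assume n: "1 \<le> n"
      have "ereal (real n * (hm + I)) \<le> ereal (obs_entropy M (itinerary shift (?t m) n) + real n * I)"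
        using hm(2)[of n] by (simp add: algebra_simps)
      also have "\<dots> \<le> ereal_ln (separated_sum (shift_metric A \<rho> \<theta>) shift \<phi> n (r / 2))"
        unfolding I_def using r by (intro truncated_entropy_le_separated_sum[OF M r(2)]) auto
      finally have "ereal (real n * (hm + I)) / ereal (real n) \<le> ?L (r / 2) n"
        using n by (intro ereal_divide_right_mono) auto
      then show "ereal (hm + I) \<le> ?L (r / 2) n"
        using n by simp
    qed simp
    also have "\<dots> \<le> topological_pressure (shift_metric A \<rho> \<theta>) shift \<phi>"
      unfolding topological_pressure_eq_SUP using r(1) by (intro SUP_upper) auto
    finally have "ereal (hm + I) + ereal d \<le> topological_pressure (shift_metric A \<rho> \<theta>) shift \<phi> + ereal d"
      by (rule add_right_mono)
    moreover have "entropy_wrt M shift (level_partition M f) + ereal (\<integral>x. \<phi> x \<partial>M) \<le> ereal (hm + I) + ereal d"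
      using h_le by (simp add: h(1) I_def)
    ultimately show "entropy_wrt M shift (level_partition M f) + ereal (\<integral>x. \<phi> x \<partial>M)
        \<le> topological_pressure (shift_metric A \<rho> \<theta>) shift \<phi> + ereal d"
      by (rule order_trans[rotated])
  qed
qed

end

section \<open>Invariant measures from independent concatenation of loops\<close>

context shift_potential
begin

lemma birkhoff_sum_blocks:
  "birkhoff_sum (k * L) x = (\<Sum>j<k. birkhoff_sum L ((shift ^^ (j * L)) x))"
proof (induction k)
  case (Suc k)
  have "birkhoff_sum (Suc k * L) x = birkhoff_sum (k * L + L) x"
    by (simp add: add.commute)
  with Suc show ?case
    unfolding birkhoff_sum_add by simp
qed (simp add: birkhoff_sum_def)

end

text \<open>The reason why an average over \<open>L\<close> cyclic starting positions is invariant under the shift.\<close>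

lemma sum_rotate:
  fixes g :: "nat \<Rightarrow> 'c :: comm_monoid_add"
  assumes "0 < L" "g L = g 0"
  shows "(\<Sum>r<L. g (Suc r)) = (\<Sum>r<L. g r)"
proof -
  obtain l where l: "L = Suc l" using assms(1) gr0_conv_Suc by blast
  have "(\<Sum>r<L. g (Suc r)) = (\<Sum>r<l. g (Suc r)) + g 0"
    using assms(2) by (simp add: l)
  also have "\<dots> = (\<Sum>r<Suc l. g r)"
    by (simp only: sum.lessThan_Suc_shift add.commute)
  finally show ?thesis by (simp only: l)
qed

text \<open>A point of \<open>Y\<close> stands for its initial word of length \<open>L\<close>, a loop at \<open>a\<close>; the condition \<open>returns\<close> makes
  the words freely composable.\<close>

locale loop_family = shift_potential +
  fixes Y :: "(nat \<Rightarrow> nat) set" and a L :: nat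
  assumes finite_Y: "finite Y" and Y_nonempty: "Y \<noteq> {}" and Y_subset: "Y \<subseteq> shift_space A"
    and L_pos: "0 < L" and starts: "y \<in> Y \<Longrightarrow> y 0 = a" and returns: "y \<in> Y \<Longrightarrow> y L = a"
    and distinct: "y \<in> Y \<Longrightarrow> z \<in> Y \<Longrightarrow> (\<And>i. i < L \<Longrightarrow> y i = z i) \<Longrightarrow> y = z"
begin

definition Z :: real where "Z = (\<Sum>y\<in>Y. exp (birkhoff_sum L y))"

lemma Z_pos: "0 < Z"
  unfolding Z_def using finite_Y Y_nonempty by (intro sum_pos) auto

definition block_weight :: "(nat \<Rightarrow> nat) \<Rightarrow> real" where
  "block_weight y = exp (birkhoff_sum L y) / Z"

lemma block_weight_nonneg: "0 \<le> block_weight y"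
  using Z_pos by (simp add: block_weight_def)

definition block_measure :: "(nat \<Rightarrow> nat) measure" where
  "block_measure = point_measure Y (\<lambda>y. ennreal (block_weight y))"

definition block_sequences :: "(nat \<Rightarrow> nat \<Rightarrow> nat) measure" where
  "block_sequences = Pi\<^sub>M UNIV (\<lambda>_ :: nat. block_measure)"

lemma space_block_measure: "space block_measure = Y"
  by (simp add: block_measure_def space_point_measure)

lemma sets_block_measure: "sets block_measure = Pow Y"
  by (simp add: block_measure_def sets_point_measure)

lemma prob_space_block_measure: "prob_space block_measure"
proof
  have "emeasure block_measure (space block_measure) = (\<Sum>y\<in>Y. ennreal (block_weight y))"
    unfolding space_block_measure by (simp add: block_measure_def emeasure_point_measure_finite finite_Y)
  also have "\<dots> = ennreal (\<Sum>y\<in>Y. block_weight y)"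
    using block_weight_nonneg by simp
  also have "(\<Sum>y\<in>Y. block_weight y) = 1"
    using Z_pos by (simp add: block_weight_def Z_def flip: sum_divide_distrib)
  finally show "emeasure block_measure (space block_measure) = 1" by simp
qed

sublocale product_prob_space "\<lambda>_ :: nat. block_measure" UNIV
  by (intro product_prob_spaceI prob_space_block_measure)

lemma space_block_sequences: "\<omega> \<in> space block_sequences \<longleftrightarrow> (\<forall>k. \<omega> k \<in> Y)"
  by (auto simp: block_sequences_def space_PiM space_block_measure PiE_iff)

lemma prob_space_block_sequences: "prob_space block_sequences"
  unfolding block_sequences_def by (rule prob_space_PiM[OF prob_space_block_measure])

definition concat_from :: "nat \<Rightarrow> (nat \<Rightarrow> nat \<Rightarrow> nat) \<Rightarrow> nat \<Rightarrow> nat" where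
  "concat_from r \<omega> n = \<omega> ((n + r) div L) ((n + r) mod L)"

lemma shift_concat_from: "shift (concat_from r \<omega>) = concat_from (Suc r) \<omega>"
  by (simp add: shift_def concat_from_def fun_eq_iff)

lemma concat_from_in_shift_space:
  assumes \<omega>: "\<omega> \<in> space block_sequences"
  shows "concat_from r \<omega> \<in> shift_space A"
proof -
  have Y: "\<omega> k \<in> Y" for k using \<omega> space_block_sequences by blast
  then have X: "\<omega> k \<in> shift_space A" for k using Y_subset by blast
  have "A (\<omega> (n div L) (n mod L)) (\<omega> (Suc n div L) (Suc n mod L))" for n
  (* At the end of a block the next one starts at the vertex to which the block returns. *)
  proof (cases "Suc (n mod L) = L")
    case True
    then have "\<omega> (Suc n div L) (Suc n mod L) = \<omega> (n div L) (Suc (n mod L))"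
      using starts[OF Y] returns[OF Y] by (simp add: mod_Suc)
    then show ?thesis using X[of "n div L"] by (simp add: shift_space_def)
  next
    case False
    then have "Suc n div L = n div L" "Suc n mod L = Suc (n mod L)"
      by (simp_all add: div_Suc mod_Suc)
    then show ?thesis using X[of "n div L"] by (simp add: shift_space_def)
  qed
  then show ?thesis
    using X by (simp add: shift_space_def concat_from_def)
qed

lemma measurable_concat_from: "concat_from r \<in> measurable block_sequences (shift_borel A)"
proof (rule measurable_to_shift_borel)
  show "concat_from r \<in> space block_sequences \<rightarrow> shift_space A"
    using concat_from_in_shift_space by blast
  fix n w
  have symbol: "(\<lambda>\<omega>. \<omega> k j) \<in> measurable block_sequences (count_space UNIV)" for k j
  proof (rule measurable_compose[of "\<lambda>\<omega>. \<omega> k" _ block_measure])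
    show "(\<lambda>\<omega>. \<omega> k) \<in> measurable block_sequences block_measure"
      unfolding block_sequences_def by (rule measurable_component_singleton) simp
    show "(\<lambda>y. y j) \<in> measurable block_measure (count_space UNIV)"
      by (simp add: block_measure_def)
  qed
  show "{\<omega> \<in> space block_sequences. \<forall>i<n. concat_from r \<omega> i = w i} \<in> sets block_sequences"
    unfolding concat_from_def using symbol by measurable
qed

lemma block_sequences_shift_invariant:
  "distr block_sequences block_sequences (\<lambda>\<omega> k. \<omega> (Suc k)) = block_sequences"
  using distr_PiM_reindex[of UNIV "\<lambda>_ :: nat. block_measure" Suc UNIV] prob_space_block_measure
  by (simp add: block_sequences_def restrict_UNIV)

lemma measurable_block_shift: "(\<lambda>\<omega> k. \<omega> (Suc k)) \<in> measurable block_sequences block_sequences"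
  unfolding block_sequences_def by (rule measurable_PiM_single') (auto simp: space_PiM PiE_iff)

text \<open>Concatenated random blocks are invariant only under the \<open>L\<close>-th power of the shift; averaging over
  the position at which the first block is entered repairs this.\<close>

definition loop_measure :: "(nat \<Rightarrow> nat) measure" where
  "loop_measure = measure_pmf (pmf_of_set {..<L}) \<bind> (\<lambda>r. distr block_sequences (shift_borel A) (concat_from r))"

lemma kernel_measurable:
  "(\<lambda>r. distr block_sequences (shift_borel A) (concat_from r))
    \<in> measurable (measure_pmf (pmf_of_set {..<L})) (subprob_algebra (shift_borel A))"
proof -
  interpret \<Omega>: prob_space block_sequences by (rule prob_space_block_sequences)
  have "distr block_sequences (shift_borel A) (concat_from r) \<in> space (subprob_algebra (shift_borel A))" for r
    unfolding space_subprob_algebra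
    using \<Omega>.prob_space_distr[OF measurable_concat_from] by (auto intro: prob_space_imp_subprob_space)
  then show ?thesis
    by (simp add: measurable_pmf_measure1)
qed

lemma sets_loop_measure: "sets loop_measure = sets (shift_borel A)"
  unfolding loop_measure_def by (rule sets_bind[OF sets_kernel[OF kernel_measurable]]) auto

lemma emeasure_loop_measure:
  assumes "U \<in> sets (shift_borel A)"
  shows "emeasure loop_measure U =
    (\<Sum>r<L. emeasure block_sequences (concat_from r -` U \<inter> space block_sequences)) / ennreal (real L)"
proof -
  have "emeasure loop_measure U = (\<integral>\<^sup>+r. emeasure (distr block_sequences (shift_borel A) (concat_from r)) U
      \<partial>measure_pmf (pmf_of_set {..<L}))"
    unfolding loop_measure_def by (rule emeasure_bind[OF _ kernel_measurable assms]) simp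
  also have "\<dots> = (\<Sum>r<L. emeasure block_sequences (concat_from r -` U \<inter> space block_sequences)) / ennreal (real L)"
    using L_pos assms by (subst nn_integral_pmf_of_set)
      (auto simp: emeasure_distr[OF measurable_concat_from] ennreal_of_nat_eq_real_of_nat lessThan_empty_iff)
  finally show ?thesis .
qed

lemma loop_measure_invariant: "loop_measure \<in> invariant_measures A"
proof -
  interpret \<Omega>: prob_space block_sequences by (rule prob_space_block_sequences)
  let ?g = "\<lambda>U r. emeasure block_sequences (concat_from r -` U \<inter> space block_sequences)"
  have space_loop: "space loop_measure = shift_space A"
    using sets_eq_imp_space_eq[OF sets_loop_measure] by simp
  have "prob_space loop_measure"
  proof
    have "concat_from r -` shift_space A \<inter> space block_sequences = space block_sequences" for r
      using concat_from_in_shift_space by blast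
    then have "emeasure loop_measure (space loop_measure) = (\<Sum>r<L. 1) / ennreal (real L)"
      unfolding space_loop using sets.top[of "shift_borel A"]
      by (subst emeasure_loop_measure) (simp_all add: \<Omega>.emeasure_space_1)
    also have "\<dots> = 1"
      using L_pos by (simp add: ennreal_of_nat_eq_real_of_nat divide_ennreal)
    finally show "emeasure loop_measure (space loop_measure) = 1" .
  qed
  moreover have meas: "shift \<in> measurable loop_measure loop_measure"
    using measurable_shift by (simp cong: measurable_cong_sets add: sets_loop_measure)
  moreover have "distr loop_measure loop_measure shift = loop_measure"
  proof (rule measure_eqI)
    fix U assume "U \<in> sets (distr loop_measure loop_measure shift)"
    then have U: "U \<in> sets (shift_borel A)" by (simp add: sets_loop_measure)
    have step: "?g (shift -` U \<inter> shift_space A) r = ?g U (Suc r)" for r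
    proof -
      have "concat_from r -` (shift -` U \<inter> shift_space A) \<inter> space block_sequences
          = concat_from (Suc r) -` U \<inter> space block_sequences"
        using concat_from_in_shift_space[of _ r] by (auto simp: shift_concat_from)
      then show ?thesis by simp
    qed
    (* Entering the blocks after L steps is the same as deleting the block with index 0. *)
    have wrap: "?g U L = ?g U 0"
    proof -
      have L0: "concat_from L \<omega> = concat_from 0 (\<lambda>k. \<omega> (Suc k))" for \<omega>
        using L_pos by (simp add: concat_from_def fun_eq_iff)
      have "?g U 0 = emeasure (distr block_sequences block_sequences (\<lambda>\<omega> k. \<omega> (Suc k)))
          (concat_from 0 -` U \<inter> space block_sequences)"
        by (simp add: block_sequences_shift_invariant)
      also have "\<dots> = emeasure block_sequences ((\<lambda>\<omega> k. \<omega> (Suc k)) -` (concat_from 0 -` U \<inter> space block_sequences)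
          \<inter> space block_sequences)"
        by (rule emeasure_distr[OF measurable_block_shift measurable_sets[OF measurable_concat_from U]])
      also have "(\<lambda>\<omega> k. \<omega> (Suc k)) -` (concat_from 0 -` U \<inter> space block_sequences) \<inter> space block_sequences
          = concat_from L -` U \<inter> space block_sequences"
        using measurable_space[OF measurable_block_shift] by (auto simp: L0)
      finally show ?thesis ..
    qed
    have sums: "(\<Sum>r<L. ?g U (Suc r)) = (\<Sum>r<L. ?g U r)"
      by (rule sum_rotate[where g = "?g U", OF L_pos wrap])
    have "emeasure (distr loop_measure loop_measure shift) U = emeasure loop_measure (shift -` U \<inter> shift_space A)"
      using U by (simp add: emeasure_distr[OF meas] sets_loop_measure space_loop)
    also have "\<dots> = (\<Sum>r<L. ?g U (Suc r)) / ennreal (real L)"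
      using measurable_sets[OF measurable_shift U] by (subst emeasure_loop_measure) (simp_all only: step space_shift_borel)
    also have "\<dots> = emeasure loop_measure U"
      unfolding sums by (rule emeasure_loop_measure[OF U, symmetric])
    finally show "emeasure (distr loop_measure loop_measure shift) U = emeasure loop_measure U" .
  qed simp
  ultimately show ?thesis
    by (simp add: invariant_measures_def sets_loop_measure)
qed

end

section \<open>Pressure carried by a finite family of loops\<close>

context loop_family
begin

definition loop_symbols :: "nat set" where
  "loop_symbols = (\<Union>y\<in>Y. y ` {..<L})"

definition loop_symbol :: "nat \<Rightarrow> nat" where
  "loop_symbol v = (if v \<in> loop_symbols then v else 0)"

lemma finite_loop_symbols: "finite loop_symbols"
  using finite_Y by (simp add: loop_symbols_def)

lemma loop_symbols_pos: "v \<in> loop_symbols \<Longrightarrow> 0 < v"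
  using Y_subset symbol_in_verts by (auto simp: loop_symbols_def verts_def Suc_le_eq)

lemma loop_symbol_eqD: "loop_symbol u = loop_symbol v \<Longrightarrow> v \<in> loop_symbols \<Longrightarrow> u = v"
  using loop_symbols_pos[of v] by (auto simp: loop_symbol_def split: if_splits)

lemma concat_from_loop_symbols:
  assumes "\<omega> \<in> space block_sequences"
  shows "concat_from r \<omega> i \<in> loop_symbols"
proof -
  have "\<omega> ((i + r) div L) \<in> Y" "(i + r) mod L \<in> {..<L}"
    using assms space_block_sequences L_pos by auto
  then show ?thesis
    unfolding concat_from_def loop_symbols_def by blast
qed

lemma concat_from_block:
  assumes "r < L" "i < L"
  shows "concat_from r \<omega> (L - r + j * L + i) = \<omega> (Suc j) i"
proof -
  have "L - r + j * L + i + r = Suc j * L + i"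
    using assms by simp
  then show ?thesis
    using assms by (simp add: concat_from_def del: mult_Suc)
qed

text \<open>The block with index 0 may be entered in the middle, hence only the blocks from index 1 on are
  prescribed.\<close>

lemma emeasure_block_cylinder:
  assumes "\<And>j. \<omega>0 j \<in> Y"
  shows "emeasure block_sequences {\<omega> \<in> space block_sequences. \<forall>j<k. \<omega> (Suc j) = \<omega>0 (Suc j)}
    = ennreal (\<Prod>j<k. block_weight (\<omega>0 (Suc j)))"
proof -
  let ?J = "Suc ` {..<k}"
  have "emeasure block_sequences {\<omega> \<in> space block_sequences. \<forall>j\<in>?J. \<omega> j \<in> {\<omega>0 j}}
      = (\<Prod>j\<in>?J. emeasure block_measure {\<omega>0 j})"
    unfolding block_sequences_def using assms by (intro emeasure_PiM_Collect) (auto simp: sets_block_measure)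
  also have "\<dots> = (\<Prod>j\<in>?J. ennreal (block_weight (\<omega>0 j)))"
    using assms finite_Y by (simp add: block_measure_def emeasure_point_measure_finite)
  also have "\<dots> = (\<Prod>j<k. ennreal (block_weight (\<omega>0 (Suc j))))"
    by (subst prod.reindex) auto
  also have "\<dots> = ennreal (\<Prod>j<k. block_weight (\<omega>0 (Suc j)))"
    by (rule prod_ennreal) (rule block_weight_nonneg)
  finally have "emeasure block_sequences {\<omega> \<in> space block_sequences. \<forall>j\<in>?J. \<omega> j \<in> {\<omega>0 j}}
      = ennreal (\<Prod>j<k. block_weight (\<omega>0 (Suc j)))" .
  moreover have "{\<omega> \<in> space block_sequences. \<forall>j\<in>?J. \<omega> j \<in> {\<omega>0 j}}
      = {\<omega> \<in> space block_sequences. \<forall>j<k. \<omega> (Suc j) = \<omega>0 (Suc j)}"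
    by auto
  ultimately show ?thesis by (simp only:)
qed

text \<open>The error made by evaluating the Birkhoff sum of a block at another point with the same
  symbols; see \<open>birkhoff_sum_distortion\<close>.\<close>

definition distortion :: "nat \<Rightarrow> real \<Rightarrow> real" where
  "distortion m \<eta> = real L * \<eta> + 2 * real m * B"

context
  fixes m :: nat and \<eta> :: real
  assumes m: "\<And>x y. x \<in> shift_space A \<Longrightarrow> y \<in> shift_space A \<Longrightarrow> (\<And>i. i < m \<Longrightarrow> x i = y i) \<Longrightarrow> \<bar>\<phi> x - \<phi> y\<bar> \<le> \<eta>"
    and \<eta>: "0 \<le> \<eta>"
begin

text \<open>Of \<open>k + 1\<close> blocks of symbols, the \<open>k\<close> complete ones carry the Birkhoff sum up to their distortion.
  The incomplete pieces at the two ends have total length \<open>L\<close> and cost at most \<open>L * B\<close>.\<close>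

lemma block_weights_le:
  assumes x: "x \<in> X" and r: "r < L" and \<omega>: "\<And>j. \<omega> j \<in> Y"
    and agree: "\<And>j i. j < k \<Longrightarrow> i < L \<Longrightarrow> x (L - r + j * L + i) = \<omega> (Suc j) i"
  shows "(\<Prod>j<k. block_weight (\<omega> (Suc j)))
    \<le> exp (birkhoff_sum (Suc k * L) x + real L * B - real k * (ln Z - distortion m \<eta>))"
proof -
  let ?x = "(shift ^^ (L - r)) x"
  have x': "?x \<in> X" by (rule funpow_shift_in_shift_space[OF x])
  have block: "birkhoff_sum L (\<omega> (Suc j)) \<le> birkhoff_sum L ((shift ^^ (j * L)) ?x) + distortion m \<eta>" if "j < k" for j
  proof -
    have "\<bar>birkhoff_sum L (\<omega> (Suc j)) - birkhoff_sum L ((shift ^^ (j * L)) ?x)\<bar> \<le> distortion m \<eta>"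
      unfolding distortion_def
    proof (rule birkhoff_sum_distortion[OF m \<eta>])
      show "\<omega> (Suc j) \<in> X" using \<omega> Y_subset by blast
      show "(shift ^^ (j * L)) ?x \<in> X" by (rule funpow_shift_in_shift_space[OF x'])
      show "\<omega> (Suc j) i = (shift ^^ (j * L)) ?x i" if "i < L" for i
        using agree[OF \<open>j < k\<close> that] by (simp add: funpow_shift add.assoc)
    qed
    then show ?thesis by simp
  qed
  have prod: "(\<Prod>j<k. block_weight (\<omega> (Suc j))) = exp (\<Sum>j<k. birkhoff_sum L (\<omega> (Suc j)) - ln Z)"
    unfolding exp_sum[OF finite_lessThan] using Z_pos
    by (intro prod.cong) (auto simp: block_weight_def exp_diff)
  have "(\<Sum>j<k. birkhoff_sum L (\<omega> (Suc j)) - ln Z)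
      \<le> (\<Sum>j<k. birkhoff_sum L ((shift ^^ (j * L)) ?x) + distortion m \<eta> - ln Z)"
  proof (rule sum_mono)
    fix j assume "j \<in> {..<k}"
    then have "j < k" by simp
    from block[OF this] show "birkhoff_sum L (\<omega> (Suc j)) - ln Z
        \<le> birkhoff_sum L ((shift ^^ (j * L)) ?x) + distortion m \<eta> - ln Z"
      by linarith
  qed
  also have "\<dots> = birkhoff_sum (k * L) ?x - real k * (ln Z - distortion m \<eta>)"
    by (simp only: birkhoff_sum_blocks sum.distrib sum_subtractf sum_constant card_lessThan right_diff_distrib)
  also have "birkhoff_sum (k * L) ?x \<le> birkhoff_sum (Suc k * L) x + real L * B"
  proof -
    have "Suc k * L = (L - r) + (k * L + r)" using r by simp
    then have "birkhoff_sum (Suc k * L) x = birkhoff_sum (L - r) x + (birkhoff_sum (k * L) ?x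
        + birkhoff_sum r ((shift ^^ (k * L)) ?x))"
      by (simp only: birkhoff_sum_add)
    moreover have "\<bar>birkhoff_sum (L - r) x\<bar> \<le> real (L - r) * B"
      by (rule birkhoff_sum_bound[OF x])
    moreover have "\<bar>birkhoff_sum r ((shift ^^ (k * L)) ?x)\<bar> \<le> real r * B"
      by (rule birkhoff_sum_bound[OF funpow_shift_in_shift_space[OF x']])
    moreover have "real (L - r) * B + real r * B = real L * B"
      using r by (simp add: of_nat_diff algebra_simps)
    ultimately show ?thesis by linarith
  qed
  finally have "(\<Sum>j<k. birkhoff_sum L (\<omega> (Suc j)) - ln Z)
      \<le> birkhoff_sum (Suc k * L) x + real L * B - real k * (ln Z - distortion m \<eta>)"
    by linarith
  then show ?thesis unfolding prod exp_le_cancel_iff .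
qed

definition loop_word :: "nat \<Rightarrow> (nat \<Rightarrow> nat) \<Rightarrow> nat list" where
  "loop_word n = itinerary shift (\<lambda>x. loop_symbol (x 0)) n"

lemma loop_word_eq_iff: "loop_word n x = loop_word n y \<longleftrightarrow> (\<forall>i<n. loop_symbol (x i) = loop_symbol (y i))"
  by (simp add: loop_word_def itinerary_eq_iff funpow_shift)

text \<open>Upper half of the Gibbs property. For each starting position the symbols of a cylinder
  determine all complete blocks, so the cylinder has at most the product of their weights.\<close>

lemma loop_measure_cylinder_le:
  assumes x: "x \<in> X"
  shows "measure loop_measure {y \<in> X. loop_word (Suc k * L) y = loop_word (Suc k * L) x}
    \<le> exp (birkhoff_sum (Suc k * L) x + real L * B - real k * (ln Z - distortion m \<eta>))" (is "_ \<le> ?R")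
proof -
  let ?n = "Suc k * L"
  let ?C = "{y \<in> X. loop_word ?n y = loop_word ?n x}"
  have C: "?C \<in> sets (shift_borel A)"
  proof (rule finite_coordinates_in_sets_shift_borel[where n = ?n])
    fix y z assume "\<forall>i<?n. y i = z i" "loop_word ?n y = loop_word ?n x"
    then show "loop_word ?n z = loop_word ?n x"
      unfolding loop_word_eq_iff by simp
  qed
  have le: "emeasure block_sequences (concat_from r -` ?C \<inter> space block_sequences) \<le> ennreal ?R" if r: "r < L" for r
  proof (cases "concat_from r -` ?C \<inter> space block_sequences = {}")
    case False
    then obtain \<omega>0 where \<omega>0: "\<omega>0 \<in> space block_sequences" "concat_from r \<omega>0 \<in> ?C"
      by blast
    have Y0: "\<omega>0 j \<in> Y" for j using \<omega>0(1) space_block_sequences by blast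
    (* Loop symbols are not replaced by 0, so equal words have equal symbols there. *)
    have agree: "x i = concat_from r \<omega> i"
      if "i < ?n" "\<omega> \<in> space block_sequences" "concat_from r \<omega> \<in> ?C" for \<omega> i
    proof (rule loop_symbol_eqD)
      show "loop_symbol (x i) = loop_symbol (concat_from r \<omega> i)"
        using that by (simp add: loop_word_eq_iff)
      show "concat_from r \<omega> i \<in> loop_symbols"
        by (rule concat_from_loop_symbols[OF that(2)])
    qed
    have block: "\<omega> (Suc j) i = x (L - r + j * L + i)"
      if "j < k" "i < L" "\<omega> \<in> space block_sequences" "concat_from r \<omega> \<in> ?C" for \<omega> i j
    proof -
      have "Suc j * L \<le> k * L"
        using that(1) by (intro mult_right_mono) auto
      then have "L - r + j * L + i < ?n"
        using that(2) by simp
      from agree[OF this that(3,4)] concat_from_block[OF r that(2)] show ?thesis by simp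
    qed
    have "emeasure block_sequences (concat_from r -` ?C \<inter> space block_sequences)
        \<le> emeasure block_sequences {\<omega> \<in> space block_sequences. \<forall>j<k. \<omega> (Suc j) = \<omega>0 (Suc j)}"
    proof (rule emeasure_mono)
      show "concat_from r -` ?C \<inter> space block_sequences
          \<subseteq> {\<omega> \<in> space block_sequences. \<forall>j<k. \<omega> (Suc j) = \<omega>0 (Suc j)}"
      proof
        fix \<omega> assume "\<omega> \<in> concat_from r -` ?C \<inter> space block_sequences"
        then have \<omega>: "\<omega> \<in> space block_sequences" "concat_from r \<omega> \<in> ?C" by simp_all
        have "\<omega> (Suc j) = \<omega>0 (Suc j)" if "j < k" for j
        proof (rule distinct)
          show "\<omega> (Suc j) \<in> Y" using \<omega>(1) space_block_sequences by blast
          show "\<omega> (Suc j) i = \<omega>0 (Suc j) i" if "i < L" for i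
            using block[OF \<open>j < k\<close> that \<omega>] block[OF \<open>j < k\<close> that \<omega>0] by simp
        qed (rule Y0)
        with \<omega>(1) show "\<omega> \<in> {\<omega> \<in> space block_sequences. \<forall>j<k. \<omega> (Suc j) = \<omega>0 (Suc j)}"
          by blast
      qed
      have "(\<lambda>\<omega>. \<omega> j) \<in> measurable block_sequences block_measure" for j
        unfolding block_sequences_def by (rule measurable_component_singleton) simp
      then have "{\<omega> \<in> space block_sequences. \<omega> (Suc j) = \<omega>0 (Suc j)} \<in> sets block_sequences" for j
        using measurable_sets[of "\<lambda>\<omega>. \<omega> (Suc j)" block_sequences block_measure "{\<omega>0 (Suc j)}"] Y0
        by (simp add: sets_block_measure vimage_def Int_def conj_commute)
      then show "{\<omega> \<in> space block_sequences. \<forall>j<k. \<omega> (Suc j) = \<omega>0 (Suc j)} \<in> sets block_sequences"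
        by measurable
    qed
    also have "\<dots> = ennreal (\<Prod>j<k. block_weight (\<omega>0 (Suc j)))"
      by (rule emeasure_block_cylinder[OF Y0])
    also have "\<dots> \<le> ennreal ?R"
      using block[OF _ _ \<omega>0] by (intro ennreal_leI block_weights_le[OF x r Y0]) simp
    finally show ?thesis .
  qed simp
  have "emeasure loop_measure ?C \<le> (\<Sum>r<L. ennreal ?R) / ennreal (real L)"
    unfolding emeasure_loop_measure[OF C] using le by (intro divide_right_mono_ennreal sum_mono) auto
  also have "\<dots> = ennreal ?R"
  proof -
    have "(\<Sum>r<L. ennreal ?R) = ennreal (real L * ?R)"
      by (simp add: ennreal_mult ennreal_of_nat_eq_real_of_nat del: ennreal_mult'' )
    moreover have "\<dots> / ennreal (real L) = ennreal (real L * ?R / real L)"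
      using L_pos by (intro divide_ennreal) auto
    ultimately show ?thesis using L_pos by simp
  qed
  finally show ?thesis
    unfolding measure_def by (rule enn2real_leI[rotated]) simp
qed

lemma loop_measure_entropy_bound:
  "real k * (ln Z - distortion m \<eta>) - real L * B
    \<le> obs_entropy loop_measure (loop_word (Suc k * L)) + real (Suc k * L) * (\<integral>x. \<phi> x \<partial>loop_measure)"
proof -
  note M = loop_measure_invariant
  interpret measure_preserving loop_measure shift
    using M by (simp add: invariant_measures_iff)
  have "finite (range loop_symbol)"
    by (rule finite_subset[of _ "insert 0 loop_symbols"]) (auto simp: loop_symbol_def finite_loop_symbols)
  then have F: "simple_function loop_measure (loop_word n)" for n
    unfolding loop_word_def
    by (intro simple_function_itinerary simple_function_first_symbol[OF sets_loop_measure] measurable_T)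
  have spM: "space loop_measure = X" by (rule space_M[OF M])
  show ?thesis
    unfolding birkhoff_sum_integral(2)[OF M, symmetric]
  proof (rule obs_entropy_integral_lower_bound[OF F birkhoff_sum_integral(1)[OF M]])
    show "AE x in loop_measure. real k * (ln Z - distortion m \<eta>) - real L * B
      \<le> birkhoff_sum (Suc k * L) x - ln (prob {y \<in> space loop_measure. loop_word (Suc k * L) y = loop_word (Suc k * L) x})"
      using AE_level_set_positive[OF F[of "Suc k * L"]] AE_space
    proof eventually_elim
      case (elim x)
      let ?p = "prob {y \<in> space loop_measure. loop_word (Suc k * L) y = loop_word (Suc k * L) x}"
      have "?p \<le> exp (birkhoff_sum (Suc k * L) x + real L * B - real k * (ln Z - distortion m \<eta>))"
        using loop_measure_cylinder_le elim(2) unfolding spM by blast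
      then have "ln ?p \<le> ln (exp (birkhoff_sum (Suc k * L) x + real L * B - real k * (ln Z - distortion m \<eta>)))"
        by (rule iffD2[OF ln_le_cancel_iff[OF elim(1) exp_gt_zero]])
      then show ?case unfolding ln_exp by linarith
    qed
  qed
qed

text \<open>Integrating the bound on cylinders gives a lower bound for entropy plus integral over words of
  length \<open>(k + 1) * L\<close>, which is divided by this length as \<open>k\<close> tends to infinity.\<close>

theorem loop_pressure_bound: "ereal ((ln Z - distortion m \<eta>) / real L) \<le> shift_pressure A \<phi>"
proof -
  note M = loop_measure_invariant
  interpret measure_preserving loop_measure shift
    using M by (simp add: invariant_measures_iff)
  have "finite (range loop_symbol)"
    by (rule finite_subset[of _ "insert 0 loop_symbols"]) (auto simp: loop_symbol_def finite_loop_symbols)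
  then have f: "simple_function loop_measure (\<lambda>x. loop_symbol (x 0))"
    by (intro simple_function_first_symbol[OF sets_loop_measure])
  define I where "I = (\<integral>x. \<phi> x \<partial>loop_measure)"
  obtain h where h: "entropy_wrt loop_measure shift (level_partition loop_measure (\<lambda>x. loop_symbol (x 0))) = ereal h"
      "(\<lambda>n. obs_entropy loop_measure (itinerary shift (\<lambda>x. loop_symbol (x 0)) n) / real n) \<longlonglongrightarrow> h"
      "\<And>n. h * real n \<le> obs_entropy loop_measure (itinerary shift (\<lambda>x. loop_symbol (x 0)) n)"
    by (rule entropy_rate[OF f]) (rule that)
  have "(ln Z - distortion m \<eta>) / real L \<le> h + I"
  proof (rule LIMSEQ_le)
    have "strict_mono (\<lambda>k. Suc k * L)"
      using L_pos by (intro strict_monoI mult_strict_right_mono) auto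
    from LIMSEQ_subseq_LIMSEQ[OF h(2) this]
    show "(\<lambda>k. obs_entropy loop_measure (loop_word (Suc k * L)) / real (Suc k * L) + I) \<longlonglongrightarrow> h + I"
      unfolding loop_word_def comp_def by (rule tendsto_add[OF _ tendsto_const])
    let ?c = "(ln Z - distortion m \<eta>) / real L"
    have "(\<lambda>k. ?c - (?c + B) * inverse (real (Suc k))) \<longlonglongrightarrow> ?c - (?c + B) * 0"
      by (intro tendsto_intros LIMSEQ_inverse_real_of_nat)
    moreover have "?c - (?c + B) * inverse (real (Suc k))
        = (real k * (ln Z - distortion m \<eta>) - real L * B) / real (Suc k * L)" for k
    proof -
      have "c - (c + B) * inverse (real (Suc k)) = (real k * c - B) / real (Suc k)" for c
        by (simp add: field_simps)
      then have "?c - (?c + B) * inverse (real (Suc k)) = (real k * ?c - B) / real (Suc k)" .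
      also have "\<dots> = (real L * (real k * ?c - B)) / (real L * real (Suc k))"
        using L_pos by simp
      also have "real L * (real k * ?c - B) = real k * (ln Z - distortion m \<eta>) - real L * B"
        using L_pos by (simp add: field_simps)
      finally show ?thesis
        by (simp only: of_nat_mult mult.commute[of "real L" "real (Suc k)"])
    qed
    ultimately show "(\<lambda>k. (real k * (ln Z - distortion m \<eta>) - real L * B) / real (Suc k * L)) \<longlonglongrightarrow> ?c"
      by simp
    show "\<exists>N. \<forall>k\<ge>N. (real k * (ln Z - distortion m \<eta>) - real L * B) / real (Suc k * L)
        \<le> obs_entropy loop_measure (loop_word (Suc k * L)) / real (Suc k * L) + I"
    proof (intro exI allI impI)
      fix k
      have n: "0 < real (Suc k * L)"
        unfolding of_nat_0_less_iff using L_pos by simp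
      have "(real k * (ln Z - distortion m \<eta>) - real L * B) / real (Suc k * L)
          \<le> (obs_entropy loop_measure (loop_word (Suc k * L)) + real (Suc k * L) * I) / real (Suc k * L)"
        using loop_measure_entropy_bound[of k] n unfolding I_def by (intro divide_right_mono) simp_all
      also have "\<dots> = obs_entropy loop_measure (loop_word (Suc k * L)) / real (Suc k * L) + I"
        using n by (simp add: add_divide_distrib del: of_nat_mult)
      finally show "(real k * (ln Z - distortion m \<eta>) - real L * B) / real (Suc k * L)
        \<le> obs_entropy loop_measure (loop_word (Suc k * L)) / real (Suc k * L) + I" .
    qed
  qed
  then have "ereal ((ln Z - distortion m \<eta>) / real L) \<le> ereal h + ereal I" by simp
  also have "\<dots> \<le> shift_pressure A \<phi>"
    using pressure_ge[OF M f] by (simp add: h(1) I_def)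
  finally show ?thesis .
qed

end

end

section \<open>Walks through a sector\<close>

text \<open>For walks \<open>x\<close> of length \<open>l\<close> and \<open>y\<close> starting where \<open>x\<close> ends.\<close>

definition join_at :: "nat \<Rightarrow> (nat \<Rightarrow> 'c) \<Rightarrow> (nat \<Rightarrow> 'c) \<Rightarrow> nat \<Rightarrow> 'c" where
  "join_at l x y i = (if i \<le> l then x i else y (i - l))"

lemma join_at_le: "i \<le> l \<Longrightarrow> join_at l x y i = x i"
  by (simp add: join_at_def)

lemma join_at_add: "x l = y 0 \<Longrightarrow> join_at l x y (l + i) = y i"
  by (simp add: join_at_def)

text \<open>Only the interior vertices are required to lie in \<open>S\<close>, so that excursions from a finite set into
  a sector are covered.\<close>

definition walk :: "(nat \<Rightarrow> nat \<Rightarrow> bool) \<Rightarrow> nat set \<Rightarrow> nat \<Rightarrow> (nat \<Rightarrow> nat) \<Rightarrow> bool" where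
  "walk A S l x \<longleftrightarrow> (\<forall>i\<le>l. x i \<in> verts) \<and> (\<forall>i<l. A (x i) (x (Suc i))) \<and> (\<forall>i. 0 < i \<longrightarrow> i < l \<longrightarrow> x i \<in> S)"

lemma walk_join:
  assumes x: "walk A S l x" and y: "walk A S k y" and eq: "x l = y 0" and mid: "y 0 \<in> S"
  shows "walk A S (l + k) (join_at l x y)"
  unfolding walk_def
proof (intro conjI allI impI)
  fix i assume i: "i \<le> l + k"
  show "join_at l x y i \<in> verts"
    using x y i by (auto simp: join_at_def walk_def)
next
  fix i assume i: "i < l + k"
  show "A (join_at l x y i) (join_at l x y (Suc i))"
  proof (cases "i < l")
    case True
    then show ?thesis using x by (simp add: join_at_def walk_def)
  next
    case False
    then obtain j where j: "i = l + j" by (metis le_add_diff_inverse not_less)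
    have "A (y j) (y (Suc j))"
      using y i j by (simp add: walk_def)
    then show ?thesis
      using join_at_add[of x l y j] join_at_add[of x l y "Suc j"] eq j by simp
  qed
next
  fix i assume i: "0 < i" "i < l + k"
  consider "i < l" | "i = l" | j where "i = l + j" "0 < j" "j < k"
    using i(2) by (metis less_imp_add_positive linorder_cases nat_add_left_cancel_less)
  then show "join_at l x y i \<in> S"
  proof cases
    case 1
    then show ?thesis using x i(1) by (simp add: join_at_def walk_def)
  next
    case 2
    then show ?thesis using mid eq by (simp add: join_at_def)
  next
    case 3
    then show ?thesis using y join_at_add[of x l y j] eq by (simp add: walk_def)
  qed
qed

lemma walk_single: "a \<in> verts \<Longrightarrow> b \<in> verts \<Longrightarrow> A a b \<Longrightarrow> walk A S 1 (\<lambda>i. if i = 0 then a else b)"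
  by (auto simp: walk_def)

lemma walk_const: "a \<in> verts \<Longrightarrow> walk A S 0 (\<lambda>_. a)"
  by (simp add: walk_def)

lemma periodic_point_in_shift_space:
  assumes w: "walk A S L w" and L: "0 < L" and closed: "w L = w 0"
  shows "(\<lambda>n. w (n mod L)) \<in> shift_space A"
proof -
  have "A (w (n mod L)) (w (Suc n mod L))" for n
  proof (cases "Suc (n mod L) = L")
    case True
    then have "w (Suc n mod L) = w (Suc (n mod L))"
      using closed by (simp add: mod_Suc)
    then show ?thesis using w L by (simp add: walk_def)
  next
    case False
    then have "Suc n mod L = Suc (n mod L)" by (simp add: mod_Suc)
    then show ?thesis using w L by (simp add: walk_def)
  qed
  then show ?thesis
    using w L by (simp add: shift_space_def walk_def less_imp_le)
qed

lemma path_in_iff_walk: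
  assumes "S \<subseteq> verts"
  shows "path_in A S a b \<longleftrightarrow> (\<exists>l\<ge>1. \<exists>x. walk A S l x \<and> x 0 = a \<and> x l = b \<and> a \<in> S \<and> b \<in> S)"
proof
  assume "path_in A S a b"
  then obtain l x where "l \<ge> 1" "x 0 = a" "x l = b" "\<forall>k\<le>l. x k \<in> S" "\<forall>k<l. A (x k) (x (Suc k))"
    by (auto simp: path_in_def)
  then show "\<exists>l\<ge>1. \<exists>x. walk A S l x \<and> x 0 = a \<and> x l = b \<and> a \<in> S \<and> b \<in> S"
    using assms by (intro exI[of _ l] conjI exI[of _ x]) (auto simp: walk_def)
next
  assume "\<exists>l\<ge>1. \<exists>x. walk A S l x \<and> x 0 = a \<and> x l = b \<and> a \<in> S \<and> b \<in> S"
  then obtain l x where lx: "l \<ge> 1" "walk A S l x" "x 0 = a" "x l = b" "a \<in> S" "b \<in> S" by blast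
  have "x k \<in> S" if "k \<le> l" for k
  proof (cases "k = 0 \<or> k = l")
    case False
    then show ?thesis using that lx(2) by (simp add: walk_def)
  qed (use lx in auto)
  then show "path_in A S a b"
    unfolding path_in_def using lx by (intro exI[of _ l] conjI exI[of _ x]) (auto simp: walk_def)
qed

lemma path_in_trans:
  assumes S: "S \<subseteq> verts" and ab: "path_in A S a b" and bc: "path_in A S b c"
  shows "path_in A S a c"
proof -
  obtain l x where x: "l \<ge> 1" "walk A S l x" "x 0 = a" "x l = b" "a \<in> S" "b \<in> S"
    using ab path_in_iff_walk[OF S] by metis
  obtain k y where y: "k \<ge> 1" "walk A S k y" "y 0 = b" "y k = c" "c \<in> S"
    using bc path_in_iff_walk[OF S] by metis
  have "walk A S (l + k) (join_at l x y)"
    using x y by (intro walk_join) auto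
  moreover have "join_at l x y 0 = a" "join_at l x y (l + k) = c"
    using x y by (simp_all add: join_at_le join_at_add)
  ultimately show ?thesis
    unfolding path_in_iff_walk[OF S] using x y by (intro exI[of _ "l + k"] conjI exI[of _ "join_at l x y"]) auto
qed

text \<open>Reachability is a total preorder on a connected set, so finite subsets have greatest elements.\<close>

lemma connected_finite_subset_has_sink:
  assumes S: "S \<subseteq> verts" and conn: "connected_vertices A S"
    and T: "finite T" "T \<noteq> {}" "T \<subseteq> S"
  shows "\<exists>v\<in>T. \<forall>u\<in>T. u \<noteq> v \<longrightarrow> path_in A S u v"
  using T
proof (induction T rule: finite_ne_induct)
  case (insert u T)
  then obtain v where v: "v \<in> T" "\<And>w. w \<in> T \<Longrightarrow> w \<noteq> v \<Longrightarrow> path_in A S w v" by auto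
  have uv: "u \<noteq> v" using insert.hyps v(1) by blast
  show ?case
  proof (cases "path_in A S u v")
    case True
    then show ?thesis using v by auto
  next
    case False
    then have vu: "path_in A S v u"
      using conn uv v(1) insert.prems by (auto simp: connected_vertices_def)
    have "path_in A S w u" if "w \<in> T" for w
      using v(2)[OF that] vu path_in_trans[OF S] by (cases "w = v") auto
    then show ?thesis by auto
  qed
qed auto

text \<open>Visit the vertices of \<open>T\<close> in the order given by reachability; the greatest one is appended last.\<close>

lemma connected_walk_covers:
  assumes S: "S \<subseteq> verts" and conn: "connected_vertices A S"
    and T: "finite T" "T \<noteq> {}" "T \<subseteq> S"
  shows "\<exists>l x. walk A S l x \<and> x 0 \<in> S \<and> x l \<in> T \<and> T \<subseteq> x ` {..l}"
  using T
proof (induction "card T" arbitrary: T rule: less_induct)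
  case less
  obtain v where v: "v \<in> T" "\<And>u. u \<in> T \<Longrightarrow> u \<noteq> v \<Longrightarrow> path_in A S u v"
    using connected_finite_subset_has_sink[OF S conn less.prems] by blast
  show ?case
  proof (cases "T - {v} = {}")
    case True
    then have "T = {v}" using v(1) by blast
    then show ?thesis
      using walk_const[of v A S] S less.prems by (intro exI[of _ 0] exI[of _ "\<lambda>_. v"]) auto
  next
    case False
    have "card (T - {v}) < card T"
      using less.prems v(1) by (intro psubset_card_mono) auto
    then obtain l x where x: "walk A S l x" "x 0 \<in> S" "x l \<in> T - {v}" "T - {v} \<subseteq> x ` {..l}"
      using less.hyps[of "T - {v}"] less.prems False by auto
    then have "path_in A S (x l) v" using v(2) by auto
    then obtain k y where y: "k \<ge> 1" "walk A S k y" "y 0 = x l" "y k = v" "x l \<in> S" "v \<in> S"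
      using path_in_iff_walk[OF S] by metis
    let ?z = "join_at l x y"
    have zl: "?z (l + k) = v" using y by (simp add: join_at_add)
    have "T \<subseteq> ?z ` {..l + k}"
    proof
      fix u assume u: "u \<in> T"
      show "u \<in> ?z ` {..l + k}"
      proof (cases "u = v")
        case True
        then show ?thesis using zl by (metis atMost_iff image_eqI order_refl)
      next
        case False
        then obtain i where "i \<le> l" "u = x i" using u x(4) by auto
        then have "u = ?z i" "i \<in> {..l + k}" by (auto simp: join_at_le)
        then show ?thesis by (rule image_eqI)
      qed
    qed
    moreover have "walk A S (l + k) ?z"
      using x y by (intro walk_join) auto
    ultimately show ?thesis
      using zl v(1) x(2) by (intro exI[of _ "l + k"] exI[of _ ?z]) (auto simp: join_at_le)
  qed
qed

text \<open>A walk that visits \<open>n + 1\<close> vertices has length at least \<open>n\<close>.\<close>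

lemma long_walk_in_connected_set:
  assumes S: "S \<subseteq> verts" and conn: "connected_vertices A S" and inf: "infinite S"
  obtains l x where "n \<le> l" "walk A S l x" "x 0 \<in> S" "x l \<in> S"
proof -
  obtain T where T: "T \<subseteq> S" "finite T" "card T = Suc n"
    using infinite_arbitrarily_large[OF inf] by blast
  then have "T \<noteq> {}" by auto
  then obtain l x where x: "walk A S l x" "x 0 \<in> S" "x l \<in> T" "T \<subseteq> x ` {..l}"
    using connected_walk_covers[OF S conn T(2) _ T(1)] by blast
  have "card T \<le> card {..l}"
    using x(4) by (meson card_image_le card_mono finite_atMost finite_imageI le_trans)
  with that[of l x] x T show ?thesis by auto
qed

text \<open>Before its first visit to \<open>F\<close> a walk starting in \<open>S\<close> cannot leave \<open>S\<close>.\<close>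

lemma walk_out:
  assumes S: "S \<subseteq> verts" and exits: "\<And>v u. v \<in> S \<Longrightarrow> u \<in> verts \<Longrightarrow> A v u \<Longrightarrow> u \<in> S \<or> u \<in> F"
    and x: "walk A verts l x" and start: "x 0 \<in> S" and end_F: "x l \<in> F"
  shows "\<exists>k y. walk A S k y \<and> y 0 = x 0 \<and> y k \<in> F"
  using x start end_F
proof (induction l arbitrary: x)
  case 0
  then show ?case by (intro exI[of _ 0] exI[of _ x]) (auto simp: walk_def)
next
  case (Suc l)
  have step: "x 1 \<in> verts" "A (x 0) (x 1)" using Suc.prems(1) by (auto simp: walk_def)
  have x0: "x 0 \<in> verts" using Suc.prems S by auto
  have w1: "walk A S 1 (\<lambda>i. if i = 0 then x 0 else x 1)"
    using x0 step by (intro walk_single) auto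
  show ?case
  proof (cases "x 1 \<in> F")
    case True
    with w1 show ?thesis by (intro exI[of _ 1] exI[of _ "\<lambda>i. if i = 0 then x 0 else x 1"]) auto
  next
    case False
    then have x1: "x 1 \<in> S" using exits[OF Suc.prems(2) step] by blast
    have "walk A verts l (\<lambda>i. x (Suc i))"
      using Suc.prems(1) by (auto simp: walk_def)
    then obtain k y where y: "walk A S k y" "y 0 = x 1" "y k \<in> F"
      using Suc.IH[of "\<lambda>i. x (Suc i)"] x1 Suc.prems(3) by auto
    let ?z = "join_at 1 (\<lambda>i. if i = 0 then x 0 else x 1) y"
    have "walk A S (1 + k) ?z"
      using w1 y x1 by (intro walk_join) auto
    moreover have "?z 0 = x 0" "?z (1 + k) = y k"
      using y by (auto simp: join_at_def)
    ultimately show ?thesis using y(3) by (intro exI[of _ "1 + k"] exI[of _ ?z]) auto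
  qed
qed

text \<open>After its last visit to \<open>F\<close> a walk ending in \<open>S\<close> stays in \<open>S\<close>.\<close>

lemma walk_in:
  assumes S: "S \<subseteq> verts" and entries: "\<And>v u. v \<in> S \<Longrightarrow> u \<in> verts \<Longrightarrow> A u v \<Longrightarrow> u \<in> S \<or> u \<in> F"
    and x: "walk A verts l x" and start: "x 0 \<in> F" and end_S: "x l \<in> S"
  shows "\<exists>k y. walk A S k y \<and> y 0 \<in> F \<and> y k = x l"
  using x start end_S
proof (induction l)
  case 0
  then show ?case by (intro exI[of _ 0] exI[of _ x]) (auto simp: walk_def)
next
  case (Suc l)
  have step: "x l \<in> verts" "A (x l) (x (Suc l))" using Suc.prems(1) by (auto simp: walk_def)
  have xl: "x (Suc l) \<in> verts" using Suc.prems S by auto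
  let ?w = "\<lambda>i::nat. if i = 0 then x l else x (Suc l)"
  have w1: "walk A S 1 ?w"
    using xl step by (intro walk_single) auto
  show ?case
  proof (cases "x l \<in> F")
    case True
    with w1 show ?thesis by (intro exI[of _ 1] exI[of _ ?w]) auto
  next
    case False
    then have xS: "x l \<in> S" using entries[OF Suc.prems(3) step] by blast
    have "walk A verts l x"
      using Suc.prems(1) by (auto simp: walk_def)
    then obtain k y where y: "walk A S k y" "y 0 \<in> F" "y k = x l"
      using Suc.IH xS Suc.prems(2) by auto
    let ?z = "join_at k y ?w"
    have "walk A S (k + 1) ?z"
      using w1 y xS by (intro walk_join) auto
    moreover have "?z 0 = y 0" "?z (k + 1) = x (Suc l)"
      using y by (auto simp: join_at_def)
    ultimately show ?thesis using y(2) by (intro exI[of _ "k + 1"] exI[of _ ?z]) auto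
  qed
qed

lemma long_excursion:
  assumes mixing: "topologically_mixing A" and S: "S \<subseteq> verts" and conn: "connected_vertices A S"
    and inf: "infinite S" and F: "F \<subseteq> verts" "F \<noteq> {}"
    and exits: "\<And>v u. v \<in> S \<Longrightarrow> u \<in> verts \<Longrightarrow> A v u \<Longrightarrow> u \<in> S \<or> u \<in> F"
    and entries: "\<And>v u. v \<in> S \<Longrightarrow> u \<in> verts \<Longrightarrow> A u v \<Longrightarrow> u \<in> S \<or> u \<in> F"
  obtains l x where "n \<le> l" "walk A S l x" "x 0 \<in> F" "x l \<in> F"
proof -
  obtain l x where x: "n \<le> l" "walk A S l x" "x 0 \<in> S" "x l \<in> S"
    by (rule long_walk_in_connected_set[OF S conn inf])
  obtain f where f: "f \<in> F" using F by blast
  have paths: "\<exists>k w. walk A verts k w \<and> w 0 = a \<and> w k = b" if "a \<in> verts" "b \<in> verts" for a b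
    using mixing that path_in_iff_walk[of verts A a b] by (auto simp: topologically_mixing_def)
  obtain k w where w: "walk A verts k w" "w 0 = f" "w k = x 0"
    using paths[OF subsetD[OF F(1) f] subsetD[OF S x(3)]] by metis
  obtain k' w' where w': "walk A verts k' w'" "w' 0 = x l" "w' k' = f"
    using paths[OF subsetD[OF S x(4)] subsetD[OF F(1) f]] by metis
  obtain i u where u: "walk A S i u" "u 0 \<in> F" "u i = x 0"
  proof -
    have "\<exists>i u. walk A S i u \<and> u 0 \<in> F \<and> u i = w k"
      by (rule walk_in[OF S _ w(1)]) (use entries w f x(3) in auto)
    then show ?thesis using that w(3) by auto
  qed
  obtain j v where v: "walk A S j v" "v 0 = x l" "v j \<in> F"
  proof -
    have "\<exists>j v. walk A S j v \<and> v 0 = w' 0 \<and> v j \<in> F"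
      by (rule walk_out[OF S _ w'(1)]) (use exits w' f x(4) in auto)
    then show ?thesis using that w'(2) by auto
  qed
  have ux: "walk A S (i + l) (join_at i u x)"
    using u x by (intro walk_join) auto
  have uxl: "join_at i u x (i + l) = v 0"
    using u v by (simp add: join_at_add)
  have "walk A S (i + l + j) (join_at (i + l) (join_at i u x) v)"
    by (rule walk_join[OF ux v(1) uxl]) (simp add: v(2) x(4))
  moreover have "join_at (i + l) (join_at i u x) v 0 \<in> F"
    using u by (simp add: join_at_le)
  moreover have "join_at (i + l) (join_at i u x) v (i + l + j) \<in> F"
    using v uxl by (simp add: join_at_add)
  ultimately show ?thesis
    using x(1) by (intro that[of "i + l + j" "join_at (i + l) (join_at i u x) v"]) auto
qed

section \<open>Weights of words and of sectors\<close>

context shift_potential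
begin

definition agreement_modulus :: "nat \<Rightarrow> real \<Rightarrow> bool" where
  "agreement_modulus m \<eta> \<longleftrightarrow> 0 \<le> \<eta> \<and>
    (\<forall>x\<in>X. \<forall>y\<in>X. (\<forall>i<m. x i = y i) \<longrightarrow> \<bar>\<phi> x - \<phi> y\<bar> \<le> \<eta>)"

lemma loop_sum_le:
  assumes press: "shift_pressure A \<phi> \<le> ereal P" and mod: "agreement_modulus m \<eta>"
    and Y: "finite Y" "Y \<subseteq> X" and L: "0 < L"
    and loop: "\<And>y. y \<in> Y \<Longrightarrow> y 0 = a" "\<And>y. y \<in> Y \<Longrightarrow> y L = a"
    and distinct: "\<And>y z. y \<in> Y \<Longrightarrow> z \<in> Y \<Longrightarrow> (\<And>i. i < L \<Longrightarrow> y i = z i) \<Longrightarrow> y = z"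
  shows "(\<Sum>y\<in>Y. exp (birkhoff_sum L y)) \<le> exp (real L * (P + \<eta>) + 2 * real m * B)"
proof (cases "Y = {}")
  case False
  interpret loop_family A \<rho> \<theta> \<phi> Y a L
    by unfold_locales (use Y L loop distinct False in auto)
  have m: "\<bar>\<phi> x - \<phi> y\<bar> \<le> \<eta>" if "x \<in> X" "y \<in> X" "\<And>i. i < m \<Longrightarrow> x i = y i" for x y
    using mod that unfolding agreement_modulus_def by blast
  have \<eta>: "0 \<le> \<eta>" using mod by (simp add: agreement_modulus_def)
  have "ereal ((ln Z - distortion m \<eta>) / real L) \<le> ereal P"
    by (rule order_trans[OF loop_pressure_bound[of m \<eta>, OF m \<eta>] press])
  then have "ln Z - distortion m \<eta> \<le> real L * P"
    using L by (simp add: field_simps)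
  then have "ln Z \<le> real L * (P + \<eta>) + 2 * real m * B"
    by (simp add: distortion_def algebra_simps)
  then have "exp (ln Z) \<le> exp (real L * (P + \<eta>) + 2 * real m * B)"
    by (simp only: exp_le_cancel_iff)
  then show ?thesis
    unfolding exp_ln[OF Z_pos] by (simp only: Z_def)
qed simp

text \<open>Close every word by the same walk from \<open>b\<close> to \<open>a\<close> and apply \<open>loop_sum_le\<close> to the periodic points
  so obtained. The cost depends on the length \<open>q\<close> of that walk, but not on \<open>l\<close>.\<close>

lemma word_sum_le:
  assumes press: "shift_pressure A \<phi> \<le> ereal P" and mod: "agreement_modulus m \<eta>"
    and E: "finite E" "E \<subseteq> X"
    and ends: "\<And>y. y \<in> E \<Longrightarrow> y 0 = a" "\<And>y. y \<in> E \<Longrightarrow> y l = b"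
    and distinct: "\<And>y z. y \<in> E \<Longrightarrow> z \<in> E \<Longrightarrow> (\<And>i. i \<le> l \<Longrightarrow> y i = z i) \<Longrightarrow> y = z"
    and u: "walk A verts q u" "0 < q" "u 0 = b" "u q = a"
  shows "(\<Sum>y\<in>E. exp (birkhoff_sum l y)) \<le> exp (real l * (P + 2 * \<eta>) + real q * (P + \<eta> + B) + 4 * real m * B)"
proof -
  let ?L = "l + q"
  define w where "w y n = join_at l y u (n mod ?L)" for y n
  have w_eq: "w y i = y i" if "i \<le> l" for y i
    using that u(2) by (simp add: w_def join_at_le)
  have wX: "w y \<in> X" if y: "y \<in> E" for y
    unfolding w_def
  proof (rule periodic_point_in_shift_space)
    have "walk A verts l y"
      using y E(2) by (auto simp: walk_def shift_space_def)
    then show "walk A verts ?L (join_at l y u)"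
      using u(1,3) ends(2)[OF y] symbol_in_verts[of y l] y E(2) by (intro walk_join) auto
    show "join_at l y u ?L = join_at l y u 0"
      using u ends y by (simp add: join_at_add join_at_le)
  qed (use u(2) in simp)
  have w_inj: "y = z" if "y \<in> E" "z \<in> E" "\<And>i. i < ?L \<Longrightarrow> w y i = w z i" for y z
  proof (rule distinct[OF that(1,2)])
    fix i assume "i \<le> l"
    then show "y i = z i" using that(3)[of i] u(2) by (simp add: w_eq)
  qed
  have inj: "inj_on w E"
    by (rule inj_onI) (use w_inj in simp)
  have \<eta>: "0 \<le> \<eta>" using mod by (simp add: agreement_modulus_def)
  have le: "birkhoff_sum l y \<le> birkhoff_sum ?L (w y) + (real l * \<eta> + 2 * real m * B + real q * B)" if y: "y \<in> E" for y
  proof -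
    have "\<bar>birkhoff_sum l y - birkhoff_sum l (w y)\<bar> \<le> real l * \<eta> + 2 * real m * B"
    proof (rule birkhoff_sum_distortion[OF _ \<eta>])
      show "\<bar>\<phi> x - \<phi> y\<bar> \<le> \<eta>" if "x \<in> X" "y \<in> X" "\<And>i. i < m \<Longrightarrow> x i = y i" for x y
        using mod that unfolding agreement_modulus_def by blast
      show "y i = w y i" if "i < l" for i using that by (simp add: w_eq)
    qed (use y E(2) wX in auto)
    moreover have "\<bar>birkhoff_sum q ((shift ^^ l) (w y))\<bar> \<le> real q * B"
      by (rule birkhoff_sum_bound[OF funpow_shift_in_shift_space[OF wX[OF y]]])
    ultimately show ?thesis
      unfolding birkhoff_sum_add by linarith
  qed
  have "(\<Sum>y\<in>E. exp (birkhoff_sum l y))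
      \<le> (\<Sum>y\<in>E. exp (real l * \<eta> + 2 * real m * B + real q * B) * exp (birkhoff_sum ?L (w y)))"
    using le by (intro sum_mono) (simp add: add.commute flip: exp_add)
  also have "\<dots> = exp (real l * \<eta> + 2 * real m * B + real q * B) * (\<Sum>z\<in>w ` E. exp (birkhoff_sum ?L z))"
    by (subst sum.reindex[OF inj]) (simp add: sum_distrib_left)
  also have "\<dots> \<le> exp (real l * \<eta> + 2 * real m * B + real q * B) * exp (real ?L * (P + \<eta>) + 2 * real m * B)"
  proof (rule mult_left_mono, rule loop_sum_le[OF press mod])
    show "finite (w ` E)" "w ` E \<subseteq> X" "0 < ?L" using E wX u(2) by auto
    show "z 0 = a" if "z \<in> w ` E" for z
      using that ends(1) w_eq[of 0] by auto
    show "z ?L = a" if "z \<in> w ` E" for z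
      using that ends(1) by (auto simp: w_def join_at_le)
    show "y = z" if "y \<in> w ` E" "z \<in> w ` E" "\<And>i. i < ?L \<Longrightarrow> y i = z i" for y z
      using that w_inj by auto
  qed simp
  finally have "(\<Sum>y\<in>E. exp (birkhoff_sum l y))
      \<le> exp ((real l * \<eta> + 2 * real m * B + real q * B) + (real ?L * (P + \<eta>) + 2 * real m * B))"
    unfolding exp_add .
  moreover have "(real l * \<eta> + 2 * real m * B + real q * B) + (real ?L * (P + \<eta>) + 2 * real m * B)
      = real l * (P + 2 * \<eta>) + real q * (P + \<eta> + B) + 4 * real m * B"
    by (simp add: algebra_simps)
  ultimately show ?thesis
    by (simp only:)
qed

lemma closing_walks_bounded:
  assumes mixing: "topologically_mixing A" and F: "finite F" "F \<subseteq> verts"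
  obtains Q where "\<And>a b. a \<in> F \<Longrightarrow> b \<in> F \<Longrightarrow> \<exists>q u. 0 < q \<and> q \<le> Q \<and> walk A verts q u \<and> u 0 = a \<and> u q = b"
proof -
  have "\<exists>q. 0 < q \<and> (\<exists>u. walk A verts q u \<and> u 0 = a \<and> u q = b)" if "a \<in> F" "b \<in> F" for a b
  proof -
    have "path_in A verts a b"
      using mixing that F(2) unfolding topologically_mixing_def by blast
    then obtain l x where "l \<ge> 1" "walk A verts l x" "x 0 = a" "x l = b"
      unfolding path_in_iff_walk[OF order_refl] by blast
    then show ?thesis
      by (intro exI[of _ l] conjI exI[of _ x]) auto
  qed
  then obtain q where q: "\<And>a b. a \<in> F \<Longrightarrow> b \<in> F \<Longrightarrow> 0 < q a b \<and> (\<exists>u. walk A verts (q a b) u \<and> u 0 = a \<and> u (q a b) = b)"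
    by metis
  have "q a b \<le> Max ((\<lambda>(a, b). q a b) ` (F \<times> F))" if "a \<in> F" "b \<in> F" for a b
    using that F(1) by (intro Max_ge) auto
  with q show ?thesis
    by (intro that[of "Max ((\<lambda>(a, b). q a b) ` (F \<times> F))"]) blast
qed

text \<open>Otherwise a periodic orbit that spends all but a bounded number of steps in \<open>S\<close> would have a mean
  close to \<open>\<phi> x\<close>, which is more than the pressure allows. The bounded number of steps is \<open>Q + m\<close>: \<open>Q\<close> to
  close the excursion through \<open>F\<close>, and \<open>m\<close> because \<open>\<phi>\<close> depends essentially on \<open>m\<close> symbols.\<close>

lemma sector_bound:
  assumes press: "shift_pressure A \<phi> \<le> ereal P" and mod: "agreement_modulus m \<eta>"
    and mixing: "topologically_mixing A" and S: "S \<subseteq> verts" and conn: "connected_vertices A S"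
    and inf: "infinite S" and F: "finite F" "F \<subseteq> verts" "F \<noteq> {}"
    and exits: "\<And>v u. v \<in> S \<Longrightarrow> u \<in> verts \<Longrightarrow> A v u \<Longrightarrow> u \<in> S \<or> u \<in> F"
    and entries: "\<And>v u. v \<in> S \<Longrightarrow> u \<in> verts \<Longrightarrow> A u v \<Longrightarrow> u \<in> S \<or> u \<in> F"
    and small: "\<And>x y. x \<in> X \<Longrightarrow> y \<in> X \<Longrightarrow> (\<And>i. i < m \<Longrightarrow> x i \<in> S \<and> y i \<in> S) \<Longrightarrow> \<bar>\<phi> x - \<phi> y\<bar> \<le> \<eta>"
    and x: "x \<in> X" "\<And>i. i < m \<Longrightarrow> x i \<in> S"
  shows "\<phi> x \<le> P + 2 * \<eta>"
proof (rule ccontr)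
  assume "\<not> \<phi> x \<le> P + 2 * \<eta>"
  then have \<delta>: "0 < \<phi> x - P - 2 * \<eta>" by simp
  obtain Q where Q: "\<And>a b. a \<in> F \<Longrightarrow> b \<in> F \<Longrightarrow> \<exists>q u. 0 < q \<and> q \<le> Q \<and> walk A verts q u \<and> u 0 = a \<and> u q = b"
    by (rule closing_walks_bounded[OF mixing F(1,2)]) (rule that)
  define K where "K = 2 * B * (real Q + real m) + 2 * real m * B"
  obtain n where n: "K / (\<phi> x - P - 2 * \<eta>) < real n"
    using reals_Archimedean2 by blast
  obtain p w where w: "n + m \<le> p" "walk A S p w" "w 0 \<in> F" "w p \<in> F"
  proof (rule long_excursion[OF mixing S conn inf F(2,3), where n = "n + m"])
    show "u \<in> S \<or> u \<in> F" if "v \<in> S" "u \<in> verts" "A v u" for v u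
      by (rule exits[OF that])
    show "u \<in> S \<or> u \<in> F" if "v \<in> S" "u \<in> verts" "A u v" for v u
      by (rule entries[OF that])
  qed (rule that)
  obtain q u where u: "0 < q" "q \<le> Q" "walk A verts q u" "u 0 = w p" "u q = w 0"
    using Q[OF w(4,3)] by metis
  let ?L = "p + q"
  define z where "z i = join_at p w u (i mod ?L)" for i
  have z_eq: "z i = w i" if "i \<le> p" for i
    using that u(1) by (simp add: z_def join_at_le)
  have zX: "z \<in> X"
    unfolding z_def
  proof (rule periodic_point_in_shift_space)
    have "walk A verts p w" using w(2) by (simp add: walk_def)
    then show "walk A verts ?L (join_at p w u)"
      using u F(2) w(4) by (intro walk_join) auto
    show "join_at p w u ?L = join_at p w u 0"
      using u by (simp add: join_at_add join_at_le)
  qed (use u(1) in simp)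
  have upper: "birkhoff_sum ?L z \<le> real ?L * (P + \<eta>) + 2 * real m * B"
  proof -
    have "(\<Sum>y\<in>{z}. exp (birkhoff_sum ?L y)) \<le> exp (real ?L * (P + \<eta>) + 2 * real m * B)"
      using zX u(1) by (intro loop_sum_le[OF press mod]) (auto simp: z_def)
    then show ?thesis by simp
  qed
  (* At the times 1, ..., p - m the orbit of z shows at least m symbols of S. *)
  have lower: "(\<phi> x - \<eta>) - (if 0 < j \<and> j \<le> p - m then 0 else 2 * B) \<le> \<phi> ((shift ^^ j) z)" for j
  proof (cases "0 < j \<and> j \<le> p - m")
    case True
    have "\<bar>\<phi> x - \<phi> ((shift ^^ j) z)\<bar> \<le> \<eta>"
    proof (rule small[OF x(1) funpow_shift_in_shift_space[OF zX]])
      fix i assume i: "i < m"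
      have "z (j + i) = w (j + i)" "w (j + i) \<in> S"
        using True i w(1,2) z_eq[of "j + i"] by (auto simp: walk_def)
      then show "x i \<in> S \<and> (shift ^^ j) z i \<in> S"
        using x(2)[OF i] by (simp add: funpow_shift)
    qed
    with True show ?thesis by auto
  next
    case False
    have "0 \<le> \<eta>" using mod by (simp add: agreement_modulus_def)
    then show ?thesis
      using False phi_bound[OF x(1)] phi_bound[OF funpow_shift_in_shift_space[OF zX, of j]] by auto
  qed
  have "real ?L * (\<phi> x - \<eta>) - 2 * B * real (card {j \<in> {..<?L}. \<not> (0 < j \<and> j \<le> p - m)})
      = (\<Sum>j<?L. (\<phi> x - \<eta>) - (if 0 < j \<and> j \<le> p - m then 0 else 2 * B))"
    by (simp add: sum_subtractf sum.If_cases Int_def)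
  also have "\<dots> \<le> birkhoff_sum ?L z"
    unfolding birkhoff_sum_def by (rule sum_mono) (rule lower)
  finally have low: "real ?L * (\<phi> x - \<eta>) - 2 * B * real (card {j \<in> {..<?L}. \<not> (0 < j \<and> j \<le> p - m)})
      \<le> birkhoff_sum ?L z" .
  have "{j \<in> {..<?L}. \<not> (0 < j \<and> j \<le> p - m)} = {..<?L} - {1..p - m}"
    by auto
  moreover have "{1..p - m} \<subseteq> {..<?L}" using u(1) by auto
  ultimately have "card {j \<in> {..<?L}. \<not> (0 < j \<and> j \<le> p - m)} = ?L - (p - m)"
    by (simp add: card_Diff_subset)
  then have "card {j \<in> {..<?L}. \<not> (0 < j \<and> j \<le> p - m)} \<le> Q + m"
    using u(2) w(1) by simp
  then have "2 * B * real (card {j \<in> {..<?L}. \<not> (0 < j \<and> j \<le> p - m)}) \<le> 2 * B * (real Q + real m)"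
    using B_pos by (intro mult_left_mono) (auto simp flip: of_nat_add)
  with low upper have "real ?L * (\<phi> x - \<eta>) - real ?L * (P + \<eta>) \<le> K"
    unfolding K_def by linarith
  then have "real ?L * (\<phi> x - P - 2 * \<eta>) \<le> K"
    by (simp add: algebra_simps)
  moreover have "K < real ?L * (\<phi> x - P - 2 * \<eta>)"
  proof -
    have "K < real n * (\<phi> x - P - 2 * \<eta>)"
      using n \<delta> by (simp add: divide_less_eq)
    also have "\<dots> \<le> real ?L * (\<phi> x - P - 2 * \<eta>)"
      using w(1) \<delta> by (intro mult_right_mono) auto
    finally show ?thesis .
  qed
  ultimately show False by simp
qed

lemma segment_sum_le:
  assumes x: "x \<in> X"
    and bound: "\<And>j. j < s \<Longrightarrow> j + m \<le> s \<Longrightarrow> \<phi> ((shift ^^ j) x) \<le> c"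
  shows "birkhoff_sum s x \<le> real s * c + real m * (B + \<bar>c\<bar>)"
proof -
  have "birkhoff_sum s x \<le> (\<Sum>j<s. c + (if j + m \<le> s then 0 else B + \<bar>c\<bar>))"
    unfolding birkhoff_sum_def
  proof (rule sum_mono)
    fix j assume "j \<in> {..<s}"
    then show "\<phi> ((shift ^^ j) x) \<le> c + (if j + m \<le> s then 0 else B + \<bar>c\<bar>)"
      using bound[of j] phi_bound[OF funpow_shift_in_shift_space[OF x, of j]] by auto
  qed
  also have "\<dots> = real s * c + real (card {j \<in> {..<s}. \<not> j + m \<le> s}) * (B + \<bar>c\<bar>)"
    by (simp add: sum.distrib sum.If_cases Int_def)
  also have "real (card {j \<in> {..<s}. \<not> j + m \<le> s}) \<le> real m"
  proof -
    have "{j \<in> {..<s}. \<not> j + m \<le> s} \<subseteq> {s - m..<s}" by auto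
    from card_mono[OF _ this] show ?thesis by simp
  qed
  finally show ?thesis
    using B_pos by (simp add: mult_right_mono)
qed

end

section \<open>Separated sets sorted by their visits to a finite vertex set\<close>

text \<open>One level of a sectorial arrangement, fine enough for the accuracy \<open>\<eta>\<close> of \<open>\<phi>\<close> and the scale \<open>\<epsilon>\<close>:
  points whose first \<open>m\<close> symbols are within \<open>\<kappa>\<close> are indistinguishable. A third of \<open>\<kappa>\<close> is allowed for
  each part of a path from a symbol to another one in its sector, to a vertex of the same class, and
  on inside the sector of that vertex. The number \<open>P\<close> is any
  upper bound of the variational pressure, and \<open>Q\<close> bounds the length of the closing walks between
  vertices of \<open>F\<close>.\<close>

locale sector_cover = shift_potential +
  fixes F :: "nat set" and \<S> :: "nat set set" and P \<eta> \<kappa> \<epsilon> :: real and m Q :: nat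
    and K :: "nat set" and cls :: "nat \<Rightarrow> nat"
  assumes mixing: "topologically_mixing A" and press: "shift_pressure A \<phi> \<le> ereal P"
    and \<eta>: "0 < \<eta>" and \<kappa>: "0 < \<kappa>"
    and F: "finite F" "F \<subseteq> verts" "F \<noteq> {}"
    and sector: "S \<in> \<S> \<Longrightarrow> S \<subseteq> verts" "S \<in> \<S> \<Longrightarrow> infinite S" "S \<in> \<S> \<Longrightarrow> connected_vertices A S"
    and sector_small: "S \<in> \<S> \<Longrightarrow> i \<in> S \<Longrightarrow> j \<in> S \<Longrightarrow> mdist \<rho> i j \<le> \<kappa> / 3"
    and cover: "verts \<subseteq> F \<union> \<Union>\<S>"
    and separated: "S \<in> \<S> \<Longrightarrow> S' \<in> \<S> \<Longrightarrow> S \<noteq> S' \<Longrightarrow> \<not> leads_to A S S'"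
    and K: "finite K" "v \<in> verts \<Longrightarrow> cls v \<in> K"
    and cls_close: "v \<in> verts \<Longrightarrow> w \<in> verts \<Longrightarrow> cls v = cls w \<Longrightarrow> mdist \<rho> v w \<le> \<kappa> / 3"
    and modulus_m: "x \<in> shift_space A \<Longrightarrow> y \<in> shift_space A \<Longrightarrow> (\<And>i. i < m \<Longrightarrow> mdist \<rho> (x i) (y i) \<le> \<kappa>) \<Longrightarrow>
      \<bar>\<phi> x - \<phi> y\<bar> \<le> \<eta> \<and> mdist (shift_metric A \<rho> \<theta>) x y \<le> \<epsilon>"
    and closing: "a \<in> F \<Longrightarrow> b \<in> F \<Longrightarrow> \<exists>q u. 0 < q \<and> q \<le> Q \<and> walk A verts q u \<and> u 0 = a \<and> u q = b"
begin

lemma rho_self: "v \<in> verts \<Longrightarrow> mdist \<rho> v v = 0"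
  using mdist_zero[of v \<rho> v] mspace_rho by simp

lemma modulus_agreement: "agreement_modulus m \<eta>"
  unfolding agreement_modulus_def
proof (intro conjI ballI impI)
  fix x y assume xy: "x \<in> X" "y \<in> X" and agree: "\<forall>i<m. x i = y i"
  have "mdist \<rho> (x i) (y i) \<le> \<kappa>" if "i < m" for i
    using agree that rho_self[OF symbol_in_verts[OF xy(2), of i]] \<kappa> by simp
  with modulus_m[OF xy] show "\<bar>\<phi> x - \<phi> y\<bar> \<le> \<eta>" by blast
qed (use \<eta> in simp)

text \<open>Distinct sectors are not joined by edges in either direction.\<close>

lemma leave_sector:
  assumes "S \<in> \<S>" "v \<in> S" "u \<in> verts" "A v u \<or> A u v"
  shows "u \<in> S \<or> u \<in> F"
proof (rule ccontr)
  assume "\<not> (u \<in> S \<or> u \<in> F)"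
  then obtain S' where S': "S' \<in> \<S>" "u \<in> S'" "S \<noteq> S'"
    using assms(3) cover by blast
  then have "leads_to A S S' \<or> leads_to A S' S"
    using assms unfolding leads_to_def by blast
  with separated[OF assms(1) S'(1,3)] separated[OF S'(1) assms(1)] S'(3) show False by blast
qed

text \<open>A common bound for the growth rates of orbit pieces inside a sector and of words between vertices
  of \<open>F\<close>.\<close>

definition rate :: real where "rate = P + 2 * \<eta>"

lemma sector_phi_le:
  assumes S: "S \<in> \<S>" and x: "x \<in> X" "\<And>i. i < m \<Longrightarrow> x i \<in> S"
  shows "\<phi> x \<le> rate"
  unfolding rate_def
proof (rule sector_bound[OF press modulus_agreement mixing sector(1)[OF S] sector(3)[OF S] sector(2)[OF S] F])
  show "u \<in> S \<or> u \<in> F" if "v \<in> S" "u \<in> verts" "A v u" for v u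
    using leave_sector[OF S] that by blast
  show "u \<in> S \<or> u \<in> F" if "v \<in> S" "u \<in> verts" "A u v" for v u
    using leave_sector[OF S] that by blast
  show "\<bar>\<phi> x - \<phi> y\<bar> \<le> \<eta>" if "x \<in> X" "y \<in> X" "\<And>i. i < m \<Longrightarrow> x i \<in> S \<and> y i \<in> S" for x y
  proof -
    have "mdist \<rho> (x i) (y i) \<le> \<kappa>" if "i < m" for i
      using sector_small[OF S, of "x i" "y i"] \<open>\<And>i. i < m \<Longrightarrow> x i \<in> S \<and> y i \<in> S\<close>[OF that] \<kappa> by simp
    with modulus_m[OF that(1,2)] show ?thesis by blast
  qed
qed (use x in auto)

lemma stays_in_sector:
  assumes x: "x \<in> X" and avoid: "\<And>i. s \<le> i \<Longrightarrow> i < s + Suc l \<Longrightarrow> x i \<notin> F"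
  shows "\<exists>S\<in>\<S>. \<forall>i. s \<le> i \<longrightarrow> i < s + Suc l \<longrightarrow> x i \<in> S"
  using avoid
proof (induction l)
  case 0
  have "x s \<in> verts" "x s \<notin> F" using 0 symbol_in_verts[OF x] by auto
  then obtain S where "S \<in> \<S>" "x s \<in> S" using cover by blast
  moreover have "i = s" if "s \<le> i" "i < s + Suc 0" for i using that by simp
  ultimately show ?case by blast
next
  case (Suc l)
  then obtain S where S: "S \<in> \<S>" "\<And>i. s \<le> i \<Longrightarrow> i < s + Suc l \<Longrightarrow> x i \<in> S" by auto
  have "A (x (s + l)) (x (s + Suc l))"
    using x by (simp add: shift_space_def)
  then have "x (s + Suc l) \<in> S"
    using leave_sector[OF S(1) S(2)[of "s + l"], of "x (s + Suc l)"] symbol_in_verts[OF x] Suc.prems[of "s + Suc l"]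
    by auto
  moreover have "i < s + Suc l \<or> i = s + Suc l" if "i < s + Suc (Suc l)" for i using that by linarith
  ultimately show ?case using S by blast
qed

text \<open>Bounds the excess over \<open>rate\<close> of a single value of \<open>\<phi>\<close>.\<close>

definition slack :: real where "slack = B + \<bar>rate\<bar>"

lemma slack_nonneg: "0 \<le> slack"
  using B_pos by (simp add: slack_def)

lemma avoiding_sum_le:
  assumes x: "x \<in> X" and avoid: "\<And>i. i < s \<Longrightarrow> x i \<notin> F"
  shows "birkhoff_sum s x \<le> real s * rate + real m * slack"
  unfolding slack_def
proof (rule segment_sum_le[OF x])
  fix j assume j: "j < s" "j + m \<le> s"
  then obtain l where l: "s = Suc l" by (cases s) auto
  have "\<exists>S\<in>\<S>. \<forall>i. 0 \<le> i \<longrightarrow> i < 0 + Suc l \<longrightarrow> x i \<in> S"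
    using avoid by (intro stays_in_sector[OF x]) (simp add: l)
  then obtain S where S: "S \<in> \<S>" "\<And>i. i < s \<Longrightarrow> x i \<in> S"
    by (auto simp: l)
  show "\<phi> ((shift ^^ j) x) \<le> rate"
  proof (rule sector_phi_le[OF S(1) funpow_shift_in_shift_space[OF x]])
    show "(shift ^^ j) x i \<in> S" if "i < m" for i
      using S(2)[of "j + i"] j that by (simp add: funpow_shift)
  qed
qed

text \<open>Both pieces stay in one sector each. A single time \<open>p\<close> at which the sectors are known to be close
  decides for the whole interval.\<close>

lemma avoiding_close:
  assumes xy: "x \<in> X" "y \<in> X"
    and avoid: "\<And>i. s \<le> i \<Longrightarrow> i < t \<Longrightarrow> x i \<notin> F \<and> y i \<notin> F"
    and p: "s \<le> p" "p < t" "cls (x p) = cls (y p)" and i: "s \<le> i" "i < t"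
  shows "mdist \<rho> (x i) (y i) \<le> \<kappa>"
proof -
  obtain l where l: "t = s + Suc l"
    using i by (metis add_Suc_right less_imp_Suc_add order_le_less_trans)
  obtain S where S: "S \<in> \<S>" "\<And>i. s \<le> i \<Longrightarrow> i < t \<Longrightarrow> x i \<in> S"
    using stays_in_sector[OF xy(1), of s l] avoid l by auto
  obtain S' where S': "S' \<in> \<S>" "\<And>i. s \<le> i \<Longrightarrow> i < t \<Longrightarrow> y i \<in> S'"
    using stays_in_sector[OF xy(2), of s l] avoid l by auto
  have V: "x j \<in> mspace \<rho>" "y j \<in> mspace \<rho>" for j
    using symbol_in_verts xy by (auto simp: mspace_rho)
  have "mdist \<rho> (x i) (y i) \<le> mdist \<rho> (x i) (x p) + mdist \<rho> (x p) (y i)"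
    by (rule mdist_triangle[OF V(1) V(1) V(2)])
  also have "mdist \<rho> (x p) (y i) \<le> mdist \<rho> (x p) (y p) + mdist \<rho> (y p) (y i)"
    by (rule mdist_triangle[OF V(1) V(2) V(2)])
  finally have "mdist \<rho> (x i) (y i) \<le> mdist \<rho> (x i) (x p) + (mdist \<rho> (x p) (y p) + mdist \<rho> (y p) (y i))"
    by simp
  moreover have "mdist \<rho> (x i) (x p) \<le> \<kappa> / 3"
    using sector_small[OF S(1)] S(2) i p by blast
  moreover have "mdist \<rho> (y p) (y i) \<le> \<kappa> / 3"
    using sector_small[OF S'(1)] S'(2) i p by blast
  moreover have "mdist \<rho> (x p) (y p) \<le> \<kappa> / 3"
    using cls_close p(3) symbol_in_verts xy by blast
  ultimately show ?thesis by simp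
qed

lemma separated_points_close_eq:
  assumes E: "separated_set (shift_metric A \<rho> \<theta>) shift n \<epsilon> E" and xy: "x \<in> E" "y \<in> E"
    and close: "\<And>i. i < n + m \<Longrightarrow> mdist \<rho> (x i) (y i) \<le> \<kappa>"
  shows "x = y"
proof (rule ccontr)
  assume "x \<noteq> y"
  then obtain j where j: "j < n" "\<epsilon> < D ((shift ^^ j) x) ((shift ^^ j) y)"
    using E xy unfolding separated_set_def by blast
  have X: "x \<in> X" "y \<in> X" using E xy by (auto simp: separated_set_def mspace_X)
  have "D ((shift ^^ j) x) ((shift ^^ j) y) \<le> \<epsilon>"
    using modulus_m[of "(shift ^^ j) x" "(shift ^^ j) y"] funpow_shift_in_shift_space X close j(1)
    by (simp add: funpow_shift)
  with j(2) show False by simp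
qed

text \<open>Collects all contributions that do not grow with the length of the orbit piece.\<close>

definition code_const :: real where
  "code_const = real m * B + (2 * real m + 1) * slack + real Q * (\<bar>P\<bar> + \<eta> + B) + 4 * real m * B"

lemma birkhoff_sum_le_longer:
  assumes "x \<in> X"
  shows "birkhoff_sum n x \<le> birkhoff_sum (n + m) x + real m * B"
proof -
  have "\<bar>birkhoff_sum m ((shift ^^ n) x)\<bar> \<le> real m * B"
    by (rule birkhoff_sum_bound[OF funpow_shift_in_shift_space[OF assms]])
  then show ?thesis unfolding birkhoff_sum_add by linarith
qed

text \<open>Outside the interval from \<open>s\<close> to \<open>t\<close> the orbit pieces are indistinguishable and have Birkhoff sums
  growing at most at \<open>rate\<close>; inside it they have distinct words from \<open>a\<close> to \<open>b\<close>.\<close>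

lemma visiting_fibre_sum_le:
  assumes sep: "separated_set (shift_metric A \<rho> \<theta>) shift n \<epsilon> E" and fin: "finite E"
    and st: "s \<le> t" "t < n + m" and ab: "a \<in> F" "b \<in> F"
    and E: "\<And>x. x \<in> E \<Longrightarrow> x s = a \<and> x t = b \<and> (\<forall>i<s. x i \<notin> F) \<and> (\<forall>i. t < i \<longrightarrow> i < n + m \<longrightarrow> x i \<notin> F)
      \<and> cls (x 0) = c1 \<and> cls (x (n + m - 1)) = c2"
  shows "(\<Sum>x\<in>E. exp (birkhoff_sum n x)) \<le> exp (real (n + m) * rate + code_const)"
proof -
  let ?M = "n + m"
  have EX: "x \<in> X" if "x \<in> E" for x
    using sep that by (auto simp: separated_set_def mspace_X)
  obtain q u where u: "0 < q" "q \<le> Q" "walk A verts q u" "u 0 = b" "u q = a"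
    using closing[OF ab(2,1)] by blast
  define R where "R = real (?M - (t - s)) * rate + (2 * real m + 1) * slack + real m * B"
  have each: "birkhoff_sum n x \<le> R + birkhoff_sum (t - s) ((shift ^^ s) x)" if x: "x \<in> E" for x
  proof -
    let ?y = "(shift ^^ s) x"
    let ?z = "(shift ^^ (t - s)) ?y"
    have zX: "?y \<in> X" "?z \<in> X" "(shift ^^ 1) ?z \<in> X"
      using EX[OF x] by (intro funpow_shift_in_shift_space | assumption)+
    have z_eq: "(shift ^^ 1) ?z i = x (t + 1 + i)" for i
      using st(1) by (simp add: funpow_shift shift_def)
    (* Until the first visit, between the visits, the last visit itself, and after it. *)
    have "?M = s + ((t - s) + (1 + (?M - t - 1)))" using st by simp
    then have split: "birkhoff_sum ?M x = birkhoff_sum s x + (birkhoff_sum (t - s) ?y + (birkhoff_sum 1 ?z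
        + birkhoff_sum (?M - t - 1) ((shift ^^ 1) ?z)))"
      by (metis birkhoff_sum_add)
    have 1: "birkhoff_sum s x \<le> real s * rate + real m * slack"
      using E[OF x] by (intro avoiding_sum_le EX x) auto
    have 2: "birkhoff_sum 1 ?z \<le> rate + slack"
      using birkhoff_sum_bound[OF zX(2), of 1] by (auto simp: slack_def)
    have 3: "birkhoff_sum (?M - t - 1) ((shift ^^ 1) ?z) \<le> real (?M - t - 1) * rate + real m * slack"
    proof (rule avoiding_sum_le[OF zX(3)])
      fix i assume "i < ?M - t - 1"
      then show "(shift ^^ 1) ?z i \<notin> F"
        unfolding z_eq using E[OF x] by auto
    qed
    have "real (?M - (t - s)) = real s + (1 + real (?M - t - 1))" using st by simp
    then have "real (?M - (t - s)) * rate = real s * rate + (rate + real (?M - t - 1) * rate)"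
      by (simp only: distrib_right mult_1_left)
    then show ?thesis
      using birkhoff_sum_le_longer[OF EX[OF x], of n] split 1 2 3
      unfolding R_def distrib_right mult.assoc[of 2] mult_1_left by linarith
  qed
  have agree_eq: "x = y" if "x \<in> E" "y \<in> E" "\<And>i. i \<le> t - s \<Longrightarrow> (shift ^^ s) x i = (shift ^^ s) y i" for x y
  proof (rule separated_points_close_eq[OF sep that(1,2)])
    fix i assume i: "i < ?M"
    consider "i < s" | "s \<le> i" "i \<le> t" | "t < i" by linarith
    then show "mdist \<rho> (x i) (y i) \<le> \<kappa>"
    proof cases
      case 1
      then show ?thesis
        using E[OF that(1)] E[OF that(2)] by (intro avoiding_close[where s = 0 and t = s and p = 0] EX that) auto
    next
      case 2
      then have "x i = y i"
        using that(3)[of "i - s"] by (simp add: funpow_shift)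
      then show ?thesis
        using rho_self[OF symbol_in_verts[OF EX[OF that(2)], of i]] \<kappa> by simp
    next
      case 3
      then show ?thesis
        using E[OF that(1)] E[OF that(2)] i
        by (intro avoiding_close[where s = "Suc t" and t = ?M and p = "?M - 1"] EX that) auto
    qed
  qed
  have inj: "inj_on (shift ^^ s) E"
    by (rule inj_onI) (use agree_eq in simp)
  have "(\<Sum>y\<in>(shift ^^ s) ` E. exp (birkhoff_sum (t - s) y))
      \<le> exp (real (t - s) * (P + 2 * \<eta>) + real q * (P + \<eta> + B) + 4 * real m * B)"
  proof (rule word_sum_le[OF press modulus_agreement _ _ _ _ _ u(3,1,4,5)])
    show "finite ((shift ^^ s) ` E)" using fin by simp
    show "(shift ^^ s) ` E \<subseteq> X" using EX by (auto intro: funpow_shift_in_shift_space)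
    show "y 0 = a" "y (t - s) = b" if "y \<in> (shift ^^ s) ` E" for y
      using that E st(1) by (auto simp: funpow_shift)
    show "y = z" if yz: "y \<in> (shift ^^ s) ` E" "z \<in> (shift ^^ s) ` E"
      and agree: "\<And>i. i \<le> t - s \<Longrightarrow> y i = z i" for y z
    proof -
      obtain x x' where "x \<in> E" "x' \<in> E" "y = (shift ^^ s) x" "z = (shift ^^ s) x'"
        using yz by blast
      with agree_eq[of x x'] agree show ?thesis by simp
    qed
  qed
  also have "\<dots> \<le> exp (real (t - s) * rate + real Q * (\<bar>P\<bar> + \<eta> + B) + 4 * real m * B)"
  proof -
    have "real q * (P + \<eta> + B) \<le> real q * (\<bar>P\<bar> + \<eta> + B)"
      by (intro mult_left_mono) auto
    also have "\<dots> \<le> real Q * (\<bar>P\<bar> + \<eta> + B)"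
      using u(2) \<eta> B_pos by (intro mult_right_mono) auto
    finally show ?thesis by (simp add: rate_def)
  qed
  finally have mid: "(\<Sum>y\<in>(shift ^^ s) ` E. exp (birkhoff_sum (t - s) y))
      \<le> exp (real (t - s) * rate + real Q * (\<bar>P\<bar> + \<eta> + B) + 4 * real m * B)" .
  have "(\<Sum>x\<in>E. exp (birkhoff_sum n x)) \<le> (\<Sum>x\<in>E. exp R * exp (birkhoff_sum (t - s) ((shift ^^ s) x)))"
    unfolding exp_add[symmetric] exp_le_cancel_iff using each by (intro sum_mono) simp
  also have "\<dots> = exp R * (\<Sum>y\<in>(shift ^^ s) ` E. exp (birkhoff_sum (t - s) y))"
    by (subst sum.reindex[OF inj]) (simp add: sum_distrib_left)
  also have "\<dots> \<le> exp R * exp (real (t - s) * rate + real Q * (\<bar>P\<bar> + \<eta> + B) + 4 * real m * B)"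
    using mid by (intro mult_left_mono) auto
  finally have fin_le: "(\<Sum>x\<in>E. exp (birkhoff_sum n x))
      \<le> exp (R + (real (t - s) * rate + real Q * (\<bar>P\<bar> + \<eta> + B) + 4 * real m * B))"
    unfolding exp_add .
  have "real (?M - (t - s)) * rate + real (t - s) * rate = real ?M * rate"
    using st by (simp add: of_nat_diff algebra_simps)
  then have "R + (real (t - s) * rate + real Q * (\<bar>P\<bar> + \<eta> + B) + 4 * real m * B) = real ?M * rate + code_const"
    unfolding R_def code_const_def by linarith
  with fin_le show ?thesis by (simp only:)
qed

lemma avoiding_fibre_sum_le:
  assumes sep: "separated_set (shift_metric A \<rho> \<theta>) shift n \<epsilon> E" and fin: "finite E"
    and E: "\<And>x. x \<in> E \<Longrightarrow> (\<forall>i<n + m. x i \<notin> F) \<and> cls (x 0) = c1"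
  shows "(\<Sum>x\<in>E. exp (birkhoff_sum n x)) \<le> exp (real (n + m) * rate + code_const)"
proof (cases "E = {}")
  case False
  then obtain x where x: "x \<in> E" by blast
  have EX: "y \<in> X" if "y \<in> E" for y
    using sep that by (auto simp: separated_set_def mspace_X)
  have "y = x" if "y \<in> E" for y
  proof (rule separated_points_close_eq[OF sep that x])
    fix i assume "i < n + m"
    then show "mdist \<rho> (y i) (x i) \<le> \<kappa>"
      using E[OF that] E[OF x] by (intro avoiding_close[where s = 0 and t = "n + m" and p = 0] EX that x) auto
  qed
  then have E_eq: "E = {x}" using x by blast
  have "birkhoff_sum n x \<le> (real (n + m) * rate + real m * slack) + real m * B"
    using birkhoff_sum_le_longer[OF EX[OF x], of n] avoiding_sum_le[OF EX[OF x], of "n + m"] E[OF x] by force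
  also have "\<dots> \<le> real (n + m) * rate + code_const"
  proof -
    have "0 \<le> real m * slack" "0 \<le> slack" "0 \<le> real Q * (\<bar>P\<bar> + \<eta> + B)" "0 \<le> real m * B"
      using slack_nonneg B_pos \<eta> by auto
    then show ?thesis unfolding code_const_def distrib_right mult.assoc by linarith
  qed
  finally show ?thesis unfolding E_eq by simp
qed simp

end

section \<open>The pressure of the completion is at most the pressure of the shift\<close>

text \<open>Turns the quadratic number of codes into an exponential of small rate.\<close>

lemma square_le_exp:
  fixes \<eta> :: real
  assumes "0 < \<eta>" "0 \<le> x"
  shows "x ^ 2 \<le> (2 / \<eta>) ^ 2 * exp (\<eta> * x)"
proof -
  have "\<eta> / 2 * x \<le> exp (\<eta> / 2 * x)"
    using exp_ge_add_one_self[of "\<eta> / 2 * x"] by linarith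
  then have "x \<le> 2 / \<eta> * exp (\<eta> / 2 * x)"
    using assms(1) by (simp add: field_simps)
  then have "x ^ 2 \<le> (2 / \<eta> * exp (\<eta> / 2 * x)) ^ 2"
    using assms(2) by (intro power_mono)
  also have "\<dots> = (2 / \<eta>) ^ 2 * exp (\<eta> * x)"
    unfolding power_mult_distrib by (simp add: power2_eq_square flip: exp_add)
  finally show ?thesis .
qed

context sector_cover
begin

definition visits :: "nat \<Rightarrow> (nat \<Rightarrow> nat) \<Rightarrow> nat set" where
  "visits M x = {i \<in> {..<M}. x i \<in> F}"

text \<open>Times \<open>s = t = M\<close>, which no visit can have, mark orbit pieces that avoid \<open>F\<close>; 0 is then a
  placeholder for the missing vertices.\<close>

definition itinerary_code :: "nat \<Rightarrow> (nat \<Rightarrow> nat) \<Rightarrow> (nat \<times> nat) \<times> (nat \<times> nat) \<times> (nat \<times> nat)" where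
  "itinerary_code M x =
    (if visits M x = {} then ((M, M), (cls (x 0), cls (x (M - 1))), (0, 0))
     else ((Min (visits M x), Max (visits M x)), (cls (x 0), cls (x (M - 1))),
       (x (Min (visits M x)), x (Max (visits M x)))))"

lemma finite_visits: "finite (visits M x)"
  by (simp add: visits_def)

lemma visits_Min_Max:
  assumes "visits M x \<noteq> {}"
  shows "Min (visits M x) \<in> visits M x" "Max (visits M x) \<in> visits M x" "Min (visits M x) \<le> Max (visits M x)"
    "i < Min (visits M x) \<Longrightarrow> x i \<notin> F" "Max (visits M x) < i \<Longrightarrow> i < M \<Longrightarrow> x i \<notin> F"
proof -
  show 1: "Min (visits M x) \<in> visits M x" and 2: "Max (visits M x) \<in> visits M x"
    using assms finite_visits by auto
  show "Min (visits M x) \<le> Max (visits M x)"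
    using Min_le[OF finite_visits 2] .
  show "x i \<notin> F" if "i < Min (visits M x)"
  proof
    assume "x i \<in> F"
    moreover have "i < M" using that 1 by (auto simp: visits_def)
    ultimately have "i \<in> visits M x" by (simp add: visits_def)
    from Min_le[OF finite_visits this] that show False by simp
  qed
  show "x i \<notin> F" if "Max (visits M x) < i" "i < M"
  proof
    assume "x i \<in> F"
    then have "i \<in> visits M x" using that(2) by (simp add: visits_def)
    from Max_ge[OF finite_visits this] that show False by simp
  qed
qed

definition codes :: "nat \<Rightarrow> ((nat \<times> nat) \<times> (nat \<times> nat) \<times> (nat \<times> nat)) set" where
  "codes M = ({..M} \<times> {..M}) \<times> (K \<times> K) \<times> (insert 0 F \<times> insert 0 F)"

lemma itinerary_code_in_codes:
  assumes "x \<in> X"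
  shows "itinerary_code M x \<in> codes M"
proof (cases "visits M x = {}")
  case True
  then show ?thesis
    using K(2)[OF symbol_in_verts[OF assms]] by (simp add: itinerary_code_def codes_def)
next
  case False
  then show ?thesis
    using K(2)[OF symbol_in_verts[OF assms]] visits_Min_Max(1,2)[OF False]
    by (auto simp: itinerary_code_def codes_def visits_def)
qed

lemma separated_set_sum_le:
  assumes sep: "separated_set (shift_metric A \<rho> \<theta>) shift n \<epsilon> E" and fin: "finite E"
  shows "(\<Sum>x\<in>E. exp (birkhoff_sum n x)) \<le> real (card (codes (n + m))) * exp (real (n + m) * rate + code_const)"
proof -
  let ?M = "n + m"
  have EX: "x \<in> X" if "x \<in> E" for x
    using sep that by (auto simp: separated_set_def mspace_X)
  have finC: "finite (codes ?M)"
    using K(1) F(1) by (simp add: codes_def)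
  have sub: "itinerary_code ?M ` E \<subseteq> codes ?M"
    using itinerary_code_in_codes EX by blast
  have fibre: "(\<Sum>x\<in>{x \<in> E. itinerary_code ?M x = y}. exp (birkhoff_sum n x)) \<le> exp (real ?M * rate + code_const)"
    if y_code: "y \<in> itinerary_code ?M ` E" for y
  proof -
    let ?E = "{x \<in> E. itinerary_code ?M x = y}"
    have sepE: "separated_set (shift_metric A \<rho> \<theta>) shift n \<epsilon> ?E"
      using sep unfolding separated_set_def by blast
    have finE: "finite ?E" using fin by simp
    obtain s t c1 c2 a b where y: "y = ((s, t), (c1, c2), (a, b))"
      by (cases y) auto
    show ?thesis
    proof (cases "s < ?M")
      case True
      have vis: "visits ?M x \<noteq> {}" "Min (visits ?M x) = s" "Max (visits ?M x) = t" "x s = a" "x t = b"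
        "cls (x 0) = c1" "cls (x (?M - 1)) = c2" if "x \<in> ?E" for x
        using that True by (auto simp: itinerary_code_def y split: if_splits)
      obtain x where x: "x \<in> ?E" using y_code by blast
      have st: "s \<le> t" "t < ?M" "a \<in> F" "b \<in> F"
        using visits_Min_Max(1-3)[OF vis(1)[OF x]] vis(2-5)[OF x] by (auto simp: visits_def)
      show ?thesis
      proof (rule visiting_fibre_sum_le[OF sepE finE st])
        fix x assume x: "x \<in> ?E"
        show "x s = a \<and> x t = b \<and> (\<forall>i<s. x i \<notin> F) \<and> (\<forall>i. t < i \<longrightarrow> i < ?M \<longrightarrow> x i \<notin> F)
          \<and> cls (x 0) = c1 \<and> cls (x (?M - 1)) = c2"
          using visits_Min_Max(4,5)[OF vis(1)[OF x]] vis(2-7)[OF x] by auto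
      qed
    next
      case False
      have "visits ?M x = {} \<and> cls (x 0) = c1" if "x \<in> ?E" for x
      proof -
        have "visits ?M x = {}"
        proof (rule ccontr)
          assume ne: "visits ?M x \<noteq> {}"
          then have "Min (visits ?M x) = s"
            using that by (simp add: itinerary_code_def y)
          with visits_Min_Max(1)[OF ne] False show False by (simp add: visits_def)
        qed
        with that show ?thesis by (simp add: itinerary_code_def y)
      qed
      then show ?thesis
        by (intro avoiding_fibre_sum_le[OF sepE finE, of c1]) (auto simp: visits_def)
    qed
  qed
  have "(\<Sum>x\<in>E. exp (birkhoff_sum n x))
      = (\<Sum>y\<in>itinerary_code ?M ` E. \<Sum>x\<in>{x \<in> E. itinerary_code ?M x = y}. exp (birkhoff_sum n x))"
    by (rule sum.image_gen[OF fin])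
  also have "\<dots> \<le> (\<Sum>y\<in>itinerary_code ?M ` E. exp (real ?M * rate + code_const))"
    by (intro sum_mono fibre)
  also have "\<dots> = real (card (itinerary_code ?M ` E)) * exp (real ?M * rate + code_const)"
    by simp
  also have "\<dots> \<le> real (card (codes ?M)) * exp (real ?M * rate + code_const)"
    using card_mono[OF finC sub] by (intro mult_right_mono) auto
  finally show ?thesis .
qed

lemma card_codes_le:
  obtains C where "0 < C" "\<And>M. real (card (codes M)) \<le> C * exp (\<eta> * (real M + 1))"
proof -
  define k where "k = (real (card K)) ^ 2 * (real (card (insert 0 F))) ^ 2"
  have card: "real (card (codes M)) = (real M + 1) ^ 2 * k" for M
    unfolding codes_def k_def card_cartesian_product by (simp add: power2_eq_square algebra_simps)
  have k: "0 \<le> k" by (simp add: k_def)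
  show ?thesis
  proof (rule that[of "(2 / \<eta>) ^ 2 * k + 1"])
    show "0 < (2 / \<eta>) ^ 2 * k + 1"
      using k by (intro add_nonneg_pos mult_nonneg_nonneg) auto
    fix M
    have "real (card (codes M)) \<le> ((2 / \<eta>) ^ 2 * exp (\<eta> * (real M + 1))) * k"
      unfolding card using square_le_exp[OF \<eta>, of "real M + 1"] k by (intro mult_right_mono) auto
    also have "\<dots> \<le> ((2 / \<eta>) ^ 2 * k + 1) * exp (\<eta> * (real M + 1))"
      by (simp add: algebra_simps)
    finally show "real (card (codes M)) \<le> ((2 / \<eta>) ^ 2 * k + 1) * exp (\<eta> * (real M + 1))" .
  qed
qed

lemma separated_sum_growth_le:
  "limsup (\<lambda>n. ereal_ln (separated_sum (shift_metric A \<rho> \<theta>) shift \<phi> n \<epsilon>) / ereal (real n)) \<le> ereal (P + 3 * \<eta>)"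
proof -
  obtain C where C: "0 < C" "\<And>M. real (card (codes M)) \<le> C * exp (\<eta> * (real M + 1))"
    by (rule card_codes_le) (rule that)
  define C' where "C' = ln C + \<eta> + code_const + real m * (rate + \<eta>)"
  have le: "ereal_ln (separated_sum (shift_metric A \<rho> \<theta>) shift \<phi> n \<epsilon>) / ereal (real n)
      \<le> ereal ((rate + \<eta>) + C' / real n)" if n: "1 \<le> n" for n
  proof -
    have exponent: "ln C + \<eta> * (real (n + m) + 1) + (real (n + m) * rate + code_const) = real n * (rate + \<eta>) + C'"
      by (simp add: C'_def algebra_simps)
    have "separated_sum (shift_metric A \<rho> \<theta>) shift \<phi> n \<epsilon> \<le> ereal (exp (real n * (rate + \<eta>) + C'))"
      unfolding separated_sum_def
    proof (rule SUP_least, clarsimp simp only: mem_Collect_eq)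
      fix E assume E: "finite E" "separated_set (shift_metric A \<rho> \<theta>) shift n \<epsilon> E"
      have "(\<Sum>x\<in>E. exp (birkhoff_sum n x)) \<le> real (card (codes (n + m))) * exp (real (n + m) * rate + code_const)"
        by (rule separated_set_sum_le[OF E(2,1)])
      also have "\<dots> \<le> (C * exp (\<eta> * (real (n + m) + 1))) * exp (real (n + m) * rate + code_const)"
        by (intro mult_right_mono C(2)) simp
      also have "\<dots> = exp (ln C + \<eta> * (real (n + m) + 1) + (real (n + m) * rate + code_const))"
        unfolding exp_add exp_ln[OF C(1)] by simp
      finally have "(\<Sum>x\<in>E. exp (birkhoff_sum n x)) \<le> exp (real n * (rate + \<eta>) + C')"
        unfolding exponent .
      then show "ereal (\<Sum>x\<in>E. exp (\<Sum>i<n. \<phi> ((shift ^^ i) x))) \<le> ereal (exp (real n * (rate + \<eta>) + C'))"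
        unfolding birkhoff_sum_def ereal_less_eq(3) .
    qed
    then have "ereal_ln (separated_sum (shift_metric A \<rho> \<theta>) shift \<phi> n \<epsilon>) \<le> ereal (real n * (rate + \<eta>) + C')"
      using ereal_ln_mono ereal_ln_ereal[OF exp_gt_zero] by (metis ln_exp)
    then have "ereal_ln (separated_sum (shift_metric A \<rho> \<theta>) shift \<phi> n \<epsilon>) / ereal (real n)
        \<le> ereal (real n * (rate + \<eta>) + C') / ereal (real n)"
      using n by (intro ereal_divide_right_mono) auto
    also have "\<dots> = ereal ((rate + \<eta>) + C' / real n)"
      using n by (simp add: field_simps)
    finally show ?thesis .
  qed
  have "limsup (\<lambda>n. ereal_ln (separated_sum (shift_metric A \<rho> \<theta>) shift \<phi> n \<epsilon>) / ereal (real n))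
      \<le> limsup (\<lambda>n. ereal ((rate + \<eta>) + C' / real n))"
    using le by (intro Limsup_mono eventually_sequentiallyI[of 1])
  also have "\<dots> = ereal (rate + \<eta>)"
  proof (rule lim_imp_Limsup)
    have "(\<lambda>n. (rate + \<eta>) + C' / real n) \<longlonglongrightarrow> (rate + \<eta>) + 0"
      by (intro tendsto_intros lim_const_over_n)
    then show "(\<lambda>n. ereal ((rate + \<eta>) + C' / real n)) \<longlonglongrightarrow> ereal (rate + \<eta>)"
      by simp
  qed simp
  also have "rate + \<eta> = P + 3 * \<eta>"
    by (simp add: rate_def)
  finally show ?thesis .
qed

end

context shift_potential
begin

text \<open>Map every vertex to a nearby point of a finite net.\<close>

lemma finite_vertex_classes:
  assumes tb: "Metric_space.mtotally_bounded (mspace \<rho>) (mdist \<rho>) verts" and r: "0 < r"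
  obtains K :: "nat set" and cls :: "nat \<Rightarrow> nat" where "finite K" "\<And>v. v \<in> verts \<Longrightarrow> cls v \<in> K"
    "\<And>v w. v \<in> verts \<Longrightarrow> w \<in> verts \<Longrightarrow> cls v = cls w \<Longrightarrow> mdist \<rho> v w \<le> r"
proof -
  interpret Metric_space "mspace \<rho>" "mdist \<rho>" by simp
  have "0 < r / 2" using r by simp
  then obtain K where K: "finite K" "K \<subseteq> verts" "verts \<subseteq> (\<Union>x\<in>K. mball x (r / 2))"
    using tb unfolding mtotally_bounded_def by metis
  then have "\<forall>v\<in>verts. \<exists>x\<in>K. v \<in> mball x (r / 2)" by blast
  then obtain cls where cls: "\<And>v. v \<in> verts \<Longrightarrow> cls v \<in> K" "\<And>v. v \<in> verts \<Longrightarrow> v \<in> mball (cls v) (r / 2)"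
    by metis
  show ?thesis
  proof (rule that[OF K(1) cls(1)])
    fix v w assume vw: "v \<in> verts" "w \<in> verts" "cls v = cls w"
    have d: "mdist \<rho> (cls v) v < r / 2" "mdist \<rho> (cls v) w < r / 2"
      using cls(2)[OF vw(1)] cls(2)[OF vw(2)] vw(3) by (auto simp: in_mball)
    have "mdist \<rho> v w \<le> mdist \<rho> v (cls v) + mdist \<rho> (cls v) w"
      using vw cls(1)[OF vw(1)] K(2) mspace_rho by (intro mdist_triangle) auto
    with d show "mdist \<rho> v w \<le> r"
      using mdist_commute[of \<rho> v "cls v"] by linarith
  qed
qed

text \<open>Take one level of the arrangement whose sectors have diameter less than \<open>r\<close>, and for \<open>F\<close> the initial
  segment of vertices that belongs to it.\<close>

lemma sectors_of_small_diameter: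
  assumes sectors: "sectorially_arranged A \<rho>" and r: "0 < r"
  obtains F \<S> where "finite F" "F \<subseteq> verts" "F \<noteq> {}" "verts \<subseteq> F \<union> \<Union>\<S>"
    "\<And>S. S \<in> \<S> \<Longrightarrow> S \<subseteq> verts" "\<And>S. S \<in> \<S> \<Longrightarrow> infinite S" "\<And>S. S \<in> \<S> \<Longrightarrow> connected_vertices A S"
    "\<And>S i j. S \<in> \<S> \<Longrightarrow> i \<in> S \<Longrightarrow> j \<in> S \<Longrightarrow> mdist \<rho> i j \<le> r"
    "\<And>S S'. S \<in> \<S> \<Longrightarrow> S' \<in> \<S> \<Longrightarrow> S \<noteq> S' \<Longrightarrow> \<not> leads_to A S S'"
proof -
  obtain N :: "nat \<Rightarrow> nat" and \<delta> :: "nat \<Rightarrow> real" and p :: "nat \<Rightarrow> enat" and S :: "nat \<Rightarrow> nat \<Rightarrow> nat set"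
    where N: "\<forall>k\<ge>1. 1 \<le> N k" and "filterlim N at_top sequentially" and \<delta>: "\<delta> \<longlonglongrightarrow> 0"
      and levels: "\<forall>k\<ge>1. 1 \<le> p k \<and>
           verts = {1..N k} \<union> (\<Union>i\<in>{i. 1 \<le> i \<and> enat i \<le> p k}. S k i) \<and>
           disjoint_family_on (S k) {i. 1 \<le> i \<and> enat i \<le> p k} \<and>
           (\<forall>i\<in>{i. 1 \<le> i \<and> enat i \<le> p k}. infinite (S k i) \<and> connected_vertices A (S k i) \<and>
                     vertex_diameter \<rho> (S k i) < \<delta> k) \<and>
           (\<forall>i\<in>{i. 1 \<le> i \<and> enat i \<le> p k}. \<forall>i'\<in>{i. 1 \<le> i \<and> enat i \<le> p k}.
              i \<noteq> i' \<longrightarrow> \<not> leads_to A (S k i) (S k i')) \<and>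
           (k \<ge> 2 \<longrightarrow> (\<forall>i\<in>{i. 1 \<le> i \<and> enat i \<le> p k}.
              \<exists>i'\<in>{i. 1 \<le> i \<and> enat i \<le> p (k - 1)}. S k i \<subseteq> S (k - 1) i'))"
    using sectors unfolding sectorially_arranged_def Let_def by (elim exE conjE) (rule that)
  have "\<forall>\<^sub>F k in sequentially. \<delta> k < r \<and> 1 \<le> k"
    using order_tendstoD(2)[OF \<delta> r] eventually_ge_at_top[of 1] by eventually_elim simp
  then obtain k where k: "\<delta> k < r" "1 \<le> k"
    using eventually_happens'[OF sequentially_bot] by blast
  let ?I = "{i. 1 \<le> i \<and> enat i \<le> p k}"
  have cover: "verts = {1..N k} \<union> (\<Union>i\<in>?I. S k i)"
    and sector: "\<forall>i\<in>?I. infinite (S k i) \<and> connected_vertices A (S k i) \<and> vertex_diameter \<rho> (S k i) < \<delta> k"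
    and apart: "\<forall>i\<in>?I. \<forall>i'\<in>?I. i \<noteq> i' \<longrightarrow> \<not> leads_to A (S k i) (S k i')"
    using levels[rule_format, OF k(2)] by - (elim conjE, assumption)+
  have sub: "S k i \<subseteq> verts" if "i \<in> ?I" for i
    using cover that by blast
  show ?thesis
  proof (rule that[of "{1..N k}" "S k ` ?I"])
    show "{1..N k} \<noteq> {}" using N k(2) by simp
    show "verts \<subseteq> {1..N k} \<union> \<Union> (S k ` ?I)" using cover by blast
    show "T \<subseteq> verts" "infinite T" "connected_vertices A T" if "T \<in> S k ` ?I" for T
      using that sub sector by blast+
    show "mdist \<rho> i j \<le> r" if "T \<in> S k ` ?I" "i \<in> T" "j \<in> T" for T i j
    proof -
      have "T \<subseteq> verts" "vertex_diameter \<rho> T < \<delta> k"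
        using that(1) sub sector by blast+
      moreover have "mdist \<rho> i j \<le> vertex_diameter \<rho> T"
      proof -
        have "bdd_above ((\<lambda>(i, j). mdist \<rho> i j) ` (T \<times> T))"
          using rho_le_1 \<open>T \<subseteq> verts\<close> by (intro bdd_aboveI[of _ 1]) auto
        moreover have "(i, j) \<in> T \<times> T" using that by simp
        ultimately have "(\<lambda>(i, j). mdist \<rho> i j) (i, j) \<le> vertex_diameter \<rho> T"
          unfolding vertex_diameter_def by (intro cSUP_upper)
        then show ?thesis by simp
      qed
      ultimately show ?thesis using k(1) by linarith
    qed
    show "\<not> leads_to A T T'" if T: "T \<in> S k ` ?I" "T' \<in> S k ` ?I" "T \<noteq> T'" for T T'
    proof -
      obtain i i' where i: "i \<in> ?I" "T = S k i" and i': "i' \<in> ?I" "T' = S k i'"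
        using T(1,2) by (elim imageE)
      then have "i \<noteq> i'" using T(3) by metis
      with apart[rule_format, OF i(1) i'(1)] show ?thesis
        unfolding i(2) i'(2) .
    qed
  qed (auto simp: verts_def)
qed

text \<open>Stating the bound for every real upper bound \<open>P\<close> of the variational pressure covers the infinite
  case as well.\<close>

theorem topological_pressure_le_shift_pressure:
  assumes mixing: "topologically_mixing A"
    and tb: "Metric_space.mtotally_bounded (mspace \<rho>) (mdist \<rho>) verts"
    and sectors: "sectorially_arranged A \<rho>"
  shows "topological_pressure (shift_metric A \<rho> \<theta>) shift \<phi> \<le> shift_pressure A \<phi>"
proof (rule ereal_le_real)
  fix P :: real assume P: "shift_pressure A \<phi> \<le> ereal P"
  show "topological_pressure (shift_metric A \<rho> \<theta>) shift \<phi> \<le> ereal P"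
    unfolding topological_pressure_eq_SUP
  proof (rule SUP_least)
    fix \<epsilon> :: real assume "\<epsilon> \<in> {0<..}"
    then have \<epsilon>: "0 < \<epsilon>" by simp
    show "limsup (\<lambda>n. ereal_ln (separated_sum (shift_metric A \<rho> \<theta>) shift \<phi> n \<epsilon>) / ereal (real n)) \<le> ereal P"
    proof (rule ereal_le_epsilon2)
      fix e :: real assume e: "0 < e"
      define \<eta> where "\<eta> = e / 3"
      have \<eta>: "0 < \<eta>" using e by (simp add: \<eta>_def)
      obtain \<kappa> m where \<kappa>: "0 < \<kappa>" and mod:
        "\<And>x y. x \<in> X \<Longrightarrow> y \<in> X \<Longrightarrow> (\<And>i. i < m \<Longrightarrow> mdist \<rho> (x i) (y i) \<le> \<kappa>) \<Longrightarrow> \<bar>\<phi> x - \<phi> y\<bar> \<le> \<eta> \<and> D x y \<le> \<epsilon>"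
        using modulus[OF \<eta> \<epsilon>] by blast
      have \<kappa>3: "0 < \<kappa> / 3" using \<kappa> by simp
      obtain K :: "nat set" and cls :: "nat \<Rightarrow> nat" where K: "finite K" "\<And>v. v \<in> verts \<Longrightarrow> cls v \<in> K"
        "\<And>v w. v \<in> verts \<Longrightarrow> w \<in> verts \<Longrightarrow> cls v = cls w \<Longrightarrow> mdist \<rho> v w \<le> \<kappa> / 3"
        by (rule finite_vertex_classes[OF tb \<kappa>3]) (rule that; assumption)
      obtain F \<S> where F: "finite F" "F \<subseteq> verts" "F \<noteq> {}" "verts \<subseteq> F \<union> \<Union>\<S>"
        and S: "\<And>S. S \<in> \<S> \<Longrightarrow> S \<subseteq> verts" "\<And>S. S \<in> \<S> \<Longrightarrow> infinite S" "\<And>S. S \<in> \<S> \<Longrightarrow> connected_vertices A S"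
          "\<And>S i j. S \<in> \<S> \<Longrightarrow> i \<in> S \<Longrightarrow> j \<in> S \<Longrightarrow> mdist \<rho> i j \<le> \<kappa> / 3"
          "\<And>S S'. S \<in> \<S> \<Longrightarrow> S' \<in> \<S> \<Longrightarrow> S \<noteq> S' \<Longrightarrow> \<not> leads_to A S S'"
        by (rule sectors_of_small_diameter[OF sectors \<kappa>3]) (rule that; assumption)
      obtain Q where Q: "\<And>a b. a \<in> F \<Longrightarrow> b \<in> F \<Longrightarrow> \<exists>q u. 0 < q \<and> q \<le> Q \<and> walk A verts q u \<and> u 0 = a \<and> u q = b"
        by (rule closing_walks_bounded[OF mixing F(1,2)]) (rule that)
      interpret sector_cover A \<rho> \<theta> \<phi> F \<S> P \<eta> \<kappa> \<epsilon> m Q K cls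
        by unfold_locales (fact mixing P \<eta> \<kappa> F S K mod Q)+
      have "ereal P + ereal e = ereal (P + 3 * \<eta>)" by (simp add: \<eta>_def)
      with separated_sum_growth_le
      show "limsup (\<lambda>n. ereal_ln (separated_sum (shift_metric A \<rho> \<theta>) shift \<phi> n \<epsilon>) / ereal (real n)) \<le> ereal P + ereal e"
        by (simp only:)
    qed
  qed
qed

end

section \<open>Passage to the completion\<close>

lemma is_completion_approximating_sequence:
  assumes comp: "is_completion m X \<iota>" and x: "x \<in> mspace X"
  obtains y where "\<And>k :: nat. y k \<in> mspace m" "limitin (mtopology_of X) (\<lambda>k. \<iota> (y k)) x sequentially"
proof -
  interpret Metric_space "mspace X" "mdist X" by simp
  have "x \<in> mtopology closure_of (\<iota> ` mspace m)"
    using comp x by (simp add: is_completion_def mtopology_of_def)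
  then have dense: "\<forall>r>0. \<exists>y\<in>\<iota> ` mspace m. y \<in> mball x r"
    unfolding metric_closure_of by blast
  have "\<exists>y\<in>mspace m. mdist X x (\<iota> y) < 1 / (real k + 1)" for k
  proof -
    have "0 < 1 / (real k + 1)" by simp
    with dense obtain z where "z \<in> \<iota> ` mspace m" "z \<in> mball x (1 / (real k + 1))" by blast
    then show ?thesis by auto
  qed
  then obtain y where y: "\<And>k. y k \<in> mspace m" "\<And>k. mdist X x (\<iota> (y k)) < 1 / (real k + 1)"
    by metis
  have "limitin mtopology (\<lambda>k. \<iota> (y k)) x sequentially"
    unfolding limitin_metric
  proof (intro conjI x allI impI)
    fix e :: real assume "0 < e"
    then obtain n where n: "1 / (real n + 1) < e"
      using reals_Archimedean by (metis inverse_eq_divide of_nat_Suc add.commute)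
    show "\<forall>\<^sub>F k in sequentially. \<iota> (y k) \<in> mspace X \<and> mdist X (\<iota> (y k)) x < e"
    proof (rule eventually_sequentiallyI[of n])
      fix k assume "n \<le> k"
      then have "1 / (real k + 1) \<le> 1 / (real n + 1)"
        by (intro divide_left_mono) auto
      then show "\<iota> (y k) \<in> mspace X \<and> mdist X (\<iota> (y k)) x < e"
        using y[of k] n comp mdist_commute[of X x "\<iota> (y k)"] by (auto simp: is_completion_def)
    qed
  qed
  then have "limitin (mtopology_of X) (\<lambda>k. \<iota> (y k)) x sequentially"
    by (simp add: mtopology_of_def)
  with y(1) show ?thesis by (rule that)
qed

lemma limitin_mdist:
  assumes f: "limitin (mtopology_of X) f x F" and g: "limitin (mtopology_of X) g y F"
  shows "((\<lambda>k. mdist X (f k) (g k)) \<longlongrightarrow> mdist X x y) F"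
proof (rule tendstoI)
  fix e :: real assume e: "0 < e"
  interpret Metric_space "mspace X" "mdist X" by simp
  have xy: "x \<in> mspace X" "y \<in> mspace X"
    using f g by (auto simp: mtopology_of_def limitin_metric)
  have "\<forall>\<^sub>F k in F. f k \<in> mspace X \<and> mdist X (f k) x < e / 2" "\<forall>\<^sub>F k in F. g k \<in> mspace X \<and> mdist X (g k) y < e / 2"
    using f g half_gt_zero[OF e] unfolding mtopology_of_def limitin_metric by blast+
  then show "\<forall>\<^sub>F k in F. dist (mdist X (f k) (g k)) (mdist X x y) < e"
  proof eventually_elim
    case (elim k)
    have "mdist X (f k) (g k) \<le> mdist X (f k) x + (mdist X x y + mdist X y (g k))"
      using mdist_triangle[of "f k" X x "g k"] mdist_triangle[of x X y "g k"] elim xy by linarith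
    moreover have "mdist X x y \<le> mdist X x (f k) + (mdist X (f k) (g k) + mdist X (g k) y)"
      using mdist_triangle[of x X "f k" y] mdist_triangle[of "f k" X "g k" y] elim xy by linarith
    ultimately show ?case
      using elim mdist_commute[of X x "f k"] mdist_commute[of X y "g k"] by (simp add: dist_real_def abs_less_iff)
  qed
qed

lemma continuous_map_funpow:
  "continuous_map T T f \<Longrightarrow> continuous_map T T (f ^^ n)"
  by (induction n) (auto simp: id_def[symmetric] intro: continuous_map_compose)

text \<open>The points of a finite separated set are limits of points of the dense subspace. Being separated
  by more than \<open>\<epsilon>\<close> persists along the approximation because the inequality is strict, and the weights
  converge. Positivity of \<open>\<epsilon>\<close> keeps the approximating points distinct.\<close>

lemma separated_sum_completion:
  assumes comp: "is_completion m X \<iota>" and \<epsilon>: "0 < \<epsilon>"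
    and T: "T \<in> mspace m \<rightarrow> mspace m"
    and T': "continuous_map (mtopology_of X) (mtopology_of X) T'" "\<And>x. x \<in> mspace m \<Longrightarrow> T' (\<iota> x) = \<iota> (T x)"
    and f': "continuous_map (mtopology_of X) euclideanreal f'" "\<And>x. x \<in> mspace m \<Longrightarrow> f' (\<iota> x) = f x"
  shows "separated_sum X T' f' n \<epsilon> = separated_sum m T f n \<epsilon>"
proof (rule antisym)
  have \<iota>: "\<iota> x \<in> mspace X" if "x \<in> mspace m" for x
    using comp that by (auto simp: is_completion_def)
  have iso: "mdist X (\<iota> x) (\<iota> y) = mdist m x y" if "x \<in> mspace m" "y \<in> mspace m" for x y
    using comp that by (auto simp: is_completion_def)
  have Tn: "(T ^^ j) x \<in> mspace m" if "x \<in> mspace m" for j x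
    using that T by (induction j) auto
  have T'n: "(T' ^^ j) (\<iota> x) = \<iota> ((T ^^ j) x)" if "x \<in> mspace m" for j x
    using that by (induction j) (auto simp: T'(2) Tn)
  have cong: "(\<Sum>i<n. f' ((T' ^^ i) (\<iota> x))) = (\<Sum>i<n. f ((T ^^ i) x))" if "x \<in> mspace m" for x
    using that by (simp add: T'n f'(2) Tn)
  have \<iota>_inj: "x = y" if "x \<in> mspace m" "y \<in> mspace m" "\<iota> x = \<iota> y" for x y
    using iso[OF that(1,2)] that \<iota> mdist_zero[of "\<iota> y" X "\<iota> y"] mdist_zero[of x m y] by simp
  show "separated_sum m T f n \<epsilon> \<le> separated_sum X T' f' n \<epsilon>"
    unfolding separated_sum_def
  proof (rule SUP_least)
    fix E assume "E \<in> {E. finite E \<and> separated_set m T n \<epsilon> E}"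
    then have E: "finite E" "E \<subseteq> mspace m"
      "\<And>x y. x \<in> E \<Longrightarrow> y \<in> E \<Longrightarrow> x \<noteq> y \<Longrightarrow> \<exists>j<n. \<epsilon> < mdist m ((T ^^ j) x) ((T ^^ j) y)"
      by (auto simp: separated_set_def)
    have inj: "inj_on \<iota> E"
      using \<iota>_inj E(2) by (intro inj_onI) blast
    have "separated_set X T' n \<epsilon> (\<iota> ` E)"
      unfolding separated_set_def
    proof (intro conjI ballI impI)
      show "\<iota> ` E \<subseteq> mspace X" using \<iota> E(2) by blast
      fix u v assume "u \<in> \<iota> ` E" "v \<in> \<iota> ` E" "u \<noteq> v"
      then obtain x y where xy: "x \<in> E" "y \<in> E" "u = \<iota> x" "v = \<iota> y" "x \<noteq> y" by blast
      then obtain j where j: "j < n" "\<epsilon> < mdist m ((T ^^ j) x) ((T ^^ j) y)" using E(3) by blast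
      then have "\<epsilon> < mdist X ((T' ^^ j) u) ((T' ^^ j) v)"
        using xy E(2) by (simp add: T'n iso Tn subset_iff)
      with j(1) show "\<exists>j<n. \<epsilon> < mdist X ((T' ^^ j) u) ((T' ^^ j) v)" by blast
    qed
    moreover have "(\<Sum>x\<in>E. exp (\<Sum>i<n. f ((T ^^ i) x))) = (\<Sum>u\<in>\<iota> ` E. exp (\<Sum>i<n. f' ((T' ^^ i) u)))"
      by (subst sum.reindex[OF inj], rule sum.cong[OF refl]) (simp add: cong subsetD[OF E(2)])
    ultimately show "ereal (\<Sum>x\<in>E. exp (\<Sum>i<n. f ((T ^^ i) x)))
        \<le> (SUP E\<in>{E. finite E \<and> separated_set X T' n \<epsilon> E}. ereal (\<Sum>x\<in>E. exp (\<Sum>i<n. f' ((T' ^^ i) x))))"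
      using E(1) by (intro SUP_upper2[of "\<iota> ` E"]) auto
  qed
  show "separated_sum X T' f' n \<epsilon> \<le> separated_sum m T f n \<epsilon>"
    unfolding separated_sum_def
  proof (rule SUP_least)
    fix E assume "E \<in> {E. finite E \<and> separated_set X T' n \<epsilon> E}"
    then have E: "finite E" "E \<subseteq> mspace X"
      "\<And>x y. x \<in> E \<Longrightarrow> y \<in> E \<Longrightarrow> x \<noteq> y \<Longrightarrow> \<exists>j<n. \<epsilon> < mdist X ((T' ^^ j) x) ((T' ^^ j) y)"
      by (auto simp: separated_set_def)
    have "\<exists>y. (\<forall>k :: nat. y k \<in> mspace m) \<and> limitin (mtopology_of X) (\<lambda>k. \<iota> (y k)) x sequentially" if "x \<in> E" for x
      using is_completion_approximating_sequence[OF comp subsetD[OF E(2) that]] by metis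
    then obtain y where y: "\<And>x k. x \<in> E \<Longrightarrow> y x (k :: nat) \<in> mspace m"
        "\<And>x. x \<in> E \<Longrightarrow> limitin (mtopology_of X) (\<lambda>k. \<iota> (y x k)) x sequentially"
      by metis
    have lim: "limitin (mtopology_of X) (\<lambda>k. (T' ^^ j) (\<iota> (y x k))) ((T' ^^ j) x) sequentially" if "x \<in> E" for x j
      using continuous_map_limit[OF continuous_map_funpow[OF T'(1), of j] y(2)[OF that]] by (simp add: comp_def)
    have "\<forall>\<^sub>F k in sequentially. \<exists>j<n. \<epsilon> < mdist m ((T ^^ j) (y u k)) ((T ^^ j) (y v k))"
      if uv: "u \<in> E" "v \<in> E" "u \<noteq> v" for u v
    proof -
      obtain j where j: "j < n" "\<epsilon> < mdist X ((T' ^^ j) u) ((T' ^^ j) v)" using E(3)[OF uv] by blast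
      have "\<forall>\<^sub>F k in sequentially. \<epsilon> < mdist X ((T' ^^ j) (\<iota> (y u k))) ((T' ^^ j) (\<iota> (y v k)))"
        by (rule order_tendstoD(1)[OF limitin_mdist[OF lim[OF uv(1)] lim[OF uv(2)]] j(2)])
      then show ?thesis
      proof eventually_elim
        case (elim k)
        have "y u k \<in> mspace m" "y v k \<in> mspace m"
          using y(1) uv by blast+
        with elim have "\<epsilon> < mdist m ((T ^^ j) (y u k)) ((T ^^ j) (y v k))"
          by (simp add: T'n iso Tn)
        with j(1) show ?case by blast
      qed
    qed
    then have "\<forall>\<^sub>F k in sequentially. \<forall>u\<in>E. \<forall>v\<in>E. u \<noteq> v \<longrightarrow>
        (\<exists>j<n. \<epsilon> < mdist m ((T ^^ j) (y u k)) ((T ^^ j) (y v k)))"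
      using E(1) by (intro eventually_ball_finite ballI) (auto simp: eventually_mono)
    then have ev: "\<forall>\<^sub>F k in sequentially. ereal (\<Sum>x\<in>E. exp (\<Sum>i<n. f' ((T' ^^ i) (\<iota> (y x k)))))
        \<le> (SUP E\<in>{E. finite E \<and> separated_set m T n \<epsilon> E}. ereal (\<Sum>x\<in>E. exp (\<Sum>i<n. f ((T ^^ i) x))))"
    proof eventually_elim
      case (elim k)
      let ?E = "(\<lambda>x. y x k) ` E"
      have in_m: "y u k \<in> mspace m" if "u \<in> E" for u
        using y(1)[OF that] .
      have inj: "inj_on (\<lambda>x. y x k) E"
      proof (rule inj_onI, rule ccontr)
        fix u v assume uv: "u \<in> E" "v \<in> E" "y u k = y v k" "u \<noteq> v"
        with elim obtain j where "\<epsilon> < mdist m ((T ^^ j) (y u k)) ((T ^^ j) (y v k))" by blast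
        moreover have "mdist m ((T ^^ j) (y u k)) ((T ^^ j) (y v k)) = 0"
          using uv(3) Tn[OF in_m[OF uv(2)], of j] by simp
        ultimately show False
          using \<epsilon> by simp
      qed
      have "separated_set m T n \<epsilon> ?E"
        unfolding separated_set_def
      proof (intro conjI ballI impI)
        show "?E \<subseteq> mspace m" using in_m by blast
        fix a b assume "a \<in> ?E" "b \<in> ?E" "a \<noteq> b"
        then obtain u v where "u \<in> E" "v \<in> E" "a = y u k" "b = y v k" "u \<noteq> v" by blast
        with elim show "\<exists>j<n. \<epsilon> < mdist m ((T ^^ j) a) ((T ^^ j) b)" by blast
      qed
      moreover have "(\<Sum>x\<in>E. exp (\<Sum>i<n. f' ((T' ^^ i) (\<iota> (y x k))))) = (\<Sum>x\<in>?E. exp (\<Sum>i<n. f ((T ^^ i) x)))"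
        by (subst sum.reindex[OF inj], rule sum.cong[OF refl]) (simp add: cong in_m)
      ultimately show ?case
        using E(1) by (intro SUP_upper2[of ?E]) auto
    qed
    have "(\<lambda>k. \<Sum>x\<in>E. exp (\<Sum>i<n. f' ((T' ^^ i) (\<iota> (y x k))))) \<longlonglongrightarrow> (\<Sum>x\<in>E. exp (\<Sum>i<n. f' ((T' ^^ i) x)))"
    proof (intro tendsto_sum tendsto_exp)
      fix x i assume "x \<in> E"
      show "(\<lambda>k. f' ((T' ^^ i) (\<iota> (y x k)))) \<longlonglongrightarrow> f' ((T' ^^ i) x)"
        using continuous_map_limit[OF f'(1) lim[OF \<open>x \<in> E\<close>, of i]] by (simp add: comp_def)
    qed
    then have "(\<lambda>k. ereal (\<Sum>x\<in>E. exp (\<Sum>i<n. f' ((T' ^^ i) (\<iota> (y x k)))))) \<longlonglongrightarrow> ereal (\<Sum>x\<in>E. exp (\<Sum>i<n. f' ((T' ^^ i) x)))"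
      by simp
    then show "ereal (\<Sum>x\<in>E. exp (\<Sum>i<n. f' ((T' ^^ i) x)))
        \<le> (SUP E\<in>{E. finite E \<and> separated_set m T n \<epsilon> E}. ereal (\<Sum>x\<in>E. exp (\<Sum>i<n. f ((T ^^ i) x))))"
      by (rule tendsto_upperbound[OF _ ev]) simp
  qed
qed

theorem theorem1p1:
  fixes A :: "nat \<Rightarrow> nat \<Rightarrow> bool"
    and \<rho> :: "nat metric"
    and \<theta> :: real
    and X :: "'b metric"
    and \<iota> :: "(nat \<Rightarrow> nat) \<Rightarrow> 'b"
    and \<sigma>' :: "'b \<Rightarrow> 'b"
    and \<phi> :: "(nat \<Rightarrow> nat) \<Rightarrow> real"
    and \<phi>' :: "'b \<Rightarrow> real"
  assumes mixing: "topologically_mixing A"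
    and finite_entropy: "finite_entropy A"
    and rho: "vertex_metric \<rho>"
    and totally_bounded: "Metric_space.mtotally_bounded (mspace \<rho>) (mdist \<rho>) verts"
    and theta: "0 < \<theta>" "\<theta> < 1"
    and completion: "is_completion (shift_metric A \<rho> \<theta>) X \<iota>"
    and shift_extension_continuous: "continuous_map (mtopology_of X) (mtopology_of X) \<sigma>'"
    and shift_extension: "\<And>x. x \<in> shift_space A \<Longrightarrow> \<sigma>' (\<iota> x) = \<iota> (shift x)"
    and sectors: "sectorially_arranged A \<rho>"
    and phi: "\<phi> \<in> UC (shift_metric A \<rho> \<theta>)"
    and phi_extension_continuous: "continuous_map (mtopology_of X) euclideanreal \<phi>'"
    and phi_extension: "\<And>x. x \<in> shift_space A \<Longrightarrow> \<phi>' (\<iota> x) = \<phi> x"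
  shows "shift_pressure A \<phi> = topological_pressure X \<sigma>' \<phi>'"
proof -
  interpret shift_potential A \<rho> \<theta> \<phi>
    by unfold_locales (fact rho theta phi)+
  have "separated_sum X \<sigma>' \<phi>' n \<epsilon> = separated_sum (shift_metric A \<rho> \<theta>) shift \<phi> n \<epsilon>" if "0 < \<epsilon>" for n \<epsilon>
  proof (rule separated_sum_completion[OF completion that _ shift_extension_continuous _ phi_extension_continuous])
    show "shift \<in> mspace (shift_metric A \<rho> \<theta>) \<rightarrow> mspace (shift_metric A \<rho> \<theta>)"
      unfolding mspace_X using shift_in_shift_space by blast
  qed (simp_all add: mspace_X shift_extension phi_extension)
  then have "topological_pressure X \<sigma>' \<phi>' = topological_pressure (shift_metric A \<rho> \<theta>) shift \<phi>"
    unfolding topological_pressure_eq_SUP by simp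
  then show ?thesis
    using shift_pressure_le_topological_pressure
      topological_pressure_le_shift_pressure[OF mixing totally_bounded sectors]
    by (simp add: antisym)
qed

end
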